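(* Let $\mathbb K$ be a field, $R=\mathbb K[x_1,\dots,x_n]$, let $\mathbf a=(a_1,\dots,a_n)\in(\mathbb Z\cup\{\infty\})^n$ and let $I\subseteq R$ be an $\mathbf a$-ideal. Let $J=I+(m_1,\dots,m_q)\subseteq R$ be an ideal where the minimal generators $m_i$ are not $\mathbf a$-monomials. If $J$ admits a minimal pruned resolution, then $I$ also admits a minimal pruned resolution.
   Context: A monomial $x_1^{\alpha_1}\cdots x_n^{\alpha_n}$ is an $\mathbf a$-monomial if $\alpha_i\le a_i$ for $i=1,\dots,n$. A monomial ideal is an $\mathbf a$-ideal if it is minimally generated by $\mathbf a$-monomials. The $m_i$ are monomials. $G(I)$ denotes the set of minimal monomial generators of a monomial ideal $I$. Pruned resolutions. For a monomial ideal $I$ with minimal generators in a fixed order $m_1,\dots,m_q$ and $\sigma\subseteq\{1,\dots,q\}$ put $m_\sigma=\mathrm{lcm}(m_i: i\in\sigma)$, $m_\emptyset=1$. The Taylor resolution of $R/I$ is supported on the full simplex $X_{\mathrm{Taylor}}$ on $q$ vertices; the face $\sigma$ has homological degree $|\sigma|$ and multidegree the exponent of $m_\sigma$. Pruning algorithm: for $j=1,\dots,q$ successively (step $j$), for every $\sigma\not\ni j$ with $m_\sigma=m_{\sigma\cup\{j\}}$ and such that neither $\sigma$ nor $\sigma\cup\{j\}$ belongs to a previously selected edge, select (prune) the edge $\{\sigma,\sigma\cup\{j\}\}$. The selected edges form a homogeneous acyclic matching on $X_{\mathrm{Taylor}}$, and discrete Morse theory (Batzies–Welker) yields a $\mathbb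 Z^n$-graded CW-complex, with cells corresponding to the faces in no selected edge (critical faces), supporting a free resolution of $R/I$: the pruned resolution for the given order. Its module in homological degree $i$ is the direct sum of $R(-\deg m_\sigma)$ over critical $\sigma$ with $|\sigma|=i$; so it is minimal iff, for all $i,\alpha$, the number of critical $\sigma$ with $|\sigma|=i$ and multidegree $\alpha$ is $\beta_{i,\alpha}(R/I)$. Betti splitting version. $I=J+K$, with $G(I)$ the disjoint union of $G(J)$ and $G(K)$, is a Betti splitting if $\beta_{i,\alpha}(I)=\beta_{i,\alpha}(J)+\beta_{i,\alpha}(K)+\beta_{i-1,\alpha}(J\cap K)$ for all $i$ and $\alpha\in\mathbb Z^n$. Then one may prune separately the faces with vertices in $G(J)$, the faces with vertices in $G(K)$, and the remaining faces (which account for $J\cap K$), and iterate this using Betti splittings of $J$, $K$, $J\cap K$; this is always a partial pruning of $X_{\mathrm{Taylor}}$, and the numbers of generators (pruned Betti numbers) satisfy $\overline\beta_{i,\alpha}(I)=\overline\beta_{i,\alpha}(J)+\overline\beta_{i,\alpha}(K)+\overline\beta_{i-1,\alpha}(J\cap K)$. $I$ admits a minimal pruned resolution if, for some order of the generators, the cellular resolution given by the pruning algorithm or by its iterated Betti splitting version is minimal. Explicitly (recursively, in finitely many steps): either for some order of $G(I)$ the pruned resolution of $R/I$ is minimal, or there is a Betti splitting $I=J+K$ such that $J$, $K$ and $J\cap K$ all admit minimal pruned resolutions. *)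

theory Defs
  imports
    "HOL-Library.Poly_Mapping"
    "HOL-Library.Function_Algebras"
    "HOL-Library.Set_Algebras"
    "HOL-Library.Extended"
    "Jordan_Normal_Form.Matrix_Kernel"
begin

section \<open>Monomial ideals\<close>

text \<open>
  The variables of R = K[x_1,...,x_n] are indexed by a finite type. Exponent vectors are functions
  with the pointwise order, addition and lattice structure, so on monomials \<open>\<le>\<close> is divisibility and
  \<open>sup\<close> is the least common multiple.
\<close>

type_synonym ('n, 'k) mpoly = "('n \<Rightarrow> nat) \<Rightarrow>\<^sub>0 'k"

definition monomial :: "('n \<Rightarrow> nat) \<Rightarrow> ('n, 'k::field) mpoly" where
  "monomial t = Poly_Mapping.single t 1"

definition gen_ideal :: "('n, 'k::field) mpoly set \<Rightarrow> ('n, 'k) mpoly set" where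
  "gen_ideal S = Modules.module.span (*) S"

definition monomial_ideal :: "('n::finite, 'k::field) mpoly set \<Rightarrow> bool" where
  "monomial_ideal I \<longleftrightarrow> (\<exists>T. I = gen_ideal (monomial ` T))"

text \<open>The exponents of the minimal monomial generators, usually written G(I).\<close>

definition min_gens :: "('n::finite, 'k::field) mpoly set \<Rightarrow> ('n \<Rightarrow> nat) set" where
  "min_gens I = {t. monomial t \<in> I \<and> (\<forall>s. monomial s \<in> I \<and> s \<le> t \<longrightarrow> s = t)}"

definition a_monomial :: "('n \<Rightarrow> int extended) \<Rightarrow> ('n \<Rightarrow> nat) \<Rightarrow> bool" where
  "a_monomial a t \<longleftrightarrow> (\<forall>v. Fin (int (t v)) \<le> a v)"

definition a_ideal :: "('n \<Rightarrow> int extended) \<Rightarrow> ('n::finite, 'k::field) mpoly set \<Rightarrow> bool" where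
  "a_ideal a I \<longleftrightarrow> monomial_ideal I \<and> (\<forall>t\<in>min_gens I. a_monomial a t)"


section \<open>Multigraded free resolutions and Betti numbers\<close>

definition mdeg :: "('n \<Rightarrow> nat) \<Rightarrow> ('n \<Rightarrow> int)" where
  "mdeg t = (\<lambda>v. int (t v))"

definition homogeneous :: "('n \<Rightarrow> int) \<Rightarrow> ('n, 'k::field) mpoly \<Rightarrow> bool" where
  "homogeneous \<delta> f \<longleftrightarrow> (\<forall>t\<in>Poly_Mapping.keys f. mdeg t = \<delta>)"

text \<open>
  A complex of free modules
  F_i = R(- shift i 0) + ... + R(- shift i (rank i - 1)) (direct sum),
  where \<open>diff i\<close> is the matrix of the differential from F_(i+1) to F_i and \<open>aug\<close> is the row of the
  augmentation of F_0.
\<close>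

record (overloaded) ('n, 'k) free_complex =
  rank :: "nat \<Rightarrow> nat"
  shift :: "nat \<Rightarrow> nat \<Rightarrow> 'n \<Rightarrow> int"
  diff :: "nat \<Rightarrow> ('n, 'k) mpoly mat"
  aug :: "('n, 'k) mpoly vec"

definition image_mat :: "'a::comm_ring_1 mat \<Rightarrow> 'a vec set" where
  "image_mat D = {D *\<^sub>v w | w. w \<in> carrier_vec (dim_col D)}"

text \<open>
  Resolutions of the graded module A/B, for monomial ideals B contained in A; this covers both
  an ideal I = I/0 and the quotient R/I. The augmentation is given by a lift F_0 \<open>\<rightarrow>\<close> A of the map
  F_0 \<open>\<rightarrow>\<close> A/B, which exists because F_0 is free. The last two conditions are exactness at F_0 and at
  F_(i+1).
\<close>

definition free_resolution ::
  "('n::finite, 'k::field) mpoly set \<Rightarrow> ('n, 'k) mpoly set \<Rightarrow> ('n, 'k) free_complex \<Rightarrow> bool" where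
  "free_resolution A B F \<longleftrightarrow>
     aug F \<in> carrier_vec (rank F 0) \<and>
     (\<forall>j<rank F 0. aug F $ j \<in> A \<and> homogeneous (shift F 0 j) (aug F $ j)) \<and>
     (\<forall>i. diff F i \<in> carrier_mat (rank F i) (rank F (Suc i))) \<and>
     (\<forall>i. \<forall>j<rank F i. \<forall>k<rank F (Suc i).
        homogeneous (shift F (Suc i) k - shift F i j) (diff F i $$ (j, k))) \<and>
     (\<forall>f\<in>A. \<exists>w\<in>carrier_vec (rank F 0). f - aug F \<bullet> w \<in> B) \<and>
     {w \<in> carrier_vec (rank F 0). aug F \<bullet> w \<in> B} = image_mat (diff F 0) \<and>
     (\<forall>i. mat_kernel (diff F i) = image_mat (diff F (Suc i)))"

text \<open>
  Minimality: the differentials map F_(i+1) into (x_1,...,x_n) F_i, that is, all matrix entries have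
  zero constant term.
\<close>

definition minimal_free_resolution ::
  "('n::finite, 'k::field) mpoly set \<Rightarrow> ('n, 'k) mpoly set \<Rightarrow> ('n, 'k) free_complex \<Rightarrow> bool" where
  "minimal_free_resolution A B F \<longleftrightarrow> free_resolution A B F \<and>
     (\<forall>i. \<forall>j<rank F i. \<forall>k<rank F (Suc i). Poly_Mapping.lookup (diff F i $$ (j, k)) 0 = 0)"

text \<open>
  Minimal multigraded free resolutions exist and are unique up to isomorphism, so the choice
  does not matter.
\<close>

definition betti ::
  "('n::finite, 'k::field) mpoly set \<Rightarrow> ('n, 'k) mpoly set \<Rightarrow> nat \<Rightarrow> ('n \<Rightarrow> int) \<Rightarrow> nat" where
  "betti A B i \<alpha> =
     (let F = (SOME F. minimal_free_resolution A B F) in card {j. j < rank F i \<and> shift F i j = \<alpha>})"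

abbreviation betti_ideal ::
  "('n::finite, 'k::field) mpoly set \<Rightarrow> nat \<Rightarrow> ('n \<Rightarrow> int) \<Rightarrow> nat" where
  "betti_ideal I \<equiv> betti I {0}"

abbreviation betti_quotient ::
  "('n::finite, 'k::field) mpoly set \<Rightarrow> nat \<Rightarrow> ('n \<Rightarrow> int) \<Rightarrow> nat" where
  "betti_quotient I \<equiv> betti UNIV I"


section \<open>Pruned resolutions\<close>

text \<open>The generators are numbered from 0. Inserting the exponent 0 makes the lcm over \<open>{}\<close> equal to 1.\<close>

definition lcm_face :: "('n \<Rightarrow> nat) list \<Rightarrow> nat set \<Rightarrow> ('n \<Rightarrow> nat)" where
  "lcm_face ms \<sigma> = Sup_fin (insert 0 ((!) ms ` \<sigma>))"

text \<open>
  \<open>pruned_edges ms j\<close> is the set of edges selected in the first j steps. The candidate edges of one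
  step are pairwise disjoint, so they can be selected simultaneously.
\<close>

primrec pruned_edges :: "('n \<Rightarrow> nat) list \<Rightarrow> nat \<Rightarrow> nat set set set" where
  "pruned_edges ms 0 = {}"
| "pruned_edges ms (Suc j) = pruned_edges ms j \<union>
     {{\<sigma>, insert j \<sigma>} | \<sigma>. \<sigma> \<subseteq> {..<length ms} \<and> j \<notin> \<sigma> \<and>
        lcm_face ms \<sigma> = lcm_face ms (insert j \<sigma>) \<and>
        \<sigma> \<notin> \<Union>(pruned_edges ms j) \<and> insert j \<sigma> \<notin> \<Union>(pruned_edges ms j)}"

definition critical_faces :: "('n \<Rightarrow> nat) list \<Rightarrow> nat set set" where
  "critical_faces ms = Pow {..<length ms} - \<Union>(pruned_edges ms (length ms))"

text \<open>
  The generators of the pruned resolution of R/I in homological degree i and multidegree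
  \<open>\<alpha>\<close> correspond to the critical faces with i vertices and multidegree \<open>\<alpha>\<close>; being a free resolution
  of R/I, it is minimal iff their numbers are the Betti numbers.
\<close>

definition minimal_pruned_order ::
  "('n::finite, 'k::field) mpoly set \<Rightarrow> ('n \<Rightarrow> nat) list \<Rightarrow> bool" where
  "minimal_pruned_order I ms \<longleftrightarrow> distinct ms \<and> set ms = min_gens I \<and>
     (\<forall>i \<alpha>. card {\<sigma> \<in> critical_faces ms. card \<sigma> = i \<and> mdeg (lcm_face ms \<sigma>) = \<alpha>} =
        betti_quotient I i \<alpha>)"

definition betti_splitting ::
  "('n::finite, 'k::field) mpoly set \<Rightarrow> ('n, 'k) mpoly set \<Rightarrow> ('n, 'k) mpoly set \<Rightarrow> bool" where
  "betti_splitting I J K \<longleftrightarrow> monomial_ideal J \<and> monomial_ideal K \<and> I = J + K \<and>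
     min_gens I = min_gens J \<union> min_gens K \<and> min_gens J \<inter> min_gens K = {} \<and>
     (\<forall>i \<alpha>. betti_ideal I i \<alpha> = betti_ideal J i \<alpha> + betti_ideal K i \<alpha> +
        (if i = 0 then 0 else betti_ideal (J \<inter> K) (i - 1) \<alpha>))"

inductive admits_minimal_pruned_resolution :: "('n::finite, 'k::field) mpoly set \<Rightarrow> bool" where
  order: "monomial_ideal I \<Longrightarrow> minimal_pruned_order I ms \<Longrightarrow> admits_minimal_pruned_resolution I"
| splitting: "betti_splitting I J K \<Longrightarrow> admits_minimal_pruned_resolution J \<Longrightarrow>
     admits_minimal_pruned_resolution K \<Longrightarrow> admits_minimal_pruned_resolution (J \<inter> K) \<Longrightarrow>
     admits_minimal_pruned_resolution I"

end

theory Submission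
  imports Defs
begin

text \<open>
  Write \<open>J'\<close> for the ideal generated by the \<open>a\<close>-monomials in G(J). In a minimal multigraded free
  resolution of R/J (or of J) the summands whose shift is at most \<open>a\<close> form a minimal free resolution
  of R/J' (or of J'): in degree \<open>\<alpha>\<close> the truncated complex coincides with the full complex in degree
  \<open>min \<alpha> a\<close>. Hence the Betti numbers of J' are those of J in the degrees at most \<open>a\<close>, and 0 elsewhere.
  Pruning is homogeneous, and the faces of multidegree at most \<open>a\<close> are those with all vertices in G(J'),
  so with the induced order of G(J') the critical faces are the critical faces for J of multidegree at
  most \<open>a\<close>. Truncation is compatible with sums and intersections, hence with Betti splittings. If all
  \<open>a\<^sub>i\<close> are nonnegative, then I = J' by hypothesis; otherwise I = 0.

  Since Betti numbers are defined through an arbitrary minimal resolution, existence (choose minimal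
  generators of the successive syzygies; Dickson's lemma makes them finite) and uniqueness (comparison
  maps are invertible modulo the variables) of minimal resolutions are needed as well.
\<close>

section \<open>Graded complexes over a field\<close>

text \<open>Both rules of \<open>admits_minimal_pruned_resolution\<close> only compare numbers of
  faces or generators with Betti numbers, so no cellular map has to be constructed.

  Polynomial matrices are avoided for most of the proof. Once the monomials are divided out, the
  strands of a free module in all degrees are subspaces of one space of functions on its cells, and
  multiplication by a monomial becomes an inclusion of strands. Truncation then means deleting
  cells, and exactness is linear algebra in each degree. Degree predicates in place of ideals can
  simply be composed with the map that cuts degrees.

  The case of a negative bound has to be split off because of R/J: the generator 1 of R has degree
  0, which is then not below \<open>a\<close>, so truncation would delete it and no longer resolve a
  quotient of R. An infinite bound is harmless; it leaves its coordinate uncut.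

  Resolutions are built by dependent choice, level after level, and no bound on their length
  enters.\<close>

definition fsupp :: "nat set \<Rightarrow> (nat \<Rightarrow> 'd::order) \<Rightarrow> 'd \<Rightarrow> (nat \<Rightarrow> 'k::zero) set" where
  "fsupp N s \<alpha> = {u. \<forall>j. u j \<noteq> 0 \<longrightarrow> j \<in> N \<and> s j \<le> \<alpha>}"

definition mapply :: "nat set \<Rightarrow> (nat \<Rightarrow> nat \<Rightarrow> 'k::comm_ring_1) \<Rightarrow> (nat \<Rightarrow> 'k) \<Rightarrow> nat \<Rightarrow> 'k" where
  "mapply N P u = (\<lambda>j. \<Sum>k\<in>N. P j k * u k)"

definition mmul :: "nat set \<Rightarrow> (nat \<Rightarrow> nat \<Rightarrow> 'k::comm_ring_1) \<Rightarrow> (nat \<Rightarrow> nat \<Rightarrow> 'k) \<Rightarrow> nat \<Rightarrow> nat \<Rightarrow> 'k" where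
  "mmul N P Q = (\<lambda>j k. \<Sum>l\<in>N. P j l * Q l k)"

text \<open>Entries vanish outside \<open>N\<close> times \<open>T\<close>, so identities between
  matrices can be stated as equalities of functions without index bounds. The condition
  \<open>s j \<le> t k\<close> says that the monomial of exponent \<open>t k - s j\<close> carrying
  the entry exists.\<close>

definition graded :: "nat set \<Rightarrow> (nat \<Rightarrow> 'd::order) \<Rightarrow> nat set \<Rightarrow> (nat \<Rightarrow> 'd) \<Rightarrow> (nat \<Rightarrow> nat \<Rightarrow> 'k::zero) \<Rightarrow> bool" where
  "graded N s T t P \<longleftrightarrow> (\<forall>j k. P j k \<noteq> 0 \<longrightarrow> j \<in> N \<and> k \<in> T \<and> s j \<le> t k)"

lemma mmul_col: "(\<lambda>j. mmul N P Q j k) = mapply N P (\<lambda>l. Q l k)"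
  by (simp add: mmul_def mapply_def)

lemma mmul_assoc:
  assumes "finite M" "finite N"
  shows "mmul N (mmul M P Q) R = mmul M P (mmul N Q R)"
proof (intro ext)
  fix j k
  have "mmul N (mmul M P Q) R j k = (\<Sum>l\<in>N. \<Sum>x\<in>M. P j x * Q x l * R l k)"
    by (simp add: mmul_def sum_distrib_right)
  also have "\<dots> = (\<Sum>x\<in>M. \<Sum>l\<in>N. P j x * Q x l * R l k)"
    by (rule sum.swap)
  also have "\<dots> = mmul M P (mmul N Q R) j k"
    by (simp add: mmul_def sum_distrib_left mult.assoc)
  finally show "mmul N (mmul M P Q) R j k = mmul M P (mmul N Q R) j k" .
qed

lemma mmul_diff_left: "mmul N (\<lambda>j k. P j k - Q j k) R = (\<lambda>j k. mmul N P R j k - mmul N Q R j k)"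
  by (simp add: mmul_def left_diff_distrib sum_subtractf)

lemma mmul_diff_right: "mmul N R (\<lambda>j k. P j k - Q j k) = (\<lambda>j k. mmul N R P j k - mmul N R Q j k)"
  by (simp add: mmul_def right_diff_distrib sum_subtractf)

lemma mmul_id_left:
  assumes "finite N" "\<And>j k. P j k \<noteq> 0 \<Longrightarrow> j \<in> N"
  shows "mmul N (\<lambda>j k. if j = k \<and> j \<in> N then 1 else 0) P = P"
proof (intro ext)
  fix j k
  show "mmul N (\<lambda>j k. if j = k \<and> j \<in> N then 1 else 0) P j k = P j k"
  proof (cases "j \<in> N")
    case True
    have "mmul N (\<lambda>j k. if j = k \<and> j \<in> N then 1 else 0) P j k = (\<Sum>l\<in>N. if j = l then P l k else 0)"
      unfolding mmul_def by (intro sum.cong) (use True in auto)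
    then show ?thesis using True assms(1) by simp
  next
    case False
    then show ?thesis using assms(2) by (auto simp: mmul_def)
  qed
qed

lemma graded_col: "graded N s T t P \<Longrightarrow> (\<lambda>j. P j k) \<in> fsupp N s (t k)"
  by (auto simp: graded_def fsupp_def)

lemma mapply_fsupp:
  assumes "graded N s T t P" "u \<in> fsupp T t \<alpha>"
  shows "mapply T P u \<in> fsupp N s \<alpha>"
  unfolding fsupp_def mem_Collect_eq
proof (intro allI impI)
  fix j assume "mapply T P u j \<noteq> 0"
  then obtain k where "k \<in> T" "P j k * u k \<noteq> 0"
    unfolding mapply_def by (meson sum.neutral)
  then have "P j k \<noteq> 0" "u k \<noteq> 0" by auto
  then show "j \<in> N \<and> s j \<le> \<alpha>"
    using assms unfolding graded_def fsupp_def mem_Collect_eq by (meson order_trans)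
qed

lemma graded_mmul:
  assumes "graded N s M r P" "graded M r T t Q"
  shows "graded N s T t (mmul M P Q)"
  unfolding graded_def
proof (intro allI impI)
  fix j k assume "mmul M P Q j k \<noteq> 0"
  then obtain l where "l \<in> M" "P j l * Q l k \<noteq> 0"
    unfolding mmul_def by (meson sum.neutral)
  then have "P j l \<noteq> 0" "Q l k \<noteq> 0" by auto
  then show "j \<in> N \<and> k \<in> T \<and> s j \<le> t k"
    using assms unfolding graded_def by (meson order_trans)
qed

lemma graded_diff: "graded N s T t P \<Longrightarrow> graded N s T t Q \<Longrightarrow> graded N s T t (\<lambda>j k. P j k - (Q j k :: 'k::ring))"
  unfolding graded_def by (metis diff_0_right)

text \<open>
  The entries of a homogeneous matrix between graded free modules are scalars times monomials that
  are determined by the shifts. So a complex of such modules amounts to the matrices \<open>bd\<close> of these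
  scalars, and in each degree \<open>\<alpha>\<close> it is a complex of K-vector spaces, spanned by the cells of degree
  at most \<open>\<alpha>\<close>. In a resolution of A/B the predicates \<open>PA\<close> and \<open>PB\<close> tell in which degrees A and B are
  nonzero.
\<close>

record ('d, 'k) strands =
  cells :: "nat \<Rightarrow> nat set"
  cdeg :: "nat \<Rightarrow> nat \<Rightarrow> 'd"
  bd :: "nat \<Rightarrow> nat \<Rightarrow> nat \<Rightarrow> 'k"
  augc :: "nat \<Rightarrow> 'k"

abbreviation chains :: "('d::order, 'k::comm_ring_1) strands \<Rightarrow> nat \<Rightarrow> 'd \<Rightarrow> (nat \<Rightarrow> 'k) set" where
  "chains X i \<equiv> fsupp (cells X i) (cdeg X i)"

definition bdmap :: "('d, 'k::comm_ring_1) strands \<Rightarrow> nat \<Rightarrow> (nat \<Rightarrow> 'k) \<Rightarrow> nat \<Rightarrow> 'k" where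
  "bdmap X i = mapply (cells X (Suc i)) (bd X i)"

definition augm :: "('d, 'k::comm_ring_1) strands \<Rightarrow> (nat \<Rightarrow> 'k) \<Rightarrow> 'k" where
  "augm X u = (\<Sum>j\<in>cells X 0. augc X j * u j)"

text \<open>At level 0 these are the chains that die in A/B. In a degree where \<open>PB\<close>
  holds the quotient is zero, so every chain counts. With all levels in one function, exactness is a
  single equation.\<close>

primrec cycles :: "('d::order \<Rightarrow> bool) \<Rightarrow> ('d, 'k::comm_ring_1) strands \<Rightarrow> nat \<Rightarrow> 'd \<Rightarrow> (nat \<Rightarrow> 'k) set" where
  "cycles PB X 0 \<alpha> = {u \<in> chains X 0 \<alpha>. augm X u = 0 \<or> PB \<alpha>}"
| "cycles PB X (Suc i) \<alpha> = {u \<in> chains X (Suc i) \<alpha>. bdmap X i u = (\<lambda>_. 0)}"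

text \<open>Strands of A/B have dimension at most one, A and B being monomial. Hence the
  augmentation is scalar, and surjectivity is the existence of one nonzero value.\<close>

definition strand_resolution :: "('d::order \<Rightarrow> bool) \<Rightarrow> ('d \<Rightarrow> bool) \<Rightarrow> ('d, 'k::field) strands \<Rightarrow> bool" where
  "strand_resolution PA PB X \<longleftrightarrow>
     (\<forall>i. finite (cells X i)) \<and>
     (\<forall>i. graded (cells X i) (cdeg X i) (cells X (Suc i)) (cdeg X (Suc i)) (bd X i)) \<and>
     (\<forall>j. augc X j \<noteq> 0 \<longrightarrow> j \<in> cells X 0 \<and> PA (cdeg X 0 j)) \<and>
     (\<forall>\<alpha>. PA \<alpha> \<and> \<not> PB \<alpha> \<longrightarrow> (\<exists>u\<in>chains X 0 \<alpha>. augm X u \<noteq> 0)) \<and>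
     (\<forall>i \<alpha>. cycles PB X i \<alpha> = bdmap X i ` chains X (Suc i) \<alpha>)"

definition minimal_strands :: "('d, 'k::zero) strands \<Rightarrow> bool" where
  "minimal_strands X \<longleftrightarrow> (\<forall>i j k. bd X i j k \<noteq> 0 \<longrightarrow> cdeg X i j \<noteq> cdeg X (Suc i) k)"

section \<open>Lifting through differentials and comparison maps\<close>

lemma cycles_subset: "cycles PB X i \<alpha> \<subseteq> chains X i \<alpha>"
  by (cases i) auto

text \<open>Projectivity of graded free modules: exactness in degree \<open>t k\<close> provides a
  preimage for each column separately.\<close>

lemma lift_through_bd:
  assumes X: "strand_resolution PA PB X"
    and Q: "\<And>k. k \<in> T \<Longrightarrow> (\<lambda>j. Q j k) \<in> cycles PB X i (t k)" "\<And>j k. k \<notin> T \<Longrightarrow> Q j k = 0"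
  obtains P where "graded (cells X (Suc i)) (cdeg X (Suc i)) T t P"
    "mmul (cells X (Suc i)) (bd X i) P = Q"
proof -
  have "\<exists>u. u \<in> chains X (Suc i) (t k) \<and> bdmap X i u = (\<lambda>j. Q j k)" if "k \<in> T" for k
    using Q(1)[OF that] X unfolding strand_resolution_def by (metis imageE)
  then obtain U where U: "\<And>k. k \<in> T \<Longrightarrow> U k \<in> chains X (Suc i) (t k) \<and> bdmap X i (U k) = (\<lambda>j. Q j k)"
    by metis
  define P where "P = (\<lambda>j k. if k \<in> T then U k j else 0)"
  have "graded (cells X (Suc i)) (cdeg X (Suc i)) T t P"
    using U by (auto simp: graded_def P_def fsupp_def)
  moreover have "mmul (cells X (Suc i)) (bd X i) P = Q"
  proof (intro ext)
    fix j k
    show "mmul (cells X (Suc i)) (bd X i) P j k = Q j k"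
      using U[of k] Q(2)[of k j]
      by (cases "k \<in> T") (auto simp: mmul_def P_def bdmap_def mapply_def dest: fun_cong)
  qed
  ultimately show thesis by (rule that)
qed

text \<open>The column is the boundary of the unit chain at \<open>k\<close>, and by exactness
  boundaries are cycles.\<close>

lemma bd_col_cycles:
  assumes X: "strand_resolution PA PB X"
  shows "k \<in> cells X (Suc i) \<Longrightarrow> (\<lambda>j. bd X i j k) \<in> cycles PB X i (cdeg X (Suc i) k)"
proof -
  assume k: "k \<in> cells X (Suc i)"
  define e where "e = (\<lambda>l. if l = k then 1 else 0 :: 'b)"
  have "e \<in> chains X (Suc i) (cdeg X (Suc i) k)"
    using k by (auto simp: e_def fsupp_def)
  moreover have "bdmap X i e = (\<lambda>j. bd X i j k)"
    using k X by (auto simp: e_def bdmap_def mapply_def strand_resolution_def if_distrib cong: if_cong)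
  ultimately show ?thesis
    using X unfolding strand_resolution_def by (metis imageI)
qed

lemma bd_bd:
  assumes X: "strand_resolution PA PB X"
  shows "mmul (cells X (Suc i)) (bd X i) (bd X (Suc i)) = (\<lambda>_ _. 0)"
proof (intro ext)
  fix j k
  show "mmul (cells X (Suc i)) (bd X i) (bd X (Suc i)) j k = 0"
  proof (cases "k \<in> cells X (Suc (Suc i))")
    case True
    then have "bdmap X i (\<lambda>j. bd X (Suc i) j k) = (\<lambda>_. 0)"
      using bd_col_cycles[OF X True] by simp
    then show ?thesis by (auto simp: bdmap_def mmul_def mapply_def dest: fun_cong)
  next
    case False
    then have "bd X (Suc i) l k = 0" for l
      using X unfolding strand_resolution_def graded_def by blast
    then show ?thesis by (simp add: mmul_def)
  qed
qed

text \<open>Every cell occurring in \<open>u\<close> has degree at most \<alpha>, so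
  \<open>PB\<close> fails there too by monotonicity. Hence the hypothesis on generators, which says
  nothing inside \<open>PB\<close>, reaches all of \<open>u\<close>.\<close>

lemma augm_mapply:
  assumes Y: "finite (cells Y 0)" and X: "finite (cells X 0)"
    and P: "\<And>k. k \<in> cells X 0 \<Longrightarrow> \<not> PB (cdeg X 0 k) \<Longrightarrow> augm Y (\<lambda>j. P j k) = augc X k"
    and PB: "mono PB"
    and u: "u \<in> chains X 0 \<alpha>" "\<not> PB \<alpha>"
  shows "augm Y (mapply (cells X 0) P u) = augm X u"
proof -
  have "augm Y (mapply (cells X 0) P u) = (\<Sum>j\<in>cells Y 0. \<Sum>k\<in>cells X 0. augc Y j * P j k * u k)"
    by (simp add: augm_def mapply_def sum_distrib_left mult.assoc)
  also have "\<dots> = (\<Sum>k\<in>cells X 0. \<Sum>j\<in>cells Y 0. augc Y j * P j k * u k)"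
    by (rule sum.swap)
  also have "\<dots> = (\<Sum>k\<in>cells X 0. augm Y (\<lambda>j. P j k) * u k)"
    by (simp add: augm_def sum_distrib_right)
  also have "\<dots> = augm X u"
    unfolding augm_def[of X]
  proof (rule sum.cong[OF refl])
    fix k assume k: "k \<in> cells X 0"
    show "augm Y (\<lambda>j. P j k) * u k = augc X k * u k"
    proof (cases "u k = 0")
      case False
      then have "\<not> PB (cdeg X 0 k)" using u PB by (auto simp: fsupp_def dest: monoD)
      then show ?thesis using P k by simp
    qed simp
  qed
  finally show ?thesis .
qed

text \<open>Level 0 of a comparison map. A chain with nonzero augmentation can be rescaled to the
  required value; where \<open>PB\<close> holds or the value is zero, the zero chain serves.\<close>

lemma augmentation_lift:
  assumes X: "strand_resolution PA PB X" and Y: "strand_resolution PA PB Y"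
  obtains P where "graded (cells Y 0) (cdeg Y 0) (cells X 0) (cdeg X 0) P"
    "\<And>k. k \<in> cells X 0 \<Longrightarrow> \<not> PB (cdeg X 0 k) \<Longrightarrow> augm Y (\<lambda>j. P j k) = augc X k"
proof -
  have "\<exists>u. u \<in> chains Y 0 (cdeg X 0 k) \<and> (\<not> PB (cdeg X 0 k) \<longrightarrow> augm Y u = augc X k)" for k
  proof (cases "PB (cdeg X 0 k) \<or> augc X k = 0")
    case True
    then show ?thesis by (intro exI[of _ "\<lambda>_. 0"]) (auto simp: fsupp_def augm_def)
  next
    case False
    then have "PA (cdeg X 0 k)" using X by (auto simp: strand_resolution_def)
    then obtain u where u: "u \<in> chains Y 0 (cdeg X 0 k)" "augm Y u \<noteq> 0"
      using False Y unfolding strand_resolution_def by blast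
    let ?v = "\<lambda>j. augc X k / augm Y u * u j"
    have "augm Y ?v = augc X k / augm Y u * augm Y u"
      unfolding augm_def[of Y ?v] unfolding augm_def[of Y u] sum_distrib_left
      by (intro sum.cong) auto
    then show ?thesis using u by (intro exI[of _ ?v]) (auto simp: fsupp_def)
  qed
  then obtain U where U: "\<And>k. U k \<in> chains Y 0 (cdeg X 0 k)"
    "\<And>k. \<not> PB (cdeg X 0 k) \<Longrightarrow> augm Y (U k) = augc X k" by metis
  let ?P = "\<lambda>j k. if k \<in> cells X 0 then U k j else 0"
  have "graded (cells Y 0) (cdeg Y 0) (cells X 0) (cdeg X 0) ?P"
    using U by (auto simp: graded_def fsupp_def)
  then show thesis by (rule that) (use U in simp)
qed

text \<open>One level of a chain map, with just what the next lift requires: composed with the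
  differential it takes values in cycles. An induction can then carry a single level and choose the
  next one existentially.\<close>

definition chain_level ::
  "('d::order \<Rightarrow> bool) \<Rightarrow> ('d, 'k::comm_ring_1) strands \<Rightarrow> ('d, 'k) strands \<Rightarrow> nat \<Rightarrow>
    (nat \<Rightarrow> nat \<Rightarrow> 'k) \<Rightarrow> bool" where
  "chain_level PB X Y i p \<longleftrightarrow> graded (cells Y i) (cdeg Y i) (cells X i) (cdeg X i) p \<and>
     (\<forall>k\<in>cells X (Suc i). (\<lambda>j. mmul (cells X i) p (bd X i) j k) \<in> cycles PB Y i (cdeg X (Suc i) k))"

context
  fixes PA PB :: "'d::order \<Rightarrow> bool" and X Y :: "('d, 'k::field) strands"
  assumes X: "strand_resolution PA PB X" and Y: "strand_resolution PA PB Y"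
    and PB: "mono PB"
begin

lemma chain_level_0:
  assumes "graded (cells Y 0) (cdeg Y 0) (cells X 0) (cdeg X 0) p"
    and "\<And>k. k \<in> cells X 0 \<Longrightarrow> \<not> PB (cdeg X 0 k) \<Longrightarrow> augm Y (\<lambda>j. p j k) = augc X k"
  shows "chain_level PB X Y 0 p"
  unfolding chain_level_def
proof (intro conjI ballI)
  fix k assume k: "k \<in> cells X (Suc 0)"
  let ?u = "\<lambda>j. bd X 0 j k" and ?\<alpha> = "cdeg X (Suc 0) k"
  have u: "?u \<in> chains X 0 ?\<alpha>" "augm X ?u = 0 \<or> PB ?\<alpha>"
    using bd_col_cycles[OF X k] by auto
  have "mapply (cells X 0) p ?u \<in> chains Y 0 ?\<alpha>"
    by (rule mapply_fsupp[OF assms(1) u(1)])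
  moreover have "augm Y (mapply (cells X 0) p ?u) = 0 \<or> PB ?\<alpha>"
    using augm_mapply[OF _ _ assms(2) PB u(1)] u(2) X Y unfolding strand_resolution_def by metis
  ultimately show "(\<lambda>j. mmul (cells X 0) p (bd X 0) j k) \<in> cycles PB Y 0 ?\<alpha>"
    by (simp add: mmul_col)
qed (fact assms)

lemma chain_level_Suc:
  assumes p: "chain_level PB X Y i p"
  obtains p' where "chain_level PB X Y (Suc i) p'"
    "mmul (cells Y (Suc i)) (bd Y i) p' = mmul (cells X i) p (bd X i)"
proof -
  have fin: "\<And>i. finite (cells X i)" "\<And>i. finite (cells Y i)"
    using X Y by (auto simp: strand_resolution_def)
  have gX: "\<And>i. graded (cells X i) (cdeg X i) (cells X (Suc i)) (cdeg X (Suc i)) (bd X i)"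
    using X by (auto simp: strand_resolution_def)
  have z: "mmul (cells X i) p (bd X i) j k = 0" if "k \<notin> cells X (Suc i)" for j k
  proof -
    have "bd X i l k = 0" for l using gX that unfolding graded_def by blast
    then show ?thesis by (simp add: mmul_def)
  qed
  obtain p' where p': "graded (cells Y (Suc i)) (cdeg Y (Suc i)) (cells X (Suc i)) (cdeg X (Suc i)) p'"
    "mmul (cells Y (Suc i)) (bd Y i) p' = mmul (cells X i) p (bd X i)"
    by (rule lift_through_bd[OF Y, of "cells X (Suc i)" "mmul (cells X i) p (bd X i)" i "cdeg X (Suc i)"])
       (use p z in \<open>auto simp: chain_level_def\<close>)
  have "chain_level PB X Y (Suc i) p'"
    unfolding chain_level_def
  proof (intro conjI ballI)
    fix k assume k: "k \<in> cells X (Suc (Suc i))"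
    let ?v = "\<lambda>j. mmul (cells X (Suc i)) p' (bd X (Suc i)) j k"
    have "?v \<in> chains Y (Suc i) (cdeg X (Suc (Suc i)) k)"
      by (rule graded_col[OF graded_mmul[OF p'(1) gX]])
    moreover have "mmul (cells Y (Suc i)) (bd Y i) (mmul (cells X (Suc i)) p' (bd X (Suc i))) = (\<lambda>_ _. 0)"
      using bd_bd[OF X, of i] unfolding mmul_assoc[OF fin(2) fin(1), symmetric] p'(2)
      by (simp add: mmul_assoc fin) (simp add: mmul_def)
    then have "bdmap Y i ?v = (\<lambda>_. 0)"
      unfolding bdmap_def mmul_col[symmetric] by simp
    ultimately show "?v \<in> cycles PB Y (Suc i) (cdeg X (Suc (Suc i)) k)" by simp
  qed (fact p')
  then show thesis using p'(2) by (rule that)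
qed

end

text \<open>
  The matrix \<open>g\<close> is \<open>q p - 1\<close> corrected by a homotopy; the correction vanishes between equal degrees
  because the differentials of a minimal complex do.
\<close>

lemma comparison_identity:
  assumes X: "strand_resolution PA PB X" and Y: "strand_resolution PA PB Y"
    and PB: "mono PB"
    and min: "minimal_strands X"
  shows "\<exists>p q g. chain_level PB X Y i p \<and> chain_level PB Y X i q \<and>
    graded (cells X i) (cdeg X i) (cells X i) (cdeg X i) g \<and>
    (\<forall>k\<in>cells X i. (\<lambda>j. g j k) \<in> cycles PB X i (cdeg X i k)) \<and>
    mmul (cells X i) g (bd X i) = (\<lambda>j k. mmul (cells X i) (mmul (cells Y i) q p) (bd X i) j k - bd X i j k) \<and>
    (\<forall>j\<in>cells X i. \<forall>k\<in>cells X i. cdeg X i j = cdeg X i k \<longrightarrow>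
       g j k = mmul (cells Y i) q p j k - (if j = k \<and> j \<in> cells X i then 1 else 0))"
proof (induction i)
  have fin: "\<And>i. finite (cells X i)" "\<And>i. finite (cells Y i)"
    using X Y by (auto simp: strand_resolution_def)
  have gX: "\<And>i. graded (cells X i) (cdeg X i) (cells X (Suc i)) (cdeg X (Suc i)) (bd X i)"
    using X by (auto simp: strand_resolution_def)
  let ?I = "\<lambda>i j k. if j = k \<and> j \<in> cells X i then 1 else 0 :: 'b"
  have gI: "graded (cells X i) (cdeg X i) (cells X i) (cdeg X i) (?I i)" for i
    by (auto simp: graded_def)
  have Ibd: "mmul (cells X i) (?I i) (bd X i) = bd X i" for i
    by (rule mmul_id_left) (use fin gX in \<open>auto simp: graded_def\<close>)
  {
    case 0
    obtain p where p: "graded (cells Y 0) (cdeg Y 0) (cells X 0) (cdeg X 0) p"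
      "\<And>k. k \<in> cells X 0 \<Longrightarrow> \<not> PB (cdeg X 0 k) \<Longrightarrow> augm Y (\<lambda>j. p j k) = augc X k"
      using augmentation_lift[OF X Y] by blast
    obtain q where q: "graded (cells X 0) (cdeg X 0) (cells Y 0) (cdeg Y 0) q"
      "\<And>k. k \<in> cells Y 0 \<Longrightarrow> \<not> PB (cdeg Y 0 k) \<Longrightarrow> augm X (\<lambda>j. q j k) = augc Y k"
      using augmentation_lift[OF Y X] by blast
    define g where "g = (\<lambda>j k. mmul (cells Y 0) q p j k - ?I 0 j k)"
    have g: "graded (cells X 0) (cdeg X 0) (cells X 0) (cdeg X 0) g"
      unfolding g_def by (rule graded_diff[OF graded_mmul[OF q(1) p(1)] gI])
    have "(\<lambda>j. g j k) \<in> cycles PB X 0 (cdeg X 0 k)" if k: "k \<in> cells X 0" for k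
    proof -
      have "augm X (\<lambda>j. g j k) = 0" if nk: "\<not> PB (cdeg X 0 k)"
      proof -
        have "augm X (\<lambda>j. g j k) = augm X (mapply (cells Y 0) q (\<lambda>l. p l k)) - augm X (\<lambda>j. ?I 0 j k)"
          by (simp add: augm_def g_def mmul_def mapply_def right_diff_distrib sum_subtractf)
        also have "augm X (\<lambda>j. ?I 0 j k) = (\<Sum>j\<in>cells X 0. if j = k then augc X j else 0)"
          unfolding augm_def by (intro sum.cong) auto
        also have "\<dots> = augc X k"
          using k fin by simp
        also have "augm X (mapply (cells Y 0) q (\<lambda>l. p l k)) = augm Y (\<lambda>l. p l k)"
          by (rule augm_mapply[of X Y PB, OF fin(1) fin(2) q(2) PB graded_col[OF p(1)] nk]) auto
        finally show ?thesis using p(2)[OF k nk] by simp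
      qed
      then show ?thesis using graded_col[OF g, of k] by auto
    qed
    moreover have "mmul (cells X 0) g (bd X 0) =
        (\<lambda>j k. mmul (cells X 0) (mmul (cells Y 0) q p) (bd X 0) j k - bd X 0 j k)"
      unfolding g_def mmul_diff_left Ibd by (rule refl)
    ultimately show ?case
      using chain_level_0[OF X Y PB p] chain_level_0[OF Y X PB q] g
      by (intro exI[of _ p] exI[of _ q] exI[of _ g]) (auto simp: g_def)
  next
    case (Suc i)
    then obtain p q g where p: "chain_level PB X Y i p" and q: "chain_level PB Y X i q"
      and g: "graded (cells X i) (cdeg X i) (cells X i) (cdeg X i) g"
        "\<And>k. k \<in> cells X i \<Longrightarrow> (\<lambda>j. g j k) \<in> cycles PB X i (cdeg X i k)"
        "mmul (cells X i) g (bd X i) = (\<lambda>j k. mmul (cells X i) (mmul (cells Y i) q p) (bd X i) j k - bd X i j k)"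
      by blast
    obtain p' where p': "chain_level PB X Y (Suc i) p'"
      "mmul (cells Y (Suc i)) (bd Y i) p' = mmul (cells X i) p (bd X i)"
      using chain_level_Suc[OF X Y PB p] by blast
    obtain q' where q': "chain_level PB Y X (Suc i) q'"
      "mmul (cells X (Suc i)) (bd X i) q' = mmul (cells Y i) q (bd Y i)"
      using chain_level_Suc[OF Y X PB q] by blast
    obtain h where h: "graded (cells X (Suc i)) (cdeg X (Suc i)) (cells X i) (cdeg X i) h"
      "mmul (cells X (Suc i)) (bd X i) h = g"
      by (rule lift_through_bd[OF X, of "cells X i" g i "cdeg X i"])
         (use g in \<open>auto simp: graded_def\<close>)
    let ?\<theta> = "mmul (cells Y (Suc i)) q' p'" and ?hb = "mmul (cells X i) h (bd X i)"
    define g' where "g' = (\<lambda>j k. (?\<theta> j k - ?I (Suc i) j k) - ?hb j k)"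
    have gh: "graded (cells X (Suc i)) (cdeg X (Suc i)) (cells X (Suc i)) (cdeg X (Suc i)) ?hb"
      by (rule graded_mmul[OF h(1) gX])
    have g\<theta>: "graded (cells X (Suc i)) (cdeg X (Suc i)) (cells X (Suc i)) (cdeg X (Suc i)) ?\<theta>"
      using p'(1) q'(1) unfolding chain_level_def by (blast intro: graded_mmul)
    have g': "graded (cells X (Suc i)) (cdeg X (Suc i)) (cells X (Suc i)) (cdeg X (Suc i)) g'"
      unfolding g'_def by (intro graded_diff g\<theta> gI gh)
    have bI: "mmul (cells X (Suc i)) (bd X i) (?I (Suc i)) = bd X i"
    proof (intro ext)
      fix j k
      have "mmul (cells X (Suc i)) (bd X i) (?I (Suc i)) j k =
          (\<Sum>l\<in>cells X (Suc i). if k = l then bd X i j l else 0)"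
        unfolding mmul_def by (intro sum.cong) auto
      then show "mmul (cells X (Suc i)) (bd X i) (?I (Suc i)) j k = bd X i j k"
        using fin gX[of i] unfolding graded_def by auto
    qed
    have b\<theta>: "mmul (cells X (Suc i)) (bd X i) ?\<theta> = mmul (cells X i) (mmul (cells Y i) q p) (bd X i)"
      by (simp add: mmul_assoc[symmetric] fin q'(2)) (simp add: mmul_assoc fin p'(2))
    \<comment> \<open>The differential turns \<open>q' p'\<close> into \<open>q p\<close> followed
      by \<open>bd\<close>, and \<open>h\<close> into \<open>g\<close>. What remains is cancelled by
      the formula for \<open>g\<close> composed with \<open>bd\<close>, which is carried through the
      induction for this purpose.\<close>
    have "mmul (cells X (Suc i)) (bd X i) g' = (\<lambda>_ _. 0)"
      unfolding g'_def mmul_diff_right b\<theta> bI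
      by (simp add: mmul_assoc[symmetric] fin h(2) g(3))
    then have cyc: "(\<lambda>j. g' j k) \<in> cycles PB X (Suc i) (cdeg X (Suc i) k)" for k
      using graded_col[OF g', of k] unfolding cycles.simps bdmap_def
      by (simp add: mmul_col[symmetric])
    have comm: "mmul (cells X (Suc i)) g' (bd X (Suc i)) =
        (\<lambda>j k. mmul (cells X (Suc i)) ?\<theta> (bd X (Suc i)) j k - bd X (Suc i) j k)"
    proof -
      have "mmul (cells X (Suc i)) ?hb (bd X (Suc i)) = (\<lambda>_ _. 0)"
        by (simp add: mmul_assoc fin bd_bd[OF X]) (simp add: mmul_def)
      then show ?thesis unfolding g'_def mmul_diff_left Ibd by simp
    qed
    have "?hb j k = 0" if "cdeg X (Suc i) j = cdeg X (Suc i) k" for j k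
    proof (rule ccontr)
      assume "?hb j k \<noteq> 0"
      then obtain l where "h j l * bd X i l k \<noteq> 0"
        unfolding mmul_def by (meson sum.neutral)
      then have "h j l \<noteq> 0" "bd X i l k \<noteq> 0" by auto
      then have "cdeg X (Suc i) j \<le> cdeg X i l" "cdeg X i l \<le> cdeg X (Suc i) k"
        "cdeg X i l \<noteq> cdeg X (Suc i) k"
        using h(1) gX[of i] min unfolding graded_def minimal_strands_def by blast+
      then show False using that by auto
    qed
    then show ?case using p'(1) q'(1) g' cyc comm
      by (intro exI[of _ p'] exI[of _ q'] exI[of _ g']) (auto simp: g'_def)
  }
qed

section \<open>Uniqueness of minimal resolutions and truncation\<close>

interpretation fun_space: vector_space "\<lambda>(c::'k::field) (f::nat \<Rightarrow> 'k) j. c * f j"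
  by unfold_locales (auto simp: fun_eq_iff algebra_simps)

lemma sum_fun_apply: "(\<Sum>x\<in>A. f x) y = (\<Sum>x\<in>A. (f x y :: 'k::comm_monoid_add))"
  by (induction A rule: infinite_finite_induct) auto

lemma fun_span_units:
  assumes "finite N" "\<And>j. u j \<noteq> 0 \<Longrightarrow> j \<in> N"
  shows "u \<in> fun_space.span ((\<lambda>j l. if l = j then 1 else (0::'k::field)) ` N)"
proof -
  have eq: "u = (\<Sum>j\<in>N. (\<lambda>l. u j * (if l = j then 1 else 0)))"
  proof
    fix l
    have "(\<Sum>j\<in>N. (\<lambda>l. u j * (if l = j then 1 else 0))) l = (\<Sum>j\<in>N. if j = l then u j else 0)"
      unfolding sum_fun_apply by (intro sum.cong) auto
    then show "u l = (\<Sum>j\<in>N. (\<lambda>l. u j * (if l = j then 1 else 0))) l"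
      using assms by auto
  qed
  have "(\<Sum>j\<in>N. (\<lambda>l. u j * (if l = j then 1 else 0)))
      \<in> fun_space.span ((\<lambda>j l. if l = j then 1 else (0::'k)) ` N)"
    by (intro fun_space.span_sum fun_space.span_scale fun_space.span_base imageI)
  then show ?thesis by (subst eq)
qed

lemma fun_independent_card:
  assumes "finite N" "\<And>u j. u \<in> B \<Longrightarrow> u j \<noteq> (0::'k::field) \<Longrightarrow> j \<in> N" "fun_space.independent B"
  shows "finite B" "card B \<le> card N"
proof -
  let ?U = "(\<lambda>j l. if l = j then 1 else (0::'k)) ` N"
  have "B \<subseteq> fun_space.span ?U" using fun_span_units assms by blast
  then have "finite B \<and> card B \<le> card ?U"
    using fun_space.independent_span_bound assms by blast
  moreover have "card ?U \<le> card N" using assms(1) by (rule card_image_le)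
  ultimately show "finite B" "card B \<le> card N" by auto
qed

text \<open>The columns of \<open>p\<close>, cut to \<open>T\<close>, are independent, because
  \<open>q\<close> maps a linear combination of them to its coefficients. They lie in a space of
  dimension \<open>card T\<close>.\<close>

lemma card_le_of_left_inverse:
  fixes p q :: "nat \<Rightarrow> nat \<Rightarrow> 'k::field"
  assumes N: "finite N" and T: "finite T"
    and id: "\<And>j k. j \<in> N \<Longrightarrow> k \<in> N \<Longrightarrow> mmul T q p j k = (if j = k then 1 else 0)"
  shows "card N \<le> card T"
proof -
  define v where "v = (\<lambda>k l. if l \<in> T then p l k else 0)"
  have id': "(\<Sum>l\<in>T. q j l * v k l) = (if j = k then 1 else 0)" if "j \<in> N" "k \<in> N" for j k
    using id[OF that] by (simp add: mmul_def v_def)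
  have inj: "inj_on v N"
  proof (rule inj_onI)
    fix j k assume "j \<in> N" "k \<in> N" "v j = v k"
    then show "j = k" using id'[of j j] id'[of j k] by (auto split: if_splits)
  qed
  have "fun_space.independent (v ` N)"
  proof (rule fun_space.independent_if_scalars_zero)
    fix f u assume f: "(\<Sum>x\<in>v ` N. (\<lambda>j. f x * x j)) = 0" and "u \<in> v ` N"
    then obtain j where j: "j \<in> N" "u = v j" by auto
    have "(\<Sum>k\<in>N. f (v k) * v k l) = 0" for l
      using fun_cong[OF f, of l] by (simp add: sum.reindex[OF inj] sum_fun_apply)
    then have "0 = (\<Sum>l\<in>T. q j l * (\<Sum>k\<in>N. f (v k) * v k l))" by simp
    also have "\<dots> = (\<Sum>l\<in>T. \<Sum>k\<in>N. f (v k) * (q j l * v k l))"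
      by (simp add: sum_distrib_left mult_ac)
    also have "\<dots> = (\<Sum>k\<in>N. f (v k) * (\<Sum>l\<in>T. q j l * v k l))"
      by (subst sum.swap) (simp add: sum_distrib_left)
    also have "\<dots> = (\<Sum>k\<in>N. if k = j then f (v k) else 0)"
      by (intro sum.cong) (use id' j in auto)
    also have "\<dots> = f u" using N j by simp
    finally show "f u = 0" by simp
  qed (use N in simp)
  then have "card (v ` N) \<le> card T"
    by (rule fun_independent_card(2)[OF T, rotated]) (auto simp: v_def split: if_splits)
  then show ?thesis using card_image[OF inj] by simp
qed

text \<open>Minimality of \<open>X\<close> makes \<open>q p\<close> the identity on the cells of
  degree \<alpha>, so \<open>p\<close> has a left inverse there. Uniqueness of the graded ranks
  results from applying this in both directions.\<close>

theorem minimal_strands_card_le: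
  fixes X Y :: "('d::order, 'k::field) strands"
  assumes X: "strand_resolution PA PB X" and Y: "strand_resolution PA PB Y"
    and PB: "mono PB" and min: "minimal_strands X"
  shows "card {j \<in> cells X i. cdeg X i j = \<alpha>} \<le> card {j \<in> cells Y i. cdeg Y i j = \<alpha>}"
proof -
  have fin: "finite (cells X i)" "finite (cells Y i)"
    using X Y by (auto simp: strand_resolution_def)
  obtain p q g where p: "chain_level PB X Y i p" and q: "chain_level PB Y X i q"
    and g: "\<And>k. k \<in> cells X i \<Longrightarrow> (\<lambda>j. g j k) \<in> cycles PB X i (cdeg X i k)"
      "\<And>j k. j \<in> cells X i \<Longrightarrow> k \<in> cells X i \<Longrightarrow> cdeg X i j = cdeg X i k \<Longrightarrow>
        g j k = mmul (cells Y i) q p j k - (if j = k \<and> j \<in> cells X i then 1 else 0)"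
    using comparison_identity[OF X Y PB min, of i] by blast
  have gr: "graded (cells Y i) (cdeg Y i) (cells X i) (cdeg X i) p"
    "graded (cells X i) (cdeg X i) (cells Y i) (cdeg Y i) q"
    using p q unfolding chain_level_def by blast+
  let ?N = "{j \<in> cells X i. cdeg X i j = \<alpha>}" and ?T = "{j \<in> cells Y i. cdeg Y i j = \<alpha>}"
  \<comment> \<open>A column of \<open>g\<close> is a boundary in its own degree. A contribution at
    a cell \<open>j\<close> of the same degree would come from a cell \<open>l\<close> whose degree
    is squeezed to equality, where a minimal differential has no entry.\<close>
  have g0: "g j k = 0" if k: "k \<in> cells X i" "cdeg X i j = cdeg X i k" for j k
  proof (rule ccontr)
    assume "g j k \<noteq> 0"
    obtain u where u: "u \<in> chains X (Suc i) (cdeg X i k)" "(\<lambda>j. g j k) = bdmap X i u"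
      using g(1)[OF k(1)] X unfolding strand_resolution_def by auto
    have "bdmap X i u j \<noteq> 0" using \<open>g j k \<noteq> 0\<close> fun_cong[OF u(2), of j] by simp
    then obtain l where "bd X i j l * u l \<noteq> 0"
      unfolding bdmap_def mapply_def by (meson sum.neutral)
    then have l: "bd X i j l \<noteq> 0" "u l \<noteq> 0" by auto
    have "cdeg X (Suc i) l \<le> cdeg X i j" using l(2) u(1) k by (auto simp: fsupp_def)
    moreover have "cdeg X i j \<le> cdeg X (Suc i) l"
      using X l(1) unfolding strand_resolution_def graded_def by blast
    ultimately show False using min l(1) unfolding minimal_strands_def by (meson order_antisym)
  qed
  have "mmul ?T q p j k = (if j = k then 1 else 0)" if jk: "j \<in> ?N" "k \<in> ?N" for j k
  proof -
    \<comment> \<open>An intermediate cell has degree between \<alpha> and \<alpha>, so only cells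
      of \<open>Y\<close> of degree \<alpha> contribute.\<close>
    have "mmul ?T q p j k = mmul (cells Y i) q p j k"
      unfolding mmul_def
    proof (rule sum.mono_neutral_left)
      show "\<forall>l\<in>cells Y i - ?T. q j l * p l k = 0"
      proof (rule ballI, rule ccontr)
        fix l assume l: "l \<in> cells Y i - ?T" "q j l * p l k \<noteq> 0"
        then have "cdeg X i j \<le> cdeg Y i l" "cdeg Y i l \<le> cdeg X i k"
          using gr unfolding graded_def by auto
        then show False using jk l by auto
      qed
    qed (use fin in auto)
    also have "\<dots> = (if j = k then 1 else 0)"
      using g(2)[of j k] g0[of k j] jk by auto
    finally show ?thesis .
  qed
  then show ?thesis by (intro card_le_of_left_inverse[of ?N ?T q p]) (use fin in auto)
qed



section \<open>Restriction of a complex to a set of degrees\<close>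

definition truncate_strands :: "('d \<Rightarrow> bool) \<Rightarrow> ('d, 'k::zero) strands \<Rightarrow> ('d, 'k) strands" where
  "truncate_strands D X = \<lparr>cells = (\<lambda>i. {j \<in> cells X i. D (cdeg X i j)}), cdeg = cdeg X,
     bd = (\<lambda>i j k. if D (cdeg X (Suc i) k) then bd X i j k else 0),
     augc = (\<lambda>j. if D (cdeg X 0 j) then augc X j else 0)\<rparr>"

text \<open>
  \<open>\<tau> \<alpha>\<close> is the largest degree in \<open>D\<close> below \<open>\<alpha>\<close>, so the strand of the truncation in degree \<open>\<alpha>\<close> is the
  strand of \<open>X\<close> in degree \<open>\<tau> \<alpha>\<close>.
\<close>

lemma truncate_strands_resolution:
  assumes X: "strand_resolution PA PB X"
    and \<tau>: "\<And>\<alpha> \<beta>. \<beta> \<le> \<tau> \<alpha> \<longleftrightarrow> \<beta> \<le> \<alpha> \<and> D \<beta>"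
  shows "strand_resolution (\<lambda>\<alpha>. PA (\<tau> \<alpha>)) (\<lambda>\<alpha>. PB (\<tau> \<alpha>)) (truncate_strands D X)"
proof -
  let ?Y = "truncate_strands D X"
  have fin: "finite (cells X i)" for i using X by (auto simp: strand_resolution_def)
  \<comment> \<open>The characterisation of \<open>\<tau>\<close> contains downward closure of
    \<open>D\<close>: if \<open>D \<beta>\<close> then \<beta> is at most
    \<open>\<tau> \<beta>\<close>, and everything below \<open>\<tau> \<beta>\<close> lies in
    \<open>D\<close>.\<close>
  have D: "D \<alpha>" if "D \<beta>" "\<alpha> \<le> \<beta>" for \<alpha> \<beta>
    using \<tau>[of \<beta> \<beta>] \<tau>[of \<alpha> \<beta>] that order_trans by blast
  have \<tau>D: "\<tau> \<alpha> = \<alpha>" if "D \<alpha>" for \<alpha>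
    using \<tau>[of "\<tau> \<alpha>" \<alpha>] \<tau>[of \<alpha> \<alpha>] that by (simp add: order_antisym)
  have ch: "chains ?Y i \<alpha> = chains X i (\<tau> \<alpha>)" for i \<alpha>
    unfolding fsupp_def truncate_strands_def using \<tau> by auto
  have bdm: "bdmap ?Y i u = bdmap X i u" if "u \<in> chains X (Suc i) (\<tau> \<alpha>)" for i u \<alpha>
    unfolding bdmap_def mapply_def truncate_strands_def strands.simps
  proof (intro ext sum.mono_neutral_cong_left)
    show "\<forall>k\<in>cells X (Suc i) - {k \<in> cells X (Suc i). D (cdeg X (Suc i) k)}. bd X i j k * u k = 0" for j
      using that \<tau> by (auto simp: fsupp_def)
  qed (use fin in auto)
  have aug: "augm ?Y u = augm X u" if "u \<in> chains X 0 (\<tau> \<alpha>)" for u \<alpha>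
    unfolding augm_def truncate_strands_def strands.simps
  proof (intro sum.mono_neutral_cong_left)
    show "\<forall>k\<in>cells X 0 - {k \<in> cells X 0. D (cdeg X 0 k)}. augc X k * u k = 0"
      using that \<tau> by (auto simp: fsupp_def)
  qed (use fin in auto)
  have cyc: "cycles (\<lambda>\<alpha>. PB (\<tau> \<alpha>)) ?Y i \<alpha> = cycles PB X i (\<tau> \<alpha>)" for i \<alpha>
    by (cases i) (auto simp: ch bdm aug)
  have gX: "graded (cells X i) (cdeg X i) (cells X (Suc i)) (cdeg X (Suc i)) (bd X i)" for i
    using X by (auto simp: strand_resolution_def)
  show ?thesis
    unfolding strand_resolution_def
  proof (intro conjI allI impI)
    fix i \<alpha>
    show "finite (cells ?Y i)" using fin by (simp add: truncate_strands_def)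
    \<comment> \<open>The truncated differential tests only the degree of the column. The degree of
      the row is at most that, hence also in \<open>D\<close>.\<close>
    show "graded (cells ?Y i) (cdeg ?Y i) (cells ?Y (Suc i)) (cdeg ?Y (Suc i)) (bd ?Y i)"
      using gX[of i] D unfolding graded_def truncate_strands_def by auto
    have "bdmap ?Y i ` chains X (Suc i) (\<tau> \<alpha>) = bdmap X i ` chains X (Suc i) (\<tau> \<alpha>)"
      by (rule image_cong[OF refl bdm])
    then show "cycles (\<lambda>\<alpha>. PB (\<tau> \<alpha>)) ?Y i \<alpha> = bdmap ?Y i ` chains ?Y (Suc i) \<alpha>"
      using X unfolding cyc ch strand_resolution_def by simp
  next
    fix j assume "augc ?Y j \<noteq> 0"
    then show "j \<in> cells ?Y 0" "PA (\<tau> (cdeg ?Y 0 j))"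
      using X by (auto simp: truncate_strands_def strand_resolution_def \<tau>D split: if_splits)
  next
    fix \<alpha> assume "PA (\<tau> \<alpha>) \<and> \<not> PB (\<tau> \<alpha>)"
    then show "\<exists>u\<in>chains ?Y 0 \<alpha>. augm ?Y u \<noteq> 0"
      using X aug unfolding strand_resolution_def ch by metis
  qed
qed

lemma truncate_strands_minimal: "minimal_strands X \<Longrightarrow> minimal_strands (truncate_strands D X)"
  by (auto simp: minimal_strands_def truncate_strands_def)

lemma truncate_strands_card:
  "card {j \<in> cells (truncate_strands D X) i. cdeg (truncate_strands D X) i j = \<alpha>} =
     (if D \<alpha> then card {j \<in> cells X i. cdeg X i j = \<alpha>} else 0)"
proof (cases "D \<alpha>")
  case True
  then have "{j \<in> cells (truncate_strands D X) i. cdeg (truncate_strands D X) i j = \<alpha>} = {j \<in> cells X i. cdeg X i j = \<alpha>}"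
    by (auto simp: truncate_strands_def)
  then show ?thesis using True by simp
next
  case False
  then have "{j \<in> cells (truncate_strands D X) i. cdeg (truncate_strands D X) i j = \<alpha>} = {}"
    by (auto simp: truncate_strands_def)
  then show ?thesis using False by (simp del: Collect_empty_eq)
qed

section \<open>Existence of minimal resolutions\<close>

text \<open>A basis \<open>C\<close> of \<open>U\<close> is extended to a basis \<open>E\<close> of
  \<open>W\<close>; the difference represents a basis of the quotient W/U. The last clause is
  independence modulo \<open>U\<close>.\<close>

lemma basis_modulo_subspace:
  fixes U W :: "(nat \<Rightarrow> 'k::field) set"
  assumes U: "fun_space.subspace U" and W: "fun_space.subspace W" and UW: "U \<subseteq> W"
    and N: "finite N" "\<And>u j. u \<in> W \<Longrightarrow> u j \<noteq> 0 \<Longrightarrow> j \<in> N"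
  obtains B where "finite B" "B \<subseteq> W" "W \<subseteq> fun_space.span (U \<union> B)"
    "\<And>f b. (\<Sum>x\<in>B. (\<lambda>j. f x * x j)) \<in> U \<Longrightarrow> b \<in> B \<Longrightarrow> f b = 0"
proof -
  obtain C where C: "C \<subseteq> U" "fun_space.independent C" "U \<subseteq> fun_space.span C"
    using fun_space.maximal_independent_subset[of U] by blast
  have "C \<subseteq> W" using C(1) UW by (rule subset_trans)
  then obtain E where E: "C \<subseteq> E" "E \<subseteq> W" "fun_space.independent E" "W \<subseteq> fun_space.span E"
    using fun_space.maximal_independent_subset_extend[OF _ C(2), of W] by blast
  have finE: "finite E"
    by (rule fun_independent_card(1)[OF N(1) _ E(3)]) (use N(2) E(2) in blast)
  have finC: "finite C" using E(1) finE by (rule finite_subset)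
  show thesis
  proof (rule that[of "E - C"])
    show "finite (E - C)" "E - C \<subseteq> W" using finE E(2) by auto
    have "E \<subseteq> U \<union> (E - C)" using C(1) by blast
    then show "W \<subseteq> fun_space.span (U \<union> (E - C))"
      using E(4) fun_space.span_mono by blast
  next
    fix f b assume f: "(\<Sum>x\<in>E - C. (\<lambda>j. f x * x j)) \<in> U" and b: "b \<in> E - C"
    then have "(\<Sum>x\<in>E - C. (\<lambda>j. f x * x j)) \<in> range (\<lambda>g. \<Sum>x\<in>C. (\<lambda>j. g x * x j))"
      using C(3) unfolding fun_space.span_finite[OF finC] by blast
    then obtain g where g: "(\<Sum>x\<in>E - C. (\<lambda>j. f x * x j)) = (\<Sum>x\<in>C. (\<lambda>j. g x * x j))" by blast
    define h where "h = (\<lambda>x. if x \<in> C then - g x else f x)"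
    have "(\<Sum>x\<in>E. (\<lambda>j. h x * x j)) = (\<Sum>x\<in>E - C. (\<lambda>j. h x * x j)) + (\<Sum>x\<in>C. (\<lambda>j. h x * x j))"
      by (rule sum.subset_diff[OF E(1) finE])
    also have "(\<Sum>x\<in>E - C. (\<lambda>j. h x * x j)) = (\<Sum>x\<in>E - C. (\<lambda>j. f x * x j))"
      by (rule sum.cong) (auto simp: h_def)
    also have "(\<Sum>x\<in>C. (\<lambda>j. h x * x j)) = (\<Sum>x\<in>C. - (\<lambda>j. g x * x j))"
      by (rule sum.cong) (auto simp: h_def)
    also have "\<dots> = - (\<Sum>x\<in>C. (\<lambda>j. g x * x j))" by (rule sum_negf)
    finally have "(\<Sum>x\<in>E. (\<lambda>j. h x * x j)) = 0" unfolding g by (simp add: zero_fun_def)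
    then have "h b = 0"
      using fun_space.independentD[OF E(3) finE subset_refl] b by blast
    then show "f b = 0" using b by (simp add: h_def)
  qed
qed

section \<open>Dickson's lemma and finiteness of the generating degrees\<close>

lemma int_monotone_subsequence:
  fixes x :: "nat \<Rightarrow> int"
  assumes "\<And>i. L \<le> x i"
  shows "\<exists>g::nat \<Rightarrow> nat. strict_mono g \<and> mono (\<lambda>i. x (g i))"
proof -
  obtain g :: "nat \<Rightarrow> nat" where g: "strict_mono g" "monoseq (\<lambda>n. x (g n))"
    using seq_monosub[of x] by blast
  show ?thesis
  proof (cases "incseq (\<lambda>n. x (g n))")
    case False
    then have dec: "decseq (\<lambda>n. x (g n))" using g(2) by (simp add: monoseq_iff)
    \<comment> \<open>A decreasing integer sequence bounded below attains its minimum at some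
      \<open>n\<close> and is constant from there on, so its tail is also increasing.\<close>
    obtain n where "\<forall>m. nat (x (g n) - L) \<le> nat (x (g m) - L)"
      using ex_has_least_nat[of "\<lambda>_. True" 0 "\<lambda>n. nat (x (g n) - L)"] by auto
    then have n: "nat (x (g n) - L) \<le> nat (x (g m) - L)" for m by simp
    have eq: "x (g m) = x (g n)" if "n \<le> m" for m
      using decseqD[OF dec that] nat_le_eq_zle[of "x (g n) - L" "x (g m) - L"] n[of m]
        assms[of "g n"] assms[of "g m"] by simp
    have "mono (\<lambda>i. x (g (i + n)))"
    proof (rule monoI)
      show "x (g (i + n)) \<le> x (g (j + n))" for i j
        using eq[of "i + n"] eq[of "j + n"] by (simp only: le_add2)
    qed
    moreover have "strict_mono (\<lambda>i. g (i + n))" using g(1) by (simp add: strict_mono_def)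
    ultimately show ?thesis by blast
  next
    case True
    then show ?thesis using g(1) by blast
  qed
qed

text \<open>Subsequences are refined one coordinate at a time; monotonicity in the coordinates
  already treated survives refinement.\<close>

lemma dickson_monotone_subsequence:
  fixes f :: "nat \<Rightarrow> 'n::finite \<Rightarrow> int"
  assumes "\<And>i. L \<le> f i"
  shows "\<exists>g::nat \<Rightarrow> nat. strict_mono g \<and> mono (\<lambda>i. f (g i))"
proof -
  have "\<exists>g::nat \<Rightarrow> nat. strict_mono g \<and> (\<forall>v\<in>V. mono (\<lambda>i. f (g i) v))" if "finite V" for V :: "'n set"
    using that
  proof (induction V rule: finite_induct)
    case empty
    have "strict_mono (\<lambda>i::nat. i)" by (simp add: strict_mono_def)
    then show ?case by blast
  next
    case (insert w V)
    then obtain g :: "nat \<Rightarrow> nat" where g: "strict_mono g" "\<forall>v\<in>V. mono (\<lambda>i. f (g i) v)" by blast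
    obtain h :: "nat \<Rightarrow> nat" where h: "strict_mono h" "mono (\<lambda>i. f (g (h i)) w)"
      using int_monotone_subsequence[of "L w" "\<lambda>i. f (g i) w"] assms by (auto simp: le_fun_def)
    have "mono (\<lambda>i. f (g (h i)) v)" if "v \<in> V" for v
    proof (rule monoI)
      fix i j :: nat assume "i \<le> j"
      then have "h i \<le> h j" using strict_mono_mono[OF h(1)] by (simp add: mono_def)
      then show "f (g (h i)) v \<le> f (g (h j)) v" using g(2) that by (auto dest: monoD)
    qed
    moreover have "strict_mono (\<lambda>i. g (h i))" using g(1) h(1) by (auto simp: strict_mono_def)
    ultimately show ?case using h(2) by (intro exI[of _ "\<lambda>i. g (h i)"]) auto
  qed
  from this[of UNIV] obtain g :: "nat \<Rightarrow> nat" where "strict_mono g" "\<forall>v. mono (\<lambda>i. f (g i) v)" by auto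
  moreover have "mono (\<lambda>i. f (g i))"
    using calculation(2) by (auto simp: mono_def le_fun_def)
  ultimately show ?thesis by blast
qed

text \<open>If \<open>M\<close> is the family of strands of a graded module, this is the strand in
  degree \<alpha> of (x_1,...,x_n) times the module. Minimal generators sit where it is a proper
  subspace of \<open>M \<alpha>\<close>.\<close>

definition below :: "('d::order \<Rightarrow> (nat \<Rightarrow> 'k::field) set) \<Rightarrow> 'd \<Rightarrow> (nat \<Rightarrow> 'k) set" where
  "below M \<alpha> = fun_space.span (\<Union>\<beta>\<in>{\<beta>. \<beta> < \<alpha>}. M \<beta>)"

lemma below_minimal: "fun_space.subspace S \<Longrightarrow> (\<And>\<beta>. \<beta> < \<alpha> \<Longrightarrow> M \<beta> \<subseteq> S) \<Longrightarrow> below M \<alpha> \<subseteq> S"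
  unfolding below_def by (intro fun_space.span_minimal) auto

lemma below_superset: "\<beta> < \<alpha> \<Longrightarrow> M \<beta> \<subseteq> below M \<alpha>"
  unfolding below_def by (rule subset_trans[OF _ fun_space.span_superset]) auto

text \<open>Noetherianity in terms of strands: infinitely many jumps would contain, by Dickson's
  lemma, a strictly increasing chain of degrees, and a new vector at each of them would be
  independent of the earlier ones. But all strands lie in the space of functions on the finite set
  \<open>N\<close>.\<close>

lemma finite_jumps:
  fixes M :: "('n::finite \<Rightarrow> int) \<Rightarrow> (nat \<Rightarrow> 'k::field) set"
  assumes M: "mono M" and supp: "finite N" "\<And>\<alpha> u j. u \<in> M \<alpha> \<Longrightarrow> u j \<noteq> 0 \<Longrightarrow> j \<in> N"
    and L: "\<And>\<alpha> u j. u \<in> M \<alpha> \<Longrightarrow> u j \<noteq> 0 \<Longrightarrow> L \<le> \<alpha>"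
  shows "finite {\<alpha>. \<not> M \<alpha> \<subseteq> below M \<alpha>}"
proof (rule ccontr)
  assume "infinite {\<alpha>. \<not> M \<alpha> \<subseteq> below M \<alpha>}"
  from infinite_countable_subset[OF this] obtain f :: "nat \<Rightarrow> 'n \<Rightarrow> int"
    where f: "inj f" "range f \<subseteq> {\<alpha>. \<not> M \<alpha> \<subseteq> below M \<alpha>}" by (elim exE conjE)
  have "\<exists>b. b \<in> M (f i) \<and> b \<notin> below M (f i)" for i using f(2) by auto
  then have "\<exists>b. \<forall>i. b i \<in> M (f i) \<and> b i \<notin> below M (f i)" by (intro choice allI)
  then obtain b where b: "\<And>i. b i \<in> M (f i)" "\<And>i. b i \<notin> below M (f i)" by blast
  have "L \<le> f i" for i
  proof -
    have "0 \<in> below M (f i)" unfolding below_def by (rule fun_space.span_zero)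
    then have "b i \<noteq> 0" using b(2)[of i] by auto
    then obtain j where "b i j \<noteq> 0" by (auto simp: fun_eq_iff)
    then show ?thesis using L b(1) by blast
  qed
  from dickson_monotone_subsequence[of L f, OF this] obtain g :: "nat \<Rightarrow> nat"
    where g: "strict_mono g" "mono (\<lambda>i. f (g i))" by (elim exE conjE)
  define v where "v = (\<lambda>i. b (g i))"
  have lt: "f (g i) < f (g j)" if "i < j" for i j
  proof -
    have "f (g i) \<le> f (g j)" using g(2) that by (simp add: mono_def)
    moreover have "f (g i) \<noteq> f (g j)"
      using strict_monoD[OF g(1) that] by (simp add: inj_eq[OF f(1)])
    ultimately show ?thesis by order
  qed
  have "fun_space.independent (v ` {..<n}) \<and> card (v ` {..<n}) = n" for n
  proof (induction n)
    case (Suc n)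
    have "v ` {..<n} \<subseteq> below M (f (g n))"
      using b(1) lt below_superset unfolding v_def by blast
    then have "fun_space.span (v ` {..<n}) \<subseteq> below M (f (g n))"
      by (rule fun_space.span_minimal) (simp add: below_def)
    then have *: "v n \<notin> fun_space.span (v ` {..<n})" using b(2) by (auto simp: v_def)
    have **: "v n \<notin> v ` {..<n}"
    proof
      assume "v n \<in> v ` {..<n}"
      then have "v n \<in> fun_space.span (v ` {..<n})" by (rule fun_space.span_base)
      then show False using * by contradiction
    qed
    have "fun_space.independent (insert (v n) (v ` {..<n}))"
      by (rule fun_space.independent_insertI[OF * conjunct1[OF Suc.IH]])
    moreover have "card (insert (v n) (v ` {..<n})) = Suc n"
      using conjunct2[OF Suc.IH] ** by (subst card_insert_disjoint) auto
    ultimately show ?case unfolding lessThan_Suc image_insert by (rule conjI)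
  qed (simp add: fun_space.independent_empty)
  from this[of "Suc (card N)"] have v: "fun_space.independent (v ` {..<Suc (card N)})"
    "card (v ` {..<Suc (card N)}) = Suc (card N)" by simp_all
  have "card (v ` {..<Suc (card N)}) \<le> card N"
    by (rule fun_independent_card(2)[OF supp(1) _ v(1)]) (use b(1) supp(2) in \<open>auto simp: v_def\<close>)
  then show False using v(2) by simp
qed

section \<open>Minimal generators, degree by degree\<close>

lemma mapply_add: "mapply N P (u + v) = mapply N P u + mapply N P v"
  by (auto simp: mapply_def fun_eq_iff distrib_left sum.distrib)

lemma mapply_scale: "mapply N P (\<lambda>j. c * u j) = (\<lambda>j. c * mapply N P u j)"
  by (auto simp: mapply_def fun_eq_iff sum_distrib_left mult_ac)

lemma mapply_zero: "mapply N P 0 = 0" "mapply N P (\<lambda>_. 0) = 0"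
  by (auto simp: mapply_def fun_eq_iff)

lemma fsupp_subspace: "fun_space.subspace (fsupp N s \<alpha> :: (nat \<Rightarrow> 'k::field) set)"
proof (rule fun_space.subspaceI)
  fix x y :: "nat \<Rightarrow> 'k::field" assume "x \<in> fsupp N s \<alpha>" "y \<in> fsupp N s \<alpha>"
  moreover have "x j \<noteq> 0 \<or> y j \<noteq> 0" if "(x + y) j \<noteq> 0" for j using that by auto
  ultimately show "x + y \<in> fsupp N s \<alpha>" unfolding fsupp_def by blast
qed (auto simp: fsupp_def)

lemma mapply_image_subspace: "fun_space.subspace (mapply N P ` fsupp N s \<alpha>)"
proof (rule fun_space.subspaceI)
  show "0 \<in> mapply N P ` fsupp N s \<alpha>"
    by (rule image_eqI[where x = 0]) (simp add: mapply_zero(1), rule fun_space.subspace_0[OF fsupp_subspace])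
next
  fix x y assume "x \<in> mapply N P ` fsupp N s \<alpha>" "y \<in> mapply N P ` fsupp N s \<alpha>"
  then obtain u v where u: "u \<in> fsupp N s \<alpha>" "x = mapply N P u"
    and v: "v \<in> fsupp N s \<alpha>" "y = mapply N P v" by blast
  have "x + y = mapply N P (u + v)" unfolding u(2) v(2) by (rule mapply_add[symmetric])
  then show "x + y \<in> mapply N P ` fsupp N s \<alpha>"
    using fun_space.subspace_add[OF fsupp_subspace u(1) v(1)] by (rule image_eqI)
next
  fix c x assume "x \<in> mapply N P ` fsupp N s \<alpha>"
  then obtain u where u: "u \<in> fsupp N s \<alpha>" "x = mapply N P u" by blast
  have "(\<lambda>j. c * x j) = mapply N P (\<lambda>j. c * u j)" unfolding u(2) mapply_scale ..
  moreover have "(\<lambda>j. c * u j) \<in> fsupp N s \<alpha>" using u(1) by (auto simp: fsupp_def)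
  ultimately show "(\<lambda>j. c * x j) \<in> mapply N P ` fsupp N s \<alpha>" by (rule image_eqI)
qed

lemma mapply_kernel_subspace: "fun_space.subspace {u \<in> fsupp N s \<alpha>. mapply N P u = (\<lambda>_. 0)}"
proof (rule fun_space.subspaceI)
  show "0 \<in> {u \<in> fsupp N s \<alpha>. mapply N P u = (\<lambda>_. 0)}"
    using fun_space.subspace_0[OF fsupp_subspace] mapply_zero by (auto simp: zero_fun_def)
next
  fix x y assume "x \<in> {u \<in> fsupp N s \<alpha>. mapply N P u = (\<lambda>_. 0)}" "y \<in> {u \<in> fsupp N s \<alpha>. mapply N P u = (\<lambda>_. 0)}"
  then have "x + y \<in> fsupp N s \<alpha>" "mapply N P (x + y) = (\<lambda>_. 0)"
    using fun_space.subspace_add[OF fsupp_subspace, of x N s \<alpha> y]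
    unfolding mapply_add by (auto simp: fun_eq_iff)
  then show "x + y \<in> {u \<in> fsupp N s \<alpha>. mapply N P u = (\<lambda>_. 0)}" by blast
next
  fix c x assume "x \<in> {u \<in> fsupp N s \<alpha>. mapply N P u = (\<lambda>_. 0)}"
  then show "(\<lambda>j. c * x j) \<in> {u \<in> fsupp N s \<alpha>. mapply N P u = (\<lambda>_. 0)}"
    by (auto simp: mapply_scale fsupp_def)
qed

text \<open>Graded Nakayama: bases of \<open>M \<alpha>\<close> modulo
  \<open>below M \<alpha>\<close>, gathered over all jumps, generate the family. Degrees in
  \<open>PB\<close> are left out, which yields generators of a quotient such as A/B. The last clause
  says that no relation involves a generator of its own degree, that is, relations have no unit
  coefficients.\<close>

lemma minimal_generators:
  fixes M :: "('n::finite \<Rightarrow> int) \<Rightarrow> (nat \<Rightarrow> 'k::field) set"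
  assumes sub: "\<And>\<alpha>. fun_space.subspace (M \<alpha>)" and M: "mono M" and PB: "mono PB"
    and supp: "finite N" "\<And>\<alpha> u j. u \<in> M \<alpha> \<Longrightarrow> u j \<noteq> 0 \<Longrightarrow> j \<in> N"
    and L: "\<And>\<alpha> u j. u \<in> M \<alpha> \<Longrightarrow> u j \<noteq> 0 \<Longrightarrow> L \<le> \<alpha>"
  obtains r t c where "\<And>k. k < r \<Longrightarrow> (\<lambda>j. c j k) \<in> M (t k) \<and> \<not> PB (t k) \<and> L \<le> t k"
    "\<And>j k. c j k \<noteq> 0 \<Longrightarrow> k < r"
    "\<And>\<alpha>. \<not> PB \<alpha> \<Longrightarrow> M \<alpha> = mapply {..<r} c ` fsupp {..<r} t \<alpha>"
    "\<And>\<alpha> u k. u \<in> fsupp {..<r} t \<alpha> \<Longrightarrow> mapply {..<r} c u = (\<lambda>_. 0) \<Longrightarrow> u k \<noteq> 0 \<Longrightarrow> t k \<noteq> \<alpha>"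
proof -
  have "\<exists>B. finite B \<and> B \<subseteq> M \<alpha> \<and> M \<alpha> \<subseteq> fun_space.span (below M \<alpha> \<union> B) \<and>
    (\<forall>f b. (\<Sum>x\<in>B. (\<lambda>j. f x * x j)) \<in> below M \<alpha> \<longrightarrow> b \<in> B \<longrightarrow> f b = 0)" for \<alpha>
  proof -
    have *: "below M \<alpha> \<subseteq> M \<alpha>"
      by (rule below_minimal[OF sub]) (use M in \<open>auto dest: monoD[OF _ less_imp_le]\<close>)
    have sb: "fun_space.subspace (below M \<alpha>)"
      unfolding below_def by (rule fun_space.subspace_span)
    show ?thesis
    proof (rule basis_modulo_subspace[OF sb sub[of \<alpha>] * supp(1) supp(2)[of _ \<alpha>]])
      fix B assume "finite B" "B \<subseteq> M \<alpha>" "M \<alpha> \<subseteq> fun_space.span (below M \<alpha> \<union> B)"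
        "\<And>f b. (\<Sum>x\<in>B. (\<lambda>j. f x * x j)) \<in> below M \<alpha> \<Longrightarrow> b \<in> B \<Longrightarrow> f b = 0"
      then show ?thesis by (intro exI[of _ B] conjI allI impI)
    qed
  qed
  then have "\<exists>B. \<forall>\<alpha>. finite (B \<alpha>) \<and> B \<alpha> \<subseteq> M \<alpha> \<and> M \<alpha> \<subseteq> fun_space.span (below M \<alpha> \<union> B \<alpha>) \<and>
    (\<forall>f b. (\<Sum>x\<in>B \<alpha>. (\<lambda>j. f x * x j)) \<in> below M \<alpha> \<longrightarrow> b \<in> B \<alpha> \<longrightarrow> f b = 0)"
    by (intro choice allI)
  then obtain B where B: "\<And>\<alpha>. finite (B \<alpha>)" "\<And>\<alpha>. B \<alpha> \<subseteq> M \<alpha>"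
    "\<And>\<alpha>. M \<alpha> \<subseteq> fun_space.span (below M \<alpha> \<union> B \<alpha>)"
    "\<And>\<alpha> f b. (\<Sum>x\<in>B \<alpha>. (\<lambda>j. f x * x j)) \<in> below M \<alpha> \<Longrightarrow> b \<in> B \<alpha> \<Longrightarrow> f b = 0"
    by blast
  \<comment> \<open>Independence modulo \<open>below M \<alpha>\<close>, applied to indicator
    coefficients. Hence \<open>B \<alpha>\<close> is empty unless \<alpha> is a jump, and finitely
    many degrees contribute.\<close>
  have Bn: "b \<notin> below M \<alpha>" if "b \<in> B \<alpha>" for b \<alpha>
  proof
    assume "b \<in> below M \<alpha>"
    moreover have "(\<Sum>x\<in>B \<alpha>. (\<lambda>j. (if x = b then 1 else 0) * x j)) = (\<Sum>x\<in>B \<alpha>. if x = b then x else 0)"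
      by (rule sum.cong) (auto simp: fun_eq_iff)
    ultimately have "(\<Sum>x\<in>B \<alpha>. (\<lambda>j. (if x = b then 1 else 0) * x j)) \<in> below M \<alpha>"
      using B(1) that by simp
    from B(4)[OF this that] show False by simp
  qed
  have LB: "L \<le> \<alpha>" if "b \<in> B \<alpha>" for b \<alpha>
  proof -
    have "0 \<in> below M \<alpha>" unfolding below_def by (rule fun_space.span_zero)
    then have "b \<noteq> 0" using Bn[OF that] by auto
    then obtain j where "b j \<noteq> 0" by (auto simp: fun_eq_iff)
    then show ?thesis using L B(2) that by blast
  qed
  define P where "P = Sigma {\<alpha>. \<not> M \<alpha> \<subseteq> below M \<alpha> \<and> \<not> PB \<alpha>} B"
  have "finite {\<alpha>. \<not> M \<alpha> \<subseteq> below M \<alpha> \<and> \<not> PB \<alpha>}"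
    by (rule finite_subset[OF _ finite_jumps[OF M supp L]]) auto
  then have "finite P" unfolding P_def using B(1) by blast
  then obtain xs where xs: "set xs = P" "distinct xs" using finite_distinct_list by blast
  define r where "r = length xs"
  define t where "t = (\<lambda>k. fst (xs ! k))"
  define c where "c = (\<lambda>j k. if k < r then snd (xs ! k) j else 0)"
  have in_P: "(t k, \<lambda>j. c j k) \<in> P" if "k < r" for k
    using that xs(1) nth_mem[of k xs] by (simp add: r_def t_def c_def)
  have from_P: "\<exists>k<r. t k = \<alpha> \<and> (\<lambda>j. c j k) = b" if "b \<in> B \<alpha>" "\<not> PB \<alpha>" for b \<alpha>
  proof -
    have "(\<alpha>, b) \<in> set xs"
      using that Bn B(2) unfolding xs(1) P_def by blast
    then obtain k where "k < r" "xs ! k = (\<alpha>, b)" unfolding r_def in_set_conv_nth by blast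
    then show ?thesis by (intro exI[of _ k]) (auto simp: t_def c_def)
  qed
  have inj: "k = l" if "k < r" "l < r" "t k = t l" "(\<lambda>j. c j k) = (\<lambda>j. c j l)" for k l
  proof -
    have "xs ! k = xs ! l" using that by (intro prod_eqI) (auto simp: t_def c_def)
    then show ?thesis using that(1,2) xs(2) by (simp add: r_def nth_eq_iff_index_eq)
  qed
  have cM: "(\<lambda>j. c j k) \<in> M (t k)" if "k < r" for k
    using in_P[OF that] B(2) by (auto simp: P_def)
  let ?R = "\<lambda>\<alpha>. mapply {..<r} c ` fsupp {..<r} t \<alpha>"
  have le: "?R \<alpha> \<subseteq> M \<alpha>" for \<alpha>
  proof
    fix w assume "w \<in> ?R \<alpha>"
    then obtain u where u: "u \<in> fsupp {..<r} t \<alpha>" "w = mapply {..<r} c u" by blast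
    have "w = (\<Sum>k<r. (\<lambda>j. u k * c j k))"
      unfolding u(2) mapply_def by (auto simp: fun_eq_iff sum_fun_apply mult.commute)
    also have "\<dots> \<in> M \<alpha>"
    proof (rule fun_space.subspace_sum[OF sub])
      fix k assume k: "k \<in> {..<r}"
      show "(\<lambda>j. u k * c j k) \<in> M \<alpha>"
      proof (cases "u k = 0")
        case True
        then show ?thesis using fun_space.subspace_0[OF sub, of \<alpha>] by (simp add: zero_fun_def)
      next
        case False
        then have "M (t k) \<subseteq> M \<alpha>" using u(1) M by (auto simp: fsupp_def dest: monoD)
        then have "(\<lambda>j. c j k) \<in> M \<alpha>" using cM k by blast
        then show ?thesis by (rule fun_space.subspace_scale[OF sub])
      qed
    qed
    finally show "w \<in> M \<alpha>" .
  qed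
  have ge: "M \<alpha> \<subseteq> ?R \<alpha>" if "\<not> PB \<alpha>" for \<alpha>
    using that
  \<comment> \<open>The measure is the total excess of \<alpha> over \<open>L\<close>. It drops for
    smaller degrees that are still above \<open>L\<close>; in all other degrees \<open>M\<close> is
    zero.\<close>
  proof (induction "nat (\<Sum>v\<in>UNIV. \<alpha> v - L v)" arbitrary: \<alpha> rule: less_induct)
    case less
    show ?case
    proof (cases "L \<le> \<alpha>")
      case False
      then have "M \<alpha> \<subseteq> {0}" using L by (fastforce simp: fun_eq_iff)
      then show ?thesis using fun_space.subspace_0[OF mapply_image_subspace] by blast
    next
      case True
      have "M \<beta> \<subseteq> ?R \<alpha>" if \<beta>: "\<beta> < \<alpha>" for \<beta>
      proof (cases "L \<le> \<beta>")
        case False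
        then have "M \<beta> \<subseteq> {0}" using L by (fastforce simp: fun_eq_iff)
        then show ?thesis using fun_space.subspace_0[OF mapply_image_subspace] by blast
      next
        case True
        have "\<beta> \<le> \<alpha>" "\<not> \<alpha> \<le> \<beta>" using \<beta> by order+
        then have "(\<Sum>v\<in>UNIV. \<beta> v - L v) < (\<Sum>v\<in>UNIV. \<alpha> v - L v)"
          by (intro sum_strict_mono_ex1) (auto simp: le_fun_def not_le)
        moreover have "0 \<le> (\<Sum>v\<in>UNIV. \<beta> v - L v)"
          using True by (intro sum_nonneg) (auto simp: le_fun_def)
        moreover have "\<not> PB \<beta>" using less.prems PB \<beta> by (auto dest: monoD[OF _ less_imp_le])
        ultimately have "M \<beta> \<subseteq> ?R \<beta>" by (intro less.hyps) auto
        also have "\<dots> \<subseteq> ?R \<alpha>"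
          using \<beta> by (intro image_mono) (auto simp: fsupp_def intro: order_trans)
        finally show ?thesis .
      qed
      then have "below M \<alpha> \<subseteq> ?R \<alpha>" by (intro below_minimal mapply_image_subspace)
      moreover have "B \<alpha> \<subseteq> ?R \<alpha>"
      proof
        fix b assume "b \<in> B \<alpha>"
        then obtain k where k: "k < r" "t k = \<alpha>" "(\<lambda>j. c j k) = b" using from_P less.prems by blast
        have "b = mapply {..<r} c (\<lambda>l. if l = k then 1 else 0)"
          using k by (auto simp: mapply_def if_distrib cong: if_cong)
        moreover have "(\<lambda>l. if l = k then 1 else 0) \<in> fsupp {..<r} t \<alpha>"
          using k by (auto simp: fsupp_def)
        ultimately show "b \<in> ?R \<alpha>" by (rule image_eqI)
      qed
      ultimately have "fun_space.span (below M \<alpha> \<union> B \<alpha>) \<subseteq> ?R \<alpha>"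
        by (intro fun_space.span_minimal mapply_image_subspace) auto
      then show ?thesis using B(3) by blast
    qed
  qed
  have min: "t k \<noteq> \<alpha>" if u: "u \<in> fsupp {..<r} t \<alpha>" "mapply {..<r} c u = (\<lambda>_. 0)" "u k \<noteq> 0" for \<alpha> u k
  proof
    assume k: "t k = \<alpha>"
    let ?K = "{l. l < r \<and> t l = \<alpha>}"
    have kK: "k \<in> ?K" using u k by (auto simp: fsupp_def)
    have bij: "bij_betw (\<lambda>l j. c j l) ?K (B \<alpha>)"
    proof (rule bij_betwI')
      fix b assume "b \<in> B \<alpha>"
      moreover have "\<not> PB \<alpha>" using in_P[of k] kK by (auto simp: P_def)
      ultimately show "\<exists>l\<in>?K. b = (\<lambda>j. c j l)" using from_P by blast
    qed (use inj in_P in \<open>auto simp: P_def\<close>)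
    \<comment> \<open>The coefficients are carried from positions to the vectors of
      \<open>B \<alpha>\<close>, so that independence modulo \<open>below M \<alpha>\<close>
      applies. The other terms of the relation belong to generators of smaller degree and lie in
      \<open>below M \<alpha>\<close>.\<close>
    define f where "f = (\<lambda>b. u (the_inv_into ?K (\<lambda>l j. c j l) b))"
    have f: "f (\<lambda>j. c j l) = u l" if "l \<in> ?K" for l
      unfolding f_def using the_inv_into_f_f[OF bij_betw_imp_inj_on[OF bij] that] by simp
    have "(\<Sum>x\<in>B \<alpha>. (\<lambda>j. f x * x j)) = (\<Sum>l\<in>?K. (\<lambda>j. f (\<lambda>j. c j l) * c j l))"
      using sum.reindex_bij_betw[OF bij, of "\<lambda>x. (\<lambda>j. f x * x j)"] by simp
    also have "\<dots> = (\<Sum>l\<in>?K. (\<lambda>j. u l * c j l))"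
      by (rule sum.cong) (use f in auto)
    also have "\<dots> = - (\<Sum>l\<in>{..<r} - ?K. (\<lambda>j. u l * c j l))"
    proof -
      have "(\<Sum>l<r. (\<lambda>j. u l * c j l)) = 0"
        using u(2) by (auto simp: mapply_def fun_eq_iff sum_fun_apply mult.commute)
      moreover have "(\<Sum>l<r. (\<lambda>j. u l * c j l)) =
          (\<Sum>l\<in>{..<r} - ?K. (\<lambda>j. u l * c j l)) + (\<Sum>l\<in>?K. (\<lambda>j. u l * c j l))"
        by (rule sum.subset_diff) auto
      ultimately show ?thesis by (simp add: eq_neg_iff_add_eq_0 add.commute)
    qed
    also have "\<dots> \<in> below M \<alpha>"
    proof (unfold below_def, intro fun_space.span_neg fun_space.span_sum)
      fix l assume l: "l \<in> {..<r} - ?K"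
      show "(\<lambda>j. u l * c j l) \<in> fun_space.span (\<Union>\<beta>\<in>{\<beta>. \<beta> < \<alpha>}. M \<beta>)"
      proof (cases "u l = 0")
        case True
        then show ?thesis
          using fun_space.span_zero[of "\<Union>\<beta>\<in>{\<beta>. \<beta> < \<alpha>}. M \<beta>"] by (simp add: zero_fun_def)
      next
        case False
        then have "t l < \<alpha>" using u(1) l by (auto simp: fsupp_def order.strict_iff_order)
        then have "(\<lambda>j. c j l) \<in> (\<Union>\<beta>\<in>{\<beta>. \<beta> < \<alpha>}. M \<beta>)" using cM[of l] l by auto
        then show ?thesis by (intro fun_space.span_scale fun_space.span_base)
      qed
    qed
    finally have "f (\<lambda>j. c j k) = 0"
      by (rule B(4)) (use in_P[of k] kK in \<open>auto simp: P_def\<close>)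
    then show False using f[OF kK] u(3) by simp
  qed
  show thesis
  proof (rule that[of r c t])
    show "(\<lambda>j. c j k) \<in> M (t k) \<and> \<not> PB (t k) \<and> L \<le> t k" if "k < r" for k
      using in_P[OF that] cM[OF that] LB by (auto simp: P_def)
    show "c j k \<noteq> 0 \<Longrightarrow> k < r" for j k by (auto simp: c_def split: if_splits)
  qed (use le ge min in blast)+
qed

text \<open>What the construction must know about the syzygies \<open>Z\<close> of one level: they
  form a graded submodule of the free module with shifts \<open>s\<close>, contained in
  (x_1,...,x_n) times it; the latter is the clause \<open>s j \<noteq> \<alpha>\<close>. The lower
  bound \<open>L\<close> makes Dickson's lemma available at each level.\<close>

definition level_cycles :: "'d::order \<Rightarrow> nat \<Rightarrow> (nat \<Rightarrow> 'd) \<Rightarrow> ('d \<Rightarrow> (nat \<Rightarrow> 'k::field) set) \<Rightarrow> bool" where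
  "level_cycles L r s Z \<longleftrightarrow> (\<forall>\<alpha>. fun_space.subspace (Z \<alpha>)) \<and> mono Z \<and>
     (\<forall>\<alpha>. Z \<alpha> \<subseteq> fsupp {..<r} s \<alpha>) \<and> (\<forall>\<alpha> u j. u \<in> Z \<alpha> \<longrightarrow> u j \<noteq> 0 \<longrightarrow> s j \<noteq> \<alpha>) \<and>
     (\<forall>j<r. L \<le> s j)"

text \<open>Minimal generators of \<open>Z\<close> form the next differential. Its entries avoid
  equal degrees because \<open>Z\<close> lies in (x_1,...,x_n) times the free module, and its kernel
  qualifies again because the generators are minimal.\<close>

lemma level_cycles_cover:
  fixes Z :: "('n::finite \<Rightarrow> int) \<Rightarrow> (nat \<Rightarrow> 'k::field) set"
  assumes Z: "level_cycles L r s Z"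
  shows "\<exists>r' t c. graded {..<r} s {..<r'} t c \<and> (\<forall>j k. c j k \<noteq> 0 \<longrightarrow> s j \<noteq> t k) \<and>
    (\<forall>\<alpha>. Z \<alpha> = mapply {..<r'} c ` fsupp {..<r'} t \<alpha>) \<and>
    level_cycles L r' t (\<lambda>\<alpha>. {u \<in> fsupp {..<r'} t \<alpha>. mapply {..<r'} c u = (\<lambda>_. 0)})"
proof -
  have sub: "fun_space.subspace (Z \<alpha>)" for \<alpha> using Z by (simp add: level_cycles_def)
  have M: "mono Z" using Z by (simp add: level_cycles_def)
  have sup: "Z \<alpha> \<subseteq> fsupp {..<r} s \<alpha>" for \<alpha> using Z by (simp add: level_cycles_def)
  have min: "s j \<noteq> \<alpha>" if "u \<in> Z \<alpha>" "u j \<noteq> 0" for u j \<alpha>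
    using Z that unfolding level_cycles_def by blast
  have L: "L \<le> s j" if "j < r" for j using Z that by (simp add: level_cycles_def)
  have s1: "j \<in> {..<r}" if "u \<in> Z \<alpha>" "u j \<noteq> 0" for u j \<alpha>
    using sup[of \<alpha>] that unfolding fsupp_def by blast
  have s2: "s j \<le> \<alpha>" if "u \<in> Z \<alpha>" "u j \<noteq> 0" for u j \<alpha>
    using sup[of \<alpha>] that unfolding fsupp_def by blast
  have L': "L \<le> \<alpha>" if "u \<in> Z \<alpha>" "u j \<noteq> 0" for u j \<alpha>
    using L[of j] s1[OF that] s2[OF that] by (simp add: order_trans)
  have PB: "mono (\<lambda>\<alpha>::'n \<Rightarrow> int. False)" by (rule monoI) simp
  show ?thesis
  proof (rule minimal_generators[where M = Z and N = "{..<r}" and PB = "\<lambda>_. False" and L = L])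
    fix r' and t :: "nat \<Rightarrow> 'n \<Rightarrow> int" and c :: "nat \<Rightarrow> nat \<Rightarrow> 'k"
    assume c: "\<And>k. k < r' \<Longrightarrow> (\<lambda>j. c j k) \<in> Z (t k) \<and> \<not> False \<and> L \<le> t k"
      "\<And>j k. c j k \<noteq> 0 \<Longrightarrow> k < r'"
      "\<And>\<alpha>. \<not> False \<Longrightarrow> Z \<alpha> = mapply {..<r'} c ` fsupp {..<r'} t \<alpha>"
      "\<And>\<alpha> u k. u \<in> fsupp {..<r'} t \<alpha> \<Longrightarrow> mapply {..<r'} c u = (\<lambda>_. 0) \<Longrightarrow> u k \<noteq> 0 \<Longrightarrow> t k \<noteq> \<alpha>"
    have cZ: "(\<lambda>j. c j k) \<in> Z (t k)" if "c j k \<noteq> 0" for j k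
      using c(1)[OF c(2)[OF that]] by blast
    have "graded {..<r} s {..<r'} t c"
      unfolding graded_def using s1[OF cZ] s2[OF cZ] c(2) by blast
    moreover have "\<forall>j k. c j k \<noteq> 0 \<longrightarrow> s j \<noteq> t k"
      using min[OF cZ] by blast
    moreover have "level_cycles L r' t (\<lambda>\<alpha>. {u \<in> fsupp {..<r'} t \<alpha>. mapply {..<r'} c u = (\<lambda>_. 0)})"
      unfolding level_cycles_def
    proof (intro conjI allI impI)
      show "mono (\<lambda>\<alpha>. {u \<in> fsupp {..<r'} t \<alpha>. mapply {..<r'} c u = (\<lambda>_. 0)})"
        by (rule monoI) (auto simp: fsupp_def intro: order_trans)
      show "t k \<noteq> \<alpha>" if "u \<in> {u \<in> fsupp {..<r'} t \<alpha>. mapply {..<r'} c u = (\<lambda>_. 0)}" "u k \<noteq> 0" for \<alpha> u k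
        using c(4) that by blast
    qed (use c(1) mapply_kernel_subspace in auto)
    ultimately show ?thesis using c(3) by blast
  qed (fact sub M PB s1 L' finite_lessThan)+
qed

lemma augmentation_cover:
  fixes PA PB :: "('n::finite \<Rightarrow> int) \<Rightarrow> bool"
  assumes PA: "mono PA" and PB: "mono PB" and L: "\<And>\<alpha>. PA \<alpha> \<Longrightarrow> L \<le> \<alpha>"
  shows "\<exists>r s (a :: nat \<Rightarrow> 'k::field). (\<forall>j. a j \<noteq> 0 \<longrightarrow> j < r \<and> PA (s j)) \<and>
    (\<forall>\<alpha>. PA \<alpha> \<and> \<not> PB \<alpha> \<longrightarrow> (\<exists>u\<in>fsupp {..<r} s \<alpha>. (\<Sum>j<r. a j * u j) \<noteq> 0)) \<and>
    level_cycles L r s (\<lambda>\<alpha>. {u \<in> fsupp {..<r} s \<alpha>. (\<Sum>j<r. a j * u j) = 0 \<or> PB \<alpha>})"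
proof -
  \<comment> \<open>The strands of A inside a one-dimensional space: coordinate 0 is available
    precisely in the degrees of A.\<close>
  define M where "M = (\<lambda>\<alpha>. {u :: nat \<Rightarrow> 'k. \<forall>j. u j \<noteq> 0 \<longrightarrow> j = 0 \<and> PA \<alpha>})"
  have sub: "fun_space.subspace (M \<alpha>)" for \<alpha>
  proof (rule fun_space.subspaceI)
    fix x y assume *: "x \<in> M \<alpha>" "y \<in> M \<alpha>"
    have "x j \<noteq> 0 \<or> y j \<noteq> 0" if "(x + y) j \<noteq> 0" for j using that by auto
    then show "x + y \<in> M \<alpha>" using * unfolding M_def mem_Collect_eq by blast
  qed (auto simp: M_def)
  have M: "mono M" by (rule monoI) (use PA in \<open>auto simp: M_def dest: monoD\<close>)
  have s1: "j \<in> {0}" "L \<le> \<alpha>" if "u \<in> M \<alpha>" "u j \<noteq> 0" for u j \<alpha>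
    using that L by (auto simp: M_def)
  show ?thesis
  proof (rule minimal_generators[where M = M and N = "{0}" and PB = PB and L = L])
    fix r and s :: "nat \<Rightarrow> 'n \<Rightarrow> int" and c :: "nat \<Rightarrow> nat \<Rightarrow> 'k"
    assume c: "\<And>k. k < r \<Longrightarrow> (\<lambda>j. c j k) \<in> M (s k) \<and> \<not> PB (s k) \<and> L \<le> s k"
      "\<And>j k. c j k \<noteq> 0 \<Longrightarrow> k < r"
      "\<And>\<alpha>. \<not> PB \<alpha> \<Longrightarrow> M \<alpha> = mapply {..<r} c ` fsupp {..<r} s \<alpha>"
      "\<And>\<alpha> u k. u \<in> fsupp {..<r} s \<alpha> \<Longrightarrow> mapply {..<r} c u = (\<lambda>_. 0) \<Longrightarrow> u k \<noteq> 0 \<Longrightarrow> s k \<noteq> \<alpha>"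
    let ?a = "\<lambda>k. c 0 k"
    have c0: "j = 0 \<and> PA (s k)" if "c j k \<noteq> 0" for j k
      using c(1)[OF c(2)[OF that]] that unfolding M_def by blast
    have app: "mapply {..<r} c u = (\<lambda>j. if j = 0 then \<Sum>k<r. ?a k * u k else 0)" for u
    proof
      fix j show "mapply {..<r} c u j = (if j = 0 then \<Sum>k<r. ?a k * u k else 0)"
      proof (cases "j = 0")
        case False
        then have "c j k = 0" for k using c0 by blast
        then show ?thesis using False by (simp add: mapply_def)
      qed (simp add: mapply_def)
    qed
    have "\<forall>k. ?a k \<noteq> 0 \<longrightarrow> k < r \<and> PA (s k)" using c0 c(2) by blast
    moreover have "\<forall>\<alpha>. PA \<alpha> \<and> \<not> PB \<alpha> \<longrightarrow> (\<exists>u\<in>fsupp {..<r} s \<alpha>. (\<Sum>j<r. ?a j * u j) \<noteq> 0)"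
    proof (intro allI impI)
      fix \<alpha> assume \<alpha>: "PA \<alpha> \<and> \<not> PB \<alpha>"
      then have "(\<lambda>j. if j = 0 then 1 else 0) \<in> M \<alpha>" by (simp add: M_def)
      then obtain u where u: "u \<in> fsupp {..<r} s \<alpha>" "(\<lambda>j. if j = 0 then 1 else 0) = mapply {..<r} c u"
        using c(3) \<alpha> by blast
      have "(\<Sum>j<r. ?a j * u j) = 1" using fun_cong[OF u(2), of 0] app[of u] by simp
      then show "\<exists>u\<in>fsupp {..<r} s \<alpha>. (\<Sum>j<r. ?a j * u j) \<noteq> 0" using u(1) by (intro bexI[of _ u]) auto
    qed
    moreover have "level_cycles L r s (\<lambda>\<alpha>. {u \<in> fsupp {..<r} s \<alpha>. (\<Sum>j<r. ?a j * u j) = 0 \<or> PB \<alpha>})"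
      unfolding level_cycles_def
    proof (intro conjI allI impI)
      fix \<alpha>
      show "fun_space.subspace {u \<in> fsupp {..<r} s \<alpha>. (\<Sum>j<r. ?a j * u j) = 0 \<or> PB \<alpha>}"
      proof (rule fun_space.subspaceI)
        fix x y assume *: "x \<in> {u \<in> fsupp {..<r} s \<alpha>. (\<Sum>j<r. ?a j * u j) = 0 \<or> PB \<alpha>}"
          "y \<in> {u \<in> fsupp {..<r} s \<alpha>. (\<Sum>j<r. ?a j * u j) = 0 \<or> PB \<alpha>}"
        then have "x + y \<in> fsupp {..<r} s \<alpha>" by (intro fun_space.subspace_add[OF fsupp_subspace]) auto
        moreover have "(\<Sum>j<r. ?a j * (x + y) j) = (\<Sum>j<r. ?a j * x j) + (\<Sum>j<r. ?a j * y j)"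
          by (simp add: distrib_left sum.distrib)
        ultimately show "x + y \<in> {u \<in> fsupp {..<r} s \<alpha>. (\<Sum>j<r. ?a j * u j) = 0 \<or> PB \<alpha>}"
          using * by auto
      next
        fix d x assume *: "x \<in> {u \<in> fsupp {..<r} s \<alpha>. (\<Sum>j<r. ?a j * u j) = 0 \<or> PB \<alpha>}"
        have "(\<Sum>j<r. ?a j * (d * x j)) = d * (\<Sum>j<r. ?a j * x j)"
          by (simp add: sum_distrib_left mult_ac)
        then show "(\<lambda>j. d * x j) \<in> {u \<in> fsupp {..<r} s \<alpha>. (\<Sum>j<r. ?a j * u j) = 0 \<or> PB \<alpha>}"
          using * by (auto simp: fsupp_def)
      qed (auto simp: fsupp_def)
      \<comment> \<open>Generators are taken only in degrees outside \<open>PB\<close>. If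
        \<open>u\<close> involves one of degree \<alpha>, then \<open>u\<close> is a true relation
        rather than a chain that is a cycle because of \<open>PB\<close>, and minimality excludes
        it.\<close>
      show "s k \<noteq> \<alpha>" if u: "u \<in> {u \<in> fsupp {..<r} s \<alpha>. (\<Sum>j<r. ?a j * u j) = 0 \<or> PB \<alpha>}" "u k \<noteq> 0" for u k
      proof
        assume k: "s k = \<alpha>"
        have "k < r" using u by (auto simp: fsupp_def)
        then have "\<not> PB \<alpha>" using c(1) k by blast
        then have "mapply {..<r} c u = (\<lambda>_. 0)" using u(1) app[of u] by (auto simp: fun_eq_iff)
        then show False using c(4)[of u \<alpha> k] u k by blast
      qed
    next
      show "mono (\<lambda>\<alpha>. {u \<in> fsupp {..<r} s \<alpha>. (\<Sum>j<r. ?a j * u j) = 0 \<or> PB \<alpha>})"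
        by (rule monoI) (use PB in \<open>auto simp: fsupp_def intro: order_trans dest: monoD\<close>)
    qed (use c(1) in auto)
    ultimately show ?thesis by blast
  qed (fact sub M PB s1 finite.emptyI[THEN finite.insertI])+
qed

theorem minimal_strand_resolution_exists:
  fixes PA PB :: "('n::finite \<Rightarrow> int) \<Rightarrow> bool"
  assumes "mono PA" "mono PB" "\<And>\<alpha>. PA \<alpha> \<Longrightarrow> L \<le> \<alpha>"
  obtains X :: "('n \<Rightarrow> int, 'k::field) strands" and r :: "nat \<Rightarrow> nat" where
    "strand_resolution PA PB X" "minimal_strands X" "cells X = (\<lambda>i. {..<r i})"
proof -
  have "\<exists>r0 s0 (a :: nat \<Rightarrow> 'k). (\<forall>j. a j \<noteq> 0 \<longrightarrow> j < r0 \<and> PA (s0 j)) \<and>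
    (\<forall>\<alpha>. PA \<alpha> \<and> \<not> PB \<alpha> \<longrightarrow> (\<exists>u\<in>fsupp {..<r0} s0 \<alpha>. (\<Sum>j<r0. a j * u j) \<noteq> 0)) \<and>
    level_cycles L r0 s0 (\<lambda>\<alpha>. {u \<in> fsupp {..<r0} s0 \<alpha>. (\<Sum>j<r0. a j * u j) = 0 \<or> PB \<alpha>})"
    using assms by (rule augmentation_cover)
  then obtain r0 s0 and a :: "nat \<Rightarrow> 'k" where "(\<forall>j. a j \<noteq> 0 \<longrightarrow> j < r0 \<and> PA (s0 j)) \<and>
    (\<forall>\<alpha>. PA \<alpha> \<and> \<not> PB \<alpha> \<longrightarrow> (\<exists>u\<in>fsupp {..<r0} s0 \<alpha>. (\<Sum>j<r0. a j * u j) \<noteq> 0)) \<and>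
    level_cycles L r0 s0 (\<lambda>\<alpha>. {u \<in> fsupp {..<r0} s0 \<alpha>. (\<Sum>j<r0. a j * u j) = 0 \<or> PB \<alpha>})"
    by (elim exE)
  then have a: "\<And>j. a j \<noteq> 0 \<Longrightarrow> j < r0 \<and> PA (s0 j)"
    "\<And>\<alpha>. PA \<alpha> \<Longrightarrow> \<not> PB \<alpha> \<Longrightarrow> \<exists>u\<in>fsupp {..<r0} s0 \<alpha>. (\<Sum>j<r0. a j * u j) \<noteq> 0"
    "level_cycles L r0 s0 (\<lambda>\<alpha>. {u \<in> fsupp {..<r0} s0 \<alpha>. (\<Sum>j<r0. a j * u j) = 0 \<or> PB \<alpha>})"
    by blast+
  let ?Z0 = "\<lambda>\<alpha>. {u \<in> fsupp {..<r0} s0 \<alpha>. (\<Sum>j<r0. a j * u j) = 0 \<or> PB \<alpha>}"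
  \<comment> \<open>A state consists of the rank, the shifts and the syzygies of a level. The
    differential relates consecutive states and is selected after the whole sequence of
    states.\<close>
  let ?step = "\<lambda>x y c. graded {..<fst x} (fst (snd x)) {..<fst y} (fst (snd y)) c \<and>
    (\<forall>j k. c j k \<noteq> 0 \<longrightarrow> fst (snd x) j \<noteq> fst (snd y) k) \<and>
    (\<forall>\<alpha>. snd (snd x) \<alpha> = mapply {..<fst y} c ` fsupp {..<fst y} (fst (snd y)) \<alpha>) \<and>
    snd (snd y) = (\<lambda>\<alpha>. {u \<in> fsupp {..<fst y} (fst (snd y)) \<alpha>. mapply {..<fst y} c u = (\<lambda>_. 0)})"
  \<comment> \<open>The choice principle leaves the initial state free; the clause for
    \<open>n = 0\<close> pins it to the cover of A/B.\<close>
  let ?P = "\<lambda>(n::nat) x. level_cycles L (fst x) (fst (snd x)) (snd (snd x)) \<and> (n = 0 \<longrightarrow> x = (r0, s0, ?Z0))"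
  have "\<exists>f :: nat \<Rightarrow> nat \<times> (nat \<Rightarrow> 'n \<Rightarrow> int) \<times> (('n \<Rightarrow> int) \<Rightarrow> (nat \<Rightarrow> 'k) set).
    \<forall>n. ?P n (f n) \<and> (\<exists>c. ?step (f n) (f (Suc n)) c)"
  proof (rule dependent_nat_choice)
    show "\<exists>x. ?P 0 x" using a(3) by (intro exI[of _ "(r0, s0, ?Z0)"]) simp
  next
    fix x n assume "?P n x"
    then obtain r' t c where "graded {..<fst x} (fst (snd x)) {..<r'} t c"
      "\<forall>j k. c j k \<noteq> 0 \<longrightarrow> fst (snd x) j \<noteq> t k"
      "\<forall>\<alpha>. snd (snd x) \<alpha> = mapply {..<r'} c ` fsupp {..<r'} t \<alpha>"
      "level_cycles L r' t (\<lambda>\<alpha>. {u \<in> fsupp {..<r'} t \<alpha>. mapply {..<r'} c u = (\<lambda>_. 0)})"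
      using level_cycles_cover by blast
    then show "\<exists>y. ?P (Suc n) y \<and> (\<exists>c. ?step x y c)"
      by (intro exI[of _ "(r', t, \<lambda>\<alpha>. {u \<in> fsupp {..<r'} t \<alpha>. mapply {..<r'} c u = (\<lambda>_. 0)})"]
          conjI exI[of _ c]) simp_all
  qed
  then obtain f :: "nat \<Rightarrow> nat \<times> (nat \<Rightarrow> 'n \<Rightarrow> int) \<times> (('n \<Rightarrow> int) \<Rightarrow> (nat \<Rightarrow> 'k) set)"
    where f: "\<forall>n. ?P n (f n) \<and> (\<exists>c. ?step (f n) (f (Suc n)) c)" by (elim exE)
  have f0: "f 0 = (r0, s0, ?Z0)" using f by blast
  have "\<exists>c. \<forall>n. ?step (f n) (f (Suc n)) (c n)"
    by (intro choice allI) (rule conjunct2[OF f[THEN spec]])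
  then obtain c where c: "\<forall>n. ?step (f n) (f (Suc n)) (c n)" by (elim exE)
  note c1 = c[THEN spec, THEN conjunct1]
  note c2 = c[THEN spec, THEN conjunct2, THEN conjunct1]
  note c3 = c[THEN spec, THEN conjunct2, THEN conjunct2, THEN conjunct1]
  note c4 = c[THEN spec, THEN conjunct2, THEN conjunct2, THEN conjunct2]
  define X where "X = \<lparr>cells = (\<lambda>i. {..<fst (f i)}), cdeg = (\<lambda>i. fst (snd (f i))), bd = c, augc = a\<rparr>"
  have cyc: "cycles PB X i = snd (snd (f i))" for i
  proof
    fix \<alpha> show "cycles PB X i \<alpha> = snd (snd (f i)) \<alpha>"
    proof (cases i)
      case 0
      then show ?thesis by (simp add: X_def augm_def f0)
    next
      case (Suc n)
      have "snd (snd (f (Suc n))) = (\<lambda>\<alpha>. {u \<in> fsupp {..<fst (f (Suc n))} (fst (snd (f (Suc n)))) \<alpha>.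
          mapply {..<fst (f (Suc n))} (c n) u = (\<lambda>_. 0)})" by (rule c4)
      then show ?thesis unfolding Suc by (simp add: X_def bdmap_def)
    qed
  qed
  have "strand_resolution PA PB X"
    unfolding strand_resolution_def
  proof (intro conjI allI impI)
    fix i \<alpha>
    show "finite (cells X i)" by (simp add: X_def)
    show "graded (cells X i) (cdeg X i) (cells X (Suc i)) (cdeg X (Suc i)) (bd X i)"
      unfolding X_def strands.simps by (rule c1)
    show "cycles PB X i \<alpha> = bdmap X i ` chains X (Suc i) \<alpha>"
      unfolding cyc unfolding bdmap_def X_def strands.simps by (rule c3[THEN spec])
  next
    fix j assume "augc X j \<noteq> 0"
    then show "j \<in> cells X 0" "PA (cdeg X 0 j)" using a(1)[of j] by (simp_all add: X_def f0)
  next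
    fix \<alpha> assume "PA \<alpha> \<and> \<not> PB \<alpha>"
    then show "\<exists>u\<in>chains X 0 \<alpha>. augm X u \<noteq> 0" using a(2)[of \<alpha>] by (simp add: X_def augm_def f0)
  qed
  moreover have "minimal_strands X"
    unfolding minimal_strands_def X_def strands.simps using c2 by simp
  ultimately show thesis by (rule that[of X "\<lambda>i. fst (f i)"]) (simp add: X_def)
qed

section \<open>Monomial ideals\<close>

text \<open>Polynomials all of whose terms are divisible by a generator form an ideal containing the
  generators; conversely each such term is a multiple of a generator.\<close>

lemma mem_gen_ideal_monomials:
  fixes f :: "('n::finite, 'k::field) mpoly"
  shows "f \<in> gen_ideal (monomial ` T) \<longleftrightarrow> (\<forall>t\<in>Poly_Mapping.keys f. \<exists>g\<in>T. g \<le> t)"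
proof -
  interpret M: Modules.module "(*) :: ('n, 'k) mpoly \<Rightarrow> _"
    by unfold_locales (simp_all add: algebra_simps)
  let ?S = "monomial ` T :: ('n, 'k) mpoly set"
  show ?thesis
  proof
    assume "f \<in> gen_ideal ?S"
    then have "f \<in> M.span ?S" by (simp add: gen_ideal_def)
    moreover have "M.subspace {f. \<forall>t\<in>Poly_Mapping.keys f. \<exists>g\<in>T. g \<le> t}"
    proof (rule M.subspaceI)
      fix x y :: "('n, 'k) mpoly"
      assume "x \<in> {f. \<forall>t\<in>Poly_Mapping.keys f. \<exists>g\<in>T. g \<le> t}"
        "y \<in> {f. \<forall>t\<in>Poly_Mapping.keys f. \<exists>g\<in>T. g \<le> t}"
      then show "x + y \<in> {f. \<forall>t\<in>Poly_Mapping.keys f. \<exists>g\<in>T. g \<le> t}"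
        using Poly_Mapping.keys_add[of x y] by blast
    next
      fix c x :: "('n, 'k) mpoly"
      assume x: "x \<in> {f. \<forall>t\<in>Poly_Mapping.keys f. \<exists>g\<in>T. g \<le> t}"
      show "c * x \<in> {f. \<forall>t\<in>Poly_Mapping.keys f. \<exists>g\<in>T. g \<le> t}"
      proof (rule CollectI, rule ballI)
        fix t assume "t \<in> Poly_Mapping.keys (c * x)"
        then obtain a b where ab: "t = a + b" "b \<in> Poly_Mapping.keys x"
          using keys_mult[of c x] by blast
        then obtain g where "g \<in> T" "g \<le> b" using x by blast
        moreover have "b \<le> t" unfolding ab(1) by (simp add: le_fun_def)
        ultimately show "\<exists>g\<in>T. g \<le> t" by (meson order_trans)
      qed
    qed simp
    then have "M.span ?S \<subseteq> {f. \<forall>t\<in>Poly_Mapping.keys f. \<exists>g\<in>T. g \<le> t}"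
      by (intro M.span_minimal) (auto simp: monomial_def)
    ultimately show "\<forall>t\<in>Poly_Mapping.keys f. \<exists>g\<in>T. g \<le> t" by blast
  next
    assume f: "\<forall>t\<in>Poly_Mapping.keys f. \<exists>g\<in>T. g \<le> t"
    have "f = (\<Sum>t\<in>Poly_Mapping.keys f. Poly_Mapping.single t (Poly_Mapping.lookup f t))"
      by (rule poly_mapping_eqI)
         (auto simp: lookup_sum lookup_single when_def in_keys_iff)
    also have "\<dots> \<in> M.span ?S"
    proof (rule M.span_sum)
      fix t assume "t \<in> Poly_Mapping.keys f"
      then obtain g where g: "g \<in> T" "g \<le> t" using f by blast
      then have "t = (t - g) + g" by (auto simp: fun_eq_iff le_fun_def)
      then have "Poly_Mapping.single t (Poly_Mapping.lookup f t) =
          Poly_Mapping.single (t - g) (Poly_Mapping.lookup f t) * monomial g"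
        by (simp add: monomial_def mult_single)
      then show "Poly_Mapping.single t (Poly_Mapping.lookup f t) \<in> M.span ?S"
        using g(1) by (simp add: M.span_scale M.span_base)
    qed
    finally show "f \<in> gen_ideal ?S" by (simp add: gen_ideal_def)
  qed
qed

text \<open>For a monomial ideal this is the upward closed set of exponents that determines it. Sums
  of ideals turn into unions, and intersections remain intersections.\<close>

definition expo :: "('n::finite, 'k::field) mpoly set \<Rightarrow> ('n \<Rightarrow> nat) set" where
  "expo I = {t. monomial t \<in> I}"

lemma expo_gen_ideal: "expo (gen_ideal (monomial ` T) :: ('n::finite, 'k::field) mpoly set) = {t. \<exists>g\<in>T. g \<le> t}"
  unfolding expo_def mem_gen_ideal_monomials by (auto simp: monomial_def)

lemma mem_monomial_ideal:
  assumes "monomial_ideal I"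
  shows "f \<in> I \<longleftrightarrow> (\<forall>t\<in>Poly_Mapping.keys f. t \<in> expo I)"
proof -
  obtain T where T: "I = gen_ideal (monomial ` T)" using assms by (auto simp: monomial_ideal_def)
  show ?thesis unfolding T expo_gen_ideal mem_gen_ideal_monomials by simp
qed

lemma expo_upclosed:
  assumes "monomial_ideal I" "s \<in> expo I" "s \<le> t"
  shows "t \<in> expo I"
proof -
  obtain T where T: "I = gen_ideal (monomial ` T)" using assms by (auto simp: monomial_ideal_def)
  show ?thesis using assms(2,3) unfolding T expo_gen_ideal by (auto intro: order_trans)
qed

lemma monomial_ideal_eqI:
  "monomial_ideal I \<Longrightarrow> monomial_ideal J \<Longrightarrow> expo I = expo J \<Longrightarrow> I = J"
  by (auto simp: mem_monomial_ideal set_eq_iff)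

lemma monomial_idealI:
  fixes I :: "('n::finite, 'k::field) mpoly set"
  assumes "\<And>f. f \<in> I \<longleftrightarrow> (\<forall>t\<in>Poly_Mapping.keys f. t \<in> E)" and "\<And>s t. s \<in> E \<Longrightarrow> s \<le> t \<Longrightarrow> t \<in> E"
  shows "monomial_ideal I" "expo I = E"
proof -
  have "I = gen_ideal (monomial ` E)"
    using assms by (fastforce simp: set_eq_iff mem_gen_ideal_monomials)
  then show "monomial_ideal I" unfolding monomial_ideal_def by blast
  show "expo I = E" unfolding expo_def assms(1) by (auto simp: monomial_def)
qed

lemma monomial_ideal_gen: "monomial_ideal (gen_ideal (monomial ` T))"
  unfolding monomial_ideal_def by blast

lemma monomial_ideal_UNIV: "monomial_ideal UNIV" "expo UNIV = UNIV"
  by (rule monomial_idealI[of UNIV UNIV]; simp)+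

lemma monomial_ideal_zero: "monomial_ideal {0}" "expo {0} = {}"
  by (rule monomial_idealI[of "{0}" "{}"]; simp)+

lemma monomial_ideal_Int:
  assumes "monomial_ideal I" "monomial_ideal J"
  shows "monomial_ideal (I \<inter> J)" "expo (I \<inter> J) = expo I \<inter> expo J"
  by (rule monomial_idealI[of "I \<inter> J" "expo I \<inter> expo J"];
      use assms in \<open>auto simp: mem_monomial_ideal intro: expo_upclosed\<close>)+

lemma monomial_ideal_plus:
  fixes I J :: "('n::finite, 'k::field) mpoly set"
  assumes I: "monomial_ideal I" and J: "monomial_ideal J"
  shows "monomial_ideal (I + J)" "expo (I + J) = expo I \<union> expo J"
proof -
  have eq: "f \<in> I + J \<longleftrightarrow> (\<forall>t\<in>Poly_Mapping.keys f. t \<in> expo I \<union> expo J)" for f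
  proof
    assume "f \<in> I + J"
    then obtain g h where "f = g + h" "g \<in> I" "h \<in> J" by (elim set_plus_elim)
    then show "\<forall>t\<in>Poly_Mapping.keys f. t \<in> expo I \<union> expo J"
      using Poly_Mapping.keys_add[of g h] I J by (auto simp: mem_monomial_ideal)
  next
    assume f: "\<forall>t\<in>Poly_Mapping.keys f. t \<in> expo I \<union> expo J"
    \<comment> \<open>The terms of \<open>f\<close> lying in \<open>I\<close> are collected in
      \<open>g\<close>; the remaining ones must lie in \<open>J\<close>.\<close>
    define g where "g = (\<Sum>t\<in>Poly_Mapping.keys f \<inter> expo I. Poly_Mapping.single t (Poly_Mapping.lookup f t))"
    have lg: "Poly_Mapping.lookup g t = (if t \<in> expo I then Poly_Mapping.lookup f t else 0)" for t
      by (auto simp: g_def lookup_sum lookup_single when_def in_keys_iff)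
    have "g \<in> I" using I by (auto simp: mem_monomial_ideal in_keys_iff lg split: if_splits)
    moreover have "f - g \<in> J"
      using J f by (auto simp: mem_monomial_ideal in_keys_iff lookup_minus lg split: if_splits)
    ultimately have "g + (f - g) \<in> I + J" by (rule set_plus_intro)
    then show "f \<in> I + J" by simp
  qed
  show "monomial_ideal (I + J)" "expo (I + J) = expo I \<union> expo J"
    by (rule monomial_idealI[of "I + J" "expo I \<union> expo J"];
        use eq I J in \<open>auto intro: expo_upclosed\<close>)+
qed

lemma min_gens_expo: "min_gens I = {t \<in> expo I. \<forall>s\<in>expo I. s \<le> t \<longrightarrow> s = t}"
  by (auto simp: min_gens_def expo_def)

text \<open>Descent along proper divisors, measured by total degree.\<close>

lemma min_gens_below:
  fixes t :: "'n::finite \<Rightarrow> nat"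
  assumes "t \<in> expo I"
  obtains g where "g \<in> min_gens I" "g \<le> t"
proof -
  have "\<exists>g\<in>min_gens I. g \<le> t"
    using assms
  proof (induction "\<Sum>v\<in>UNIV. t v" arbitrary: t rule: less_induct)
    case less
    show ?case
    proof (cases "t \<in> min_gens I")
      case False
      then obtain s where s: "s \<in> expo I" "s \<le> t" "s \<noteq> t" using less.prems by (auto simp: min_gens_expo)
      then obtain v where "s v \<noteq> t v" by (auto simp: fun_eq_iff)
      then have "(\<Sum>v\<in>UNIV. s v) < (\<Sum>v\<in>UNIV. t v)"
        using s(2) by (intro sum_strict_mono_ex1) (auto simp: le_fun_def intro!: exI[of _ v] le_neq_implies_less)
      from less.hyps[OF this s(1)] s(2) show ?thesis by (blast intro: order_trans)
    qed blast
  qed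
  then show thesis using that by blast
qed

lemma expo_min_gens:
  assumes "monomial_ideal I"
  shows "expo I = {t. \<exists>g\<in>min_gens I. g \<le> t}"
proof (intro equalityI subsetI)
  fix t assume "t \<in> expo I"
  then show "t \<in> {t. \<exists>g\<in>min_gens I. g \<le> t}" using min_gens_below by blast
qed (use assms in \<open>auto simp: min_gens_expo intro: expo_upclosed\<close>)

section \<open>Homogeneous components in integer degrees\<close>

definition hmono :: "('n \<Rightarrow> int) \<Rightarrow> 'k \<Rightarrow> ('n, 'k::field) mpoly" where
  "hmono \<delta> c = (if 0 \<le> \<delta> then Poly_Mapping.single (\<lambda>v. nat (\<delta> v)) c else 0)"

text \<open>Differences of shifts are integer vectors, so coefficients are indexed by these, with
  value 0 when a coordinate is negative. Product formulas then use true subtraction of degrees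
  instead of truncated subtraction of exponents.\<close>

definition hcoeff :: "('n \<Rightarrow> int) \<Rightarrow> ('n, 'k::field) mpoly \<Rightarrow> 'k" where
  "hcoeff \<delta> f = (if 0 \<le> \<delta> then Poly_Mapping.lookup f (\<lambda>v. nat (\<delta> v)) else 0)"

text \<open>For the exponents \<open>E\<close> of a monomial ideal: its strand in degree \<delta> is
  nonzero. This is the predicate substituted for \<open>PA\<close> and \<open>PB\<close>.\<close>

definition in_degree :: "('n \<Rightarrow> nat) set \<Rightarrow> ('n \<Rightarrow> int) \<Rightarrow> bool" where
  "in_degree E \<delta> \<longleftrightarrow> 0 \<le> \<delta> \<and> (\<lambda>v. nat (\<delta> v)) \<in> E"

lemma nat_mdeg [simp]: "(\<lambda>v. nat (mdeg t v)) = t"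
  by (simp add: mdeg_def)

lemma mdeg_nonneg [simp]: "0 \<le> mdeg t"
  by (simp add: mdeg_def le_fun_def)

lemma mdeg_nat: "0 \<le> \<delta> \<Longrightarrow> mdeg (\<lambda>v. nat (\<delta> v)) = \<delta>"
  by (simp add: mdeg_def le_fun_def fun_eq_iff)

lemma hcoeff_add [simp]: "hcoeff \<delta> (f + g) = hcoeff \<delta> f + hcoeff \<delta> g"
  by (simp add: hcoeff_def lookup_add)

lemma hcoeff_minus [simp]: "hcoeff \<delta> (f - g) = hcoeff \<delta> f - hcoeff \<delta> g"
  by (simp add: hcoeff_def lookup_minus)

lemma hcoeff_zero [simp]: "hcoeff \<delta> 0 = 0"
  by (simp add: hcoeff_def)

lemma hcoeff_sum: "hcoeff \<delta> (sum f A) = (\<Sum>x\<in>A. hcoeff \<delta> (f x))"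
  by (induction A rule: infinite_finite_induct) auto

lemma hcoeff_mdeg [simp]: "hcoeff (mdeg t) f = Poly_Mapping.lookup f t"
  by (simp add: hcoeff_def)

lemma hcoeff_eqI: "(\<And>\<delta>. hcoeff \<delta> f = hcoeff \<delta> g) \<Longrightarrow> f = g"
  by (rule poly_mapping_eqI) (metis hcoeff_mdeg)

lemma hcoeff_hmono: "hcoeff \<beta> (hmono \<delta> c) = (if 0 \<le> \<delta> \<and> \<beta> = \<delta> then c else 0)"
proof -
  have "\<beta> = \<delta>" if "0 \<le> \<beta>" "0 \<le> \<delta>" "(\<lambda>v. nat (\<beta> v)) = (\<lambda>v. nat (\<delta> v))"
    using that mdeg_nat by metis
  then show ?thesis by (auto simp: hcoeff_def hmono_def lookup_single when_def)
qed

lemma homogeneous_eq_hmono: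
  assumes "homogeneous \<delta> f"
  shows "f = hmono \<delta> (hcoeff \<delta> f)"
proof (rule hcoeff_eqI)
  fix \<beta>
  show "hcoeff \<beta> f = hcoeff \<beta> (hmono \<delta> (hcoeff \<delta> f))"
  proof (cases "hcoeff \<beta> f = 0")
    case False
    then have "0 \<le> \<beta>" "(\<lambda>v. nat (\<beta> v)) \<in> Poly_Mapping.keys f"
      by (auto simp: hcoeff_def in_keys_iff split: if_splits)
    then have "\<beta> = \<delta>" using assms mdeg_nat unfolding homogeneous_def by metis
    then show ?thesis using \<open>0 \<le> \<beta>\<close> by (simp add: hcoeff_hmono)
  qed (auto simp: hcoeff_hmono)
qed

lemma homogeneous_hmono: "homogeneous \<delta> (hmono \<delta> c)"
  by (auto simp: homogeneous_def hmono_def mdeg_nat split: if_splits)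

lemma lookup_single_times:
  fixes f :: "('n::finite, 'k::field) mpoly"
  shows "Poly_Mapping.lookup (Poly_Mapping.single s c * f) t =
    (if s \<le> t then c * Poly_Mapping.lookup f (t - s) else 0)"
proof -
  have "f = (\<Sum>u\<in>Poly_Mapping.keys f. Poly_Mapping.single u (Poly_Mapping.lookup f u))"
    by (rule poly_mapping_eqI) (auto simp: lookup_sum lookup_single when_def in_keys_iff)
  then have "Poly_Mapping.single s c * f =
      (\<Sum>u\<in>Poly_Mapping.keys f. Poly_Mapping.single (s + u) (c * Poly_Mapping.lookup f u))"
    by (metis (no_types, lifting) mult_single sum.cong sum_distrib_left)
  then have *: "Poly_Mapping.lookup (Poly_Mapping.single s c * f) t =
      (\<Sum>u\<in>Poly_Mapping.keys f. if s + u = t then c * Poly_Mapping.lookup f u else 0)"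
    by (simp add: lookup_sum lookup_single when_def)
  show ?thesis
  proof (cases "s \<le> t")
    case True
    then have "s + (t - s) = t" by (simp add: fun_eq_iff le_fun_def)
    then have "s + u = t \<longleftrightarrow> u = t - s" for u by (metis add_left_cancel)
    then show ?thesis using True unfolding * by (simp add: in_keys_iff)
  next
    case False
    then have "s + u \<noteq> t" for u by (auto simp: le_fun_def)
    then show ?thesis using False unfolding * by simp
  qed
qed

lemma hcoeff_hmono_times:
  fixes f :: "('n::finite, 'k::field) mpoly"
  shows "hcoeff \<alpha> (hmono \<delta> c * f) = (if 0 \<le> \<delta> then c * hcoeff (\<alpha> - \<delta>) f else 0)"
proof (cases "0 \<le> \<delta>")
  case True
  have 1: "0 \<le> \<alpha> - \<delta> \<longleftrightarrow> 0 \<le> \<alpha> \<and> (\<lambda>v. nat (\<delta> v)) \<le> (\<lambda>v. nat (\<alpha> v))"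
  proof -
    have "0 \<le> \<alpha> v - \<delta> v \<longleftrightarrow> 0 \<le> \<alpha> v \<and> nat (\<delta> v) \<le> nat (\<alpha> v)" for v
      using True[THEN le_funD, of v] by auto
    then show ?thesis unfolding le_fun_def by (auto simp del: diff_ge_0_iff_ge)
  qed
  have 2: "(\<lambda>v. nat (\<alpha> v)) - (\<lambda>v. nat (\<delta> v)) = (\<lambda>v. nat ((\<alpha> - \<delta>) v))"
  proof
    show "((\<lambda>v. nat (\<alpha> v)) - (\<lambda>v. nat (\<delta> v))) v = nat ((\<alpha> - \<delta>) v)" for v
      using True[THEN le_funD, of v] by auto
  qed
  show ?thesis using True unfolding hcoeff_def hmono_def 1 by (auto simp: lookup_single_times 2)
qed (simp add: hmono_def)

lemma mem_monomial_ideal_hcoeff: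
  assumes "monomial_ideal I"
  shows "f \<in> I \<longleftrightarrow> (\<forall>\<delta>. hcoeff \<delta> f \<noteq> 0 \<longrightarrow> in_degree (expo I) \<delta>)"
proof
  assume "f \<in> I"
  then show "\<forall>\<delta>. hcoeff \<delta> f \<noteq> 0 \<longrightarrow> in_degree (expo I) \<delta>"
    using assms by (auto simp: mem_monomial_ideal hcoeff_def in_degree_def in_keys_iff)
next
  assume *: "\<forall>\<delta>. hcoeff \<delta> f \<noteq> 0 \<longrightarrow> in_degree (expo I) \<delta>"
  have "t \<in> expo I" if "t \<in> Poly_Mapping.keys f" for t
    using *[rule_format, of "mdeg t"] that by (simp add: in_keys_iff in_degree_def)
  then show "f \<in> I" using assms by (simp add: mem_monomial_ideal)
qed

lemma in_degree_mono:
  assumes "monomial_ideal I"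
  shows "mono (in_degree (expo I))"
proof (rule monoI, rule le_boolI)
  fix \<alpha> \<beta> :: "'a \<Rightarrow> int" assume "\<alpha> \<le> \<beta>" "in_degree (expo I) \<alpha>"
  moreover have "(\<lambda>v. nat (\<alpha> v)) \<le> (\<lambda>v. nat (\<beta> v))"
    using \<open>\<alpha> \<le> \<beta>\<close> by (simp add: le_fun_def nat_mono)
  ultimately show "in_degree (expo I) \<beta>"
    using expo_upclosed[OF assms] unfolding in_degree_def by (blast intro: order_trans)
qed

section \<open>Free resolutions and their strands\<close>

text \<open>The component of degree \<alpha> of a vector that need not be homogeneous. Basis element
  \<open>j\<close> has degree \<open>s j\<close>, so its coefficient is read off at
  \<open>\<alpha> - s j\<close>.\<close>

definition strand :: "(nat \<Rightarrow> 'n \<Rightarrow> int) \<Rightarrow> ('n \<Rightarrow> int) \<Rightarrow> ('n, 'k::field) mpoly vec \<Rightarrow> nat \<Rightarrow> 'k" where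
  "strand s \<alpha> w = (\<lambda>j. if j < dim_vec w then hcoeff (\<alpha> - s j) (w $ j) else 0)"

lemma strand_fsupp: "w \<in> carrier_vec r \<Longrightarrow> strand s \<alpha> w \<in> fsupp {..<r} s \<alpha>"
  by (auto simp: strand_def fsupp_def hcoeff_def le_fun_def split: if_splits)

lemma vec_eq_strandI:
  assumes "v \<in> carrier_vec r" "w \<in> carrier_vec r" "\<And>\<alpha>. strand s \<alpha> v = strand s \<alpha> w"
  shows "v = w"
proof (rule eq_vecI)
  fix j assume j: "j < dim_vec w"
  show "v $ j = w $ j"
  proof (rule hcoeff_eqI)
    fix \<delta>
    have "strand s (\<delta> + s j) v j = strand s (\<delta> + s j) w j" using assms(3) by simp
    then show "hcoeff \<delta> (v $ j) = hcoeff \<delta> (w $ j)" using j assms(1,2) by (simp add: strand_def)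
  qed
qed (use assms in auto)

lemma finite_strands:
  fixes w :: "('n::finite, 'k::field) mpoly vec"
  shows "finite {\<alpha>. strand s \<alpha> w \<noteq> (\<lambda>_. 0)}"
proof (rule finite_subset)
  show "{\<alpha>. strand s \<alpha> w \<noteq> (\<lambda>_. 0)} \<subseteq> (\<Union>j<dim_vec w. (\<lambda>t. mdeg t + s j) ` Poly_Mapping.keys (w $ j))"
  proof
    fix \<alpha> assume "\<alpha> \<in> {\<alpha>. strand s \<alpha> w \<noteq> (\<lambda>_. 0)}"
    then obtain j where "strand s \<alpha> w j \<noteq> 0" by (auto simp: fun_eq_iff)
    then have j: "j < dim_vec w" "0 \<le> \<alpha> - s j" "(\<lambda>v. nat ((\<alpha> - s j) v)) \<in> Poly_Mapping.keys (w $ j)"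
      by (auto simp: strand_def hcoeff_def in_keys_iff split: if_splits)
    have "\<alpha> = mdeg (\<lambda>v. nat ((\<alpha> - s j) v)) + s j" unfolding mdeg_nat[OF j(2)] by simp
    then show "\<alpha> \<in> (\<Union>j<dim_vec w. (\<lambda>t. mdeg t + s j) ` Poly_Mapping.keys (w $ j))"
      using j(1,3) by blast
  qed
qed auto

text \<open>A free module is the direct sum of its strands, so a family of components glues to a
  vector provided that finitely many are nonzero.\<close>

lemma vec_of_strands:
  fixes U :: "('n::finite \<Rightarrow> int) \<Rightarrow> nat \<Rightarrow> 'k::field"
  assumes U: "\<And>\<alpha>. U \<alpha> \<in> fsupp {..<r} s \<alpha>" and fin: "finite {\<alpha>. U \<alpha> \<noteq> (\<lambda>_. 0)}"
  obtains w where "w \<in> carrier_vec r" "\<And>\<alpha>. strand s \<alpha> w = U \<alpha>"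
proof (rule that)
  let ?A = "{\<alpha>. U \<alpha> \<noteq> (\<lambda>_. 0)}"
  let ?w = "vec r (\<lambda>j. \<Sum>\<alpha>\<in>?A. hmono (\<alpha> - s j) (U \<alpha> j))"
  show "?w \<in> carrier_vec r" by simp
  fix \<beta>
  show "strand s \<beta> ?w = U \<beta>"
  proof
    fix j
    have U0: "U \<beta> j = 0" if "\<not> (j < r \<and> 0 \<le> \<beta> - s j)"
      using U[of \<beta>] that by (auto simp: fsupp_def le_fun_def)
    show "strand s \<beta> ?w j = U \<beta> j"
    proof (cases "j < r")
      case True
      have "strand s \<beta> ?w j = (\<Sum>\<alpha>\<in>?A. hcoeff (\<beta> - s j) (hmono (\<alpha> - s j) (U \<alpha> j)))"
        using True by (simp add: strand_def hcoeff_sum)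
      also have "\<dots> = (\<Sum>\<alpha>\<in>?A. if \<alpha> = \<beta> then U \<alpha> j else 0)"
        by (rule sum.cong) (use U0 in \<open>auto simp: hcoeff_hmono\<close>)
      also have "\<dots> = U \<beta> j" by (cases "U \<beta> = (\<lambda>_. 0)") (simp_all add: sum.delta[OF fin])
      finally show ?thesis .
    qed (use U0 in \<open>simp add: strand_def\<close>)
  qed
qed

text \<open>An element of one strand becomes a homogeneous vector when extended by 0 in all other
  degrees, and 0 is admissible there. So exactness of polynomial complexes can be tested strand by
  strand.\<close>

lemma strand_sets_eq_iff:
  fixes Z Z' :: "('n::finite \<Rightarrow> int) \<Rightarrow> (nat \<Rightarrow> 'k::field) set"
  assumes "\<And>\<alpha>. Z \<alpha> \<subseteq> fsupp {..<r} s \<alpha>" "\<And>\<alpha>. Z' \<alpha> \<subseteq> fsupp {..<r} s \<alpha>"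
    and "\<And>\<alpha>. (\<lambda>_. 0) \<in> Z \<alpha>" "\<And>\<alpha>. (\<lambda>_. 0) \<in> Z' \<alpha>"
  shows "{w \<in> carrier_vec r. \<forall>\<alpha>. strand s \<alpha> w \<in> Z \<alpha>} = {w \<in> carrier_vec r. \<forall>\<alpha>. strand s \<alpha> w \<in> Z' \<alpha>}
    \<longleftrightarrow> (\<forall>\<alpha>. Z \<alpha> = Z' \<alpha>)"
proof -
  have *: "Z1 \<alpha> \<subseteq> Z2 \<alpha>"
    if sub: "\<And>\<alpha>. Z1 \<alpha> \<subseteq> fsupp {..<r} s \<alpha>" and z: "\<And>\<alpha>. (\<lambda>_. 0) \<in> Z1 \<alpha>"
      and imp: "\<And>w. w \<in> carrier_vec r \<Longrightarrow> \<forall>\<alpha>. strand s \<alpha> w \<in> Z1 \<alpha> \<Longrightarrow> \<forall>\<alpha>. strand s \<alpha> w \<in> Z2 \<alpha>"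
    for Z1 Z2 :: "('n \<Rightarrow> int) \<Rightarrow> (nat \<Rightarrow> 'k) set" and \<alpha>
  proof
    fix u assume u: "u \<in> Z1 \<alpha>"
    let ?U = "\<lambda>\<beta>. if \<beta> = \<alpha> then u else (\<lambda>_. 0)"
    have U: "?U \<beta> \<in> Z1 \<beta>" for \<beta> using u z by simp
    have "finite {\<beta>. ?U \<beta> \<noteq> (\<lambda>_. 0)}" by (rule finite_subset[of _ "{\<alpha>}"]) auto
    then obtain w where w: "w \<in> carrier_vec r" "\<And>\<beta>. strand s \<beta> w = ?U \<beta>"
      using vec_of_strands[of ?U r s] U sub by blast
    then have "\<forall>\<beta>. strand s \<beta> w \<in> Z2 \<beta>" using imp[OF w(1)] U by simp
    then have "strand s \<alpha> w \<in> Z2 \<alpha>" ..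
    then show "u \<in> Z2 \<alpha>" using w(2) by simp
  qed
  show ?thesis
  proof
    assume eq: "{w \<in> carrier_vec r. \<forall>\<alpha>. strand s \<alpha> w \<in> Z \<alpha>} = {w \<in> carrier_vec r. \<forall>\<alpha>. strand s \<alpha> w \<in> Z' \<alpha>}"
    show "\<forall>\<alpha>. Z \<alpha> = Z' \<alpha>"
    proof (intro allI equalityI)
      show "Z \<alpha> \<subseteq> Z' \<alpha>" for \<alpha> by (rule *[OF assms(1,3)]) (use eq in blast)
      show "Z' \<alpha> \<subseteq> Z \<alpha>" for \<alpha> by (rule *[OF assms(2,4)]) (use eq in blast)
    qed
  qed simp
qed

context
  fixes r r' :: nat and s s' :: "nat \<Rightarrow> 'n::finite \<Rightarrow> int" and c :: "nat \<Rightarrow> nat \<Rightarrow> 'k::field"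
    and M :: "('n, 'k) mpoly mat"
  assumes M: "M \<in> carrier_mat r r'"
    and entries: "\<And>j k. j < r \<Longrightarrow> k < r' \<Longrightarrow> M $$ (j, k) = hmono (s' k - s j) (c j k)"
    and graded: "graded {..<r} s {..<r'} s' c"
begin

lemma strand_mult_mat_vec:
  assumes w: "w \<in> carrier_vec r'"
  shows "strand s \<alpha> (M *\<^sub>v w) = mapply {..<r'} c (strand s' \<alpha> w)"
proof
  fix j
  show "strand s \<alpha> (M *\<^sub>v w) j = mapply {..<r'} c (strand s' \<alpha> w) j"
  proof (cases "j < r")
    case True
    have "(M *\<^sub>v w) $ j = (\<Sum>k<r'. hmono (s' k - s j) (c j k) * w $ k)"
      using M w True by (auto simp: scalar_prod_def entries atLeast0LessThan intro!: sum.cong)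
    then have "strand s \<alpha> (M *\<^sub>v w) j = (\<Sum>k<r'. hcoeff (\<alpha> - s j) (hmono (s' k - s j) (c j k) * w $ k))"
      using True M by (simp add: strand_def hcoeff_sum)
    also have "\<dots> = (\<Sum>k<r'. c j k * strand s' \<alpha> w k)"
    proof (rule sum.cong[OF refl])
      fix k assume k: "k \<in> {..<r'}"
      have "c j k = 0" if "\<not> 0 \<le> s' k - s j"
        using graded that unfolding graded_def by (auto simp: le_fun_def)
      then show "hcoeff (\<alpha> - s j) (hmono (s' k - s j) (c j k) * w $ k) = c j k * strand s' \<alpha> w k"
        using k w by (auto simp: hcoeff_hmono_times strand_def)
    qed
    finally show ?thesis by (simp add: mapply_def)
  next
    case False
    then have "c j k = 0" for k using graded unfolding graded_def by blast
    then show ?thesis using False M by (simp add: strand_def mapply_def)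
  qed
qed

lemma image_mat_strands:
  "image_mat M = {v \<in> carrier_vec r. \<forall>\<alpha>. strand s \<alpha> v \<in> mapply {..<r'} c ` fsupp {..<r'} s' \<alpha>}"
proof (intro equalityI subsetI)
  fix v assume "v \<in> image_mat M"
  then obtain w where w: "w \<in> carrier_vec r'" "v = M *\<^sub>v w" using M by (auto simp: image_mat_def)
  then show "v \<in> {v \<in> carrier_vec r. \<forall>\<alpha>. strand s \<alpha> v \<in> mapply {..<r'} c ` fsupp {..<r'} s' \<alpha>}"
    using M strand_fsupp[OF w(1)] by (auto simp: strand_mult_mat_vec)
next
  fix v assume v: "v \<in> {v \<in> carrier_vec r. \<forall>\<alpha>. strand s \<alpha> v \<in> mapply {..<r'} c ` fsupp {..<r'} s' \<alpha>}"
  \<comment> \<open>Taking the zero preimage wherever the strand of \<open>v\<close> is zero leaves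
    finitely many nonzero preimages, so they glue to one vector.\<close>
  have "\<exists>u. u \<in> fsupp {..<r'} s' \<alpha> \<and> mapply {..<r'} c u = strand s \<alpha> v \<and>
      (strand s \<alpha> v = (\<lambda>_. 0) \<longrightarrow> u = (\<lambda>_. 0))" for \<alpha>
  proof (cases "strand s \<alpha> v = (\<lambda>_. 0)")
    case True
    then show ?thesis by (intro exI[of _ "\<lambda>_. 0"]) (auto simp: fsupp_def mapply_def)
  next
    case False
    then show ?thesis using v by force
  qed
  then obtain U where U: "\<And>\<alpha>. U \<alpha> \<in> fsupp {..<r'} s' \<alpha>" "\<And>\<alpha>. mapply {..<r'} c (U \<alpha>) = strand s \<alpha> v"
    "\<And>\<alpha>. strand s \<alpha> v = (\<lambda>_. 0) \<longrightarrow> U \<alpha> = (\<lambda>_. 0)" by metis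
  have "finite {\<alpha>. U \<alpha> \<noteq> (\<lambda>_. 0)}"
    by (rule finite_subset[OF _ finite_strands[of s v]]) (use U(3) in auto)
  then obtain w where w: "w \<in> carrier_vec r'" "\<And>\<alpha>. strand s' \<alpha> w = U \<alpha>"
    using vec_of_strands[of U r' s'] U(1) by blast
  have "v = M *\<^sub>v w"
    by (rule vec_eq_strandI[of _ r _ s]) (use v M w U(2) in \<open>auto simp: strand_mult_mat_vec\<close>)
  then show "v \<in> image_mat M" using w(1) M by (auto simp: image_mat_def)
qed

lemma mat_kernel_strands:
  "mat_kernel M = {w \<in> carrier_vec r'. \<forall>\<alpha>. strand s' \<alpha> w \<in> {u \<in> fsupp {..<r'} s' \<alpha>. mapply {..<r'} c u = (\<lambda>_. 0)}}"
proof -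
  have "M *\<^sub>v w = 0\<^sub>v r \<longleftrightarrow> (\<forall>\<alpha>. strand s' \<alpha> w \<in> {u \<in> fsupp {..<r'} s' \<alpha>. mapply {..<r'} c u = (\<lambda>_. 0)})"
    if w: "w \<in> carrier_vec r'" for w
  proof -
    have z: "strand s \<alpha> (0\<^sub>v r) = (\<lambda>_. 0)" for \<alpha> by (auto simp: strand_def)
    have "M *\<^sub>v w = 0\<^sub>v r \<longleftrightarrow> (\<forall>\<alpha>. strand s \<alpha> (M *\<^sub>v w) = (\<lambda>_. 0))"
      using vec_eq_strandI[of "M *\<^sub>v w" r "0\<^sub>v r" s] mult_mat_vec_carrier[OF M w] by (auto simp: z)
    then show ?thesis using strand_fsupp[OF w] by (simp add: strand_mult_mat_vec[OF w])
  qed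
  then show ?thesis using M by (auto simp: mat_kernel_def)
qed

end

section \<open>Passage between free complexes and their strands\<close>

definition homogeneous_complex :: "('n, 'k::field) free_complex \<Rightarrow> bool" where
  "homogeneous_complex F \<longleftrightarrow> aug F \<in> carrier_vec (rank F 0) \<and>
     (\<forall>j<rank F 0. homogeneous (shift F 0 j) (aug F $ j)) \<and>
     (\<forall>i. diff F i \<in> carrier_mat (rank F i) (rank F (Suc i))) \<and>
     (\<forall>i. \<forall>j<rank F i. \<forall>k<rank F (Suc i).
        homogeneous (shift F (Suc i) k - shift F i j) (diff F i $$ (j, k)))"

text \<open>Each entry of a homogeneous matrix is replaced by its only possibly nonzero coefficient,
  and zeros outside the ranks make the matrices total.\<close>

definition strands_of :: "('n, 'k::field) free_complex \<Rightarrow> ('n \<Rightarrow> int, 'k) strands" where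
  "strands_of F = \<lparr>cells = (\<lambda>i. {..<rank F i}), cdeg = shift F,
     bd = (\<lambda>i j k. if j < rank F i \<and> k < rank F (Suc i)
       then hcoeff (shift F (Suc i) k - shift F i j) (diff F i $$ (j, k)) else 0),
     augc = (\<lambda>j. if j < rank F 0 then hcoeff (shift F 0 j) (aug F $ j) else 0)\<rparr>"

text \<open>Each clause splits into its homogeneous parts: membership in \<open>A\<close> constrains
  degrees, surjectivity is tested on single monomials, and exactness compares graded
  submodules.\<close>

lemma free_resolution_iff_strands:
  fixes F :: "('n::finite, 'k::field) free_complex"
  assumes F: "homogeneous_complex F" and A: "monomial_ideal A" and B: "monomial_ideal B"
  shows "free_resolution A B F \<longleftrightarrow>
    strand_resolution (in_degree (expo A)) (in_degree (expo B)) (strands_of F)"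
proof -
  define X where "X = strands_of F"
  let ?s = "shift F 0" and ?PA = "in_degree (expo A)" and ?PB = "in_degree (expo B)"
  have M: "diff F i \<in> carrier_mat (rank F i) (rank F (Suc i))" for i
    using F by (simp add: homogeneous_complex_def)
  have cells: "cells X i = {..<rank F i}" "cdeg X i = shift F i" for i
    by (simp_all add: X_def strands_of_def)
  have graded: "graded {..<rank F i} (shift F i) {..<rank F (Suc i)} (shift F (Suc i)) (bd X i)" for i
    by (auto simp: graded_def X_def strands_of_def hcoeff_def le_fun_def split: if_splits)
  have entries: "diff F i $$ (j, k) = hmono (shift F (Suc i) k - shift F i j) (bd X i j k)"
    if "j < rank F i" "k < rank F (Suc i)" for i j k
  proof -
    have "homogeneous (shift F (Suc i) k - shift F i j) (diff F i $$ (j, k))"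
      using F that by (simp add: homogeneous_complex_def)
    from homogeneous_eq_hmono[OF this] show ?thesis using that by (simp add: X_def strands_of_def)
  qed
  have aug: "aug F $ j = hmono (?s j) (augc X j)" if "j < rank F 0" for j
  proof -
    have "homogeneous (?s j) (aug F $ j)" using F that by (simp add: homogeneous_complex_def)
    from homogeneous_eq_hmono[OF this] show ?thesis using that by (simp add: X_def strands_of_def)
  qed
  have augc: "j < rank F 0 \<and> 0 \<le> ?s j" if "augc X j \<noteq> 0" for j
    using that by (auto simp: X_def strands_of_def hcoeff_def split: if_splits)
  have augm: "hcoeff \<alpha> (aug F \<bullet> w) = augm X (strand ?s \<alpha> w)" if w: "w \<in> carrier_vec (rank F 0)" for w \<alpha>
  proof -
    have "hcoeff \<alpha> (aug F \<bullet> w) = (\<Sum>j<rank F 0. hcoeff \<alpha> (hmono (?s j) (augc X j) * w $ j))"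
      using w aug by (simp add: scalar_prod_def hcoeff_sum atLeast0LessThan)
    also have "\<dots> = augm X (strand ?s \<alpha> w)"
      unfolding augm_def cells
      by (rule sum.cong) (use augc w in \<open>auto simp: hcoeff_hmono_times strand_def\<close>)
    finally show ?thesis .
  qed
  have memA: "(\<forall>j<rank F 0. aug F $ j \<in> A) \<longleftrightarrow> (\<forall>j. augc X j \<noteq> 0 \<longrightarrow> j \<in> cells X 0 \<and> ?PA (cdeg X 0 j))"
  proof -
    have "aug F $ j \<in> A \<longleftrightarrow> (augc X j \<noteq> 0 \<longrightarrow> ?PA (?s j))" if "j < rank F 0" for j
      unfolding mem_monomial_ideal_hcoeff[OF A] aug[OF that] hcoeff_hmono using augc by auto
    then show ?thesis unfolding cells using augc by auto
  qed
  have surj: "(\<forall>f\<in>A. \<exists>w\<in>carrier_vec (rank F 0). f - aug F \<bullet> w \<in> B) \<longleftrightarrow>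
      (\<forall>\<alpha>. ?PA \<alpha> \<and> \<not> ?PB \<alpha> \<longrightarrow> (\<exists>u\<in>chains X 0 \<alpha>. augm X u \<noteq> 0))"
  proof
    assume *: "\<forall>f\<in>A. \<exists>w\<in>carrier_vec (rank F 0). f - aug F \<bullet> w \<in> B"
    show "\<forall>\<alpha>. ?PA \<alpha> \<and> \<not> ?PB \<alpha> \<longrightarrow> (\<exists>u\<in>chains X 0 \<alpha>. augm X u \<noteq> 0)"
    proof (intro allI impI)
      fix \<alpha> assume \<alpha>: "?PA \<alpha> \<and> \<not> ?PB \<alpha>"
      then have "hmono \<alpha> 1 \<in> A" by (auto simp: mem_monomial_ideal_hcoeff[OF A] hcoeff_hmono split: if_splits)
      then obtain w where w: "w \<in> carrier_vec (rank F 0)" "hmono \<alpha> 1 - aug F \<bullet> w \<in> B" using * by blast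
      have "hcoeff \<alpha> (hmono \<alpha> 1 - aug F \<bullet> w) = 0"
        using w(2) \<alpha> by (auto simp: mem_monomial_ideal_hcoeff[OF B])
      then have "augm X (strand ?s \<alpha> w) = 1"
        using \<alpha> augm[OF w(1), of \<alpha>] by (simp add: hcoeff_hmono in_degree_def)
      then show "\<exists>u\<in>chains X 0 \<alpha>. augm X u \<noteq> 0"
        using strand_fsupp[OF w(1), of ?s \<alpha>] unfolding cells by (intro bexI[of _ "strand ?s \<alpha> w"]) auto
    qed
  next
    assume *: "\<forall>\<alpha>. ?PA \<alpha> \<and> \<not> ?PB \<alpha> \<longrightarrow> (\<exists>u\<in>chains X 0 \<alpha>. augm X u \<noteq> 0)"
    show "\<forall>f\<in>A. \<exists>w\<in>carrier_vec (rank F 0). f - aug F \<bullet> w \<in> B"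
    proof
      fix f assume f: "f \<in> A"
      \<comment> \<open>The zero chain is prescribed in degrees where \<open>f\<close> has no
        component, so that finitely many nonzero chains remain to be glued.\<close>
      have "\<exists>u. u \<in> chains X 0 \<alpha> \<and> (augm X u = hcoeff \<alpha> f \<or> ?PB \<alpha>) \<and> (hcoeff \<alpha> f = 0 \<longrightarrow> u = (\<lambda>_. 0))" for \<alpha>
      proof (cases "hcoeff \<alpha> f = 0 \<or> ?PB \<alpha>")
        case True
        then show ?thesis by (intro exI[of _ "\<lambda>_. 0"]) (auto simp: fsupp_def augm_def)
      next
        case False
        then have "?PA \<alpha>" using f by (auto simp: mem_monomial_ideal_hcoeff[OF A])
        then obtain u where u: "u \<in> chains X 0 \<alpha>" "augm X u \<noteq> 0" using * False by blast
        let ?v = "\<lambda>j. hcoeff \<alpha> f / augm X u * u j"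
        have "augm X ?v = hcoeff \<alpha> f / augm X u * augm X u"
          unfolding augm_def[of X ?v] unfolding augm_def[of X u] sum_distrib_left
          by (intro sum.cong) auto
        then show ?thesis using u False by (intro exI[of _ ?v]) (auto simp: fsupp_def)
      qed
      then obtain U where U: "\<And>\<alpha>. U \<alpha> \<in> chains X 0 \<alpha>" "\<And>\<alpha>. augm X (U \<alpha>) = hcoeff \<alpha> f \<or> ?PB \<alpha>"
        "\<And>\<alpha>. hcoeff \<alpha> f = 0 \<longrightarrow> U \<alpha> = (\<lambda>_. 0)" by metis
      have "{\<alpha>. U \<alpha> \<noteq> (\<lambda>_. 0)} \<subseteq> mdeg ` Poly_Mapping.keys f"
      proof
        fix \<alpha> assume "\<alpha> \<in> {\<alpha>. U \<alpha> \<noteq> (\<lambda>_. 0)}"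
        then have "hcoeff \<alpha> f \<noteq> 0" using U(3) by blast
        then have "0 \<le> \<alpha>" "(\<lambda>v. nat (\<alpha> v)) \<in> Poly_Mapping.keys f"
          by (auto simp: hcoeff_def in_keys_iff split: if_splits)
        then show "\<alpha> \<in> mdeg ` Poly_Mapping.keys f" using mdeg_nat[of \<alpha>] by (metis image_eqI)
      qed
      then have "finite {\<alpha>. U \<alpha> \<noteq> (\<lambda>_. 0)}" by (rule finite_subset) simp
      then obtain w where w: "w \<in> carrier_vec (rank F 0)" "\<And>\<alpha>. strand ?s \<alpha> w = U \<alpha>"
        using vec_of_strands[of U "rank F 0" ?s] U(1) unfolding cells by blast
      have "f - aug F \<bullet> w \<in> B"
        unfolding mem_monomial_ideal_hcoeff[OF B] hcoeff_minus augm[OF w(1)] w(2)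
        using U(2) by (metis right_minus_eq)
      then show "\<exists>w\<in>carrier_vec (rank F 0). f - aug F \<bullet> w \<in> B" using w(1) by blast
    qed
  qed
  have cyc0: "{w \<in> carrier_vec (rank F 0). aug F \<bullet> w \<in> B} =
      {w \<in> carrier_vec (rank F 0). \<forall>\<alpha>. strand ?s \<alpha> w \<in> cycles ?PB X 0 \<alpha>}"
  proof -
    have "aug F \<bullet> w \<in> B \<longleftrightarrow> (\<forall>\<alpha>. strand ?s \<alpha> w \<in> cycles ?PB X 0 \<alpha>)" if w: "w \<in> carrier_vec (rank F 0)" for w
      unfolding mem_monomial_ideal_hcoeff[OF B] augm[OF w] cycles.simps cells
      using strand_fsupp[OF w, of ?s] by auto
    then show ?thesis by auto
  qed
  have cycS: "mat_kernel (diff F i) = {w \<in> carrier_vec (rank F (Suc i)).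
      \<forall>\<alpha>. strand (shift F (Suc i)) \<alpha> w \<in> cycles ?PB X (Suc i) \<alpha>}" for i
    using mat_kernel_strands[OF M entries graded, of i] by (simp add: bdmap_def cells)
  have img: "image_mat (diff F i) = {w \<in> carrier_vec (rank F i).
      \<forall>\<alpha>. strand (shift F i) \<alpha> w \<in> bdmap X i ` chains X (Suc i) \<alpha>}" for i
    using image_mat_strands[OF M entries graded, of i] by (simp add: bdmap_def cells)
  have c0: "(\<lambda>_. 0) \<in> cycles ?PB X i \<alpha>" for i \<alpha>
    by (cases i) (auto simp: fsupp_def augm_def bdmap_def mapply_def)
  have i0: "(\<lambda>_. 0) \<in> bdmap X i ` chains X (Suc i) \<alpha>" for i \<alpha>
    by (rule image_eqI[of _ _ "\<lambda>_. 0"]) (auto simp: fsupp_def bdmap_def mapply_def)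
  have isub: "bdmap X i ` chains X (Suc i) \<alpha> \<subseteq> fsupp {..<rank F i} (shift F i) \<alpha>" for i \<alpha>
    unfolding bdmap_def cells using mapply_fsupp[OF graded] by blast
  have csub: "cycles ?PB X i \<alpha> \<subseteq> fsupp {..<rank F i} (shift F i) \<alpha>" for i \<alpha>
    using cycles_subset[of ?PB X i \<alpha>] unfolding cells .
  have ex: "{w \<in> carrier_vec (rank F i). \<forall>\<alpha>. strand (shift F i) \<alpha> w \<in> cycles ?PB X i \<alpha>} =
      image_mat (diff F i) \<longleftrightarrow> (\<forall>\<alpha>. cycles ?PB X i \<alpha> = bdmap X i ` chains X (Suc i) \<alpha>)" for i
    unfolding img by (rule strand_sets_eq_iff[OF csub isub c0 i0])
  have exact: "({w \<in> carrier_vec (rank F 0). aug F \<bullet> w \<in> B} = image_mat (diff F 0) \<and>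
      (\<forall>i. mat_kernel (diff F i) = image_mat (diff F (Suc i)))) \<longleftrightarrow>
      (\<forall>i \<alpha>. cycles ?PB X i \<alpha> = bdmap X i ` chains X (Suc i) \<alpha>)"
  proof -
    have "(\<forall>i \<alpha>. cycles ?PB X i \<alpha> = bdmap X i ` chains X (Suc i) \<alpha>) \<longleftrightarrow>
      (\<forall>\<alpha>. cycles ?PB X 0 \<alpha> = bdmap X 0 ` chains X (Suc 0) \<alpha>) \<and>
      (\<forall>i \<alpha>. cycles ?PB X (Suc i) \<alpha> = bdmap X (Suc i) ` chains X (Suc (Suc i)) \<alpha>)"
      by (metis not0_implies_Suc)
    then show ?thesis unfolding cyc0 cycS ex by simp
  qed
  have "free_resolution A B F \<longleftrightarrow> (\<forall>j<rank F 0. aug F $ j \<in> A) \<and>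
      (\<forall>f\<in>A. \<exists>w\<in>carrier_vec (rank F 0). f - aug F \<bullet> w \<in> B) \<and>
      ({w \<in> carrier_vec (rank F 0). aug F \<bullet> w \<in> B} = image_mat (diff F 0) \<and>
      (\<forall>i. mat_kernel (diff F i) = image_mat (diff F (Suc i))))"
    using F unfolding free_resolution_def homogeneous_complex_def by blast
  also have "\<dots> \<longleftrightarrow> strand_resolution ?PA ?PB X"
    unfolding memA surj exact strand_resolution_def using graded by (auto simp: cells)
  finally show ?thesis unfolding X_def .
qed

text \<open>The constant term is the component of degree 0, and a homogeneous entry can have one
  only between equal shifts.\<close>

lemma minimal_free_resolution_iff_strands:
  fixes F :: "('n::finite, 'k::field) free_complex"
  assumes F: "homogeneous_complex F" and A: "monomial_ideal A" and B: "monomial_ideal B"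
  shows "minimal_free_resolution A B F \<longleftrightarrow>
    strand_resolution (in_degree (expo A)) (in_degree (expo B)) (strands_of F) \<and> minimal_strands (strands_of F)"
proof -
  have *: "Poly_Mapping.lookup (diff F i $$ (j, k)) 0 = 0 \<longleftrightarrow>
      (hcoeff (shift F (Suc i) k - shift F i j) (diff F i $$ (j, k)) \<noteq> 0 \<longrightarrow> shift F i j \<noteq> shift F (Suc i) k)"
    if "j < rank F i" "k < rank F (Suc i)" for i j k
  proof -
    have h: "homogeneous (shift F (Suc i) k - shift F i j) (diff F i $$ (j, k))"
      using F that by (simp add: homogeneous_complex_def)
    have l: "Poly_Mapping.lookup f 0 = hcoeff 0 f" for f :: "('n, 'k) mpoly"
      by (simp add: hcoeff_def zero_fun_def)
    show ?thesis
      unfolding l by (subst homogeneous_eq_hmono[OF h]) (auto simp: hcoeff_hmono)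
  qed
  have "minimal_strands (strands_of F) \<longleftrightarrow> (\<forall>i. \<forall>j<rank F i. \<forall>k<rank F (Suc i).
      hcoeff (shift F (Suc i) k - shift F i j) (diff F i $$ (j, k)) \<noteq> 0 \<longrightarrow> shift F i j \<noteq> shift F (Suc i) k)"
    unfolding minimal_strands_def strands_of_def strands.simps by (simp split: if_split; blast)
  also have "\<dots> \<longleftrightarrow> (\<forall>i. \<forall>j<rank F i. \<forall>k<rank F (Suc i). Poly_Mapping.lookup (diff F i $$ (j, k)) 0 = 0)"
    using * by blast
  finally show ?thesis
    unfolding minimal_free_resolution_def free_resolution_iff_strands[OF assms] by blast
qed

lemma minimal_free_resolution_exists:
  fixes A B :: "('n::finite, 'k::field) mpoly set"
  assumes A: "monomial_ideal A" and B: "monomial_ideal B"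
  shows "\<exists>F. minimal_free_resolution A B F"
proof -
  let ?PA = "in_degree (expo A)" and ?PB = "in_degree (expo B)"
  obtain X :: "('n \<Rightarrow> int, 'k) strands" and r where X: "strand_resolution ?PA ?PB X" "minimal_strands X"
    "cells X = (\<lambda>i. {..<r i})"
    by (rule minimal_strand_resolution_exists[OF in_degree_mono[OF A] in_degree_mono[OF B], of 0])
       (auto simp: in_degree_def)
  define F where "F = \<lparr>rank = r, shift = cdeg X,
    diff = (\<lambda>i. mat (r i) (r (Suc i)) (\<lambda>(j, k). hmono (cdeg X (Suc i) k - cdeg X i j) (bd X i j k))),
    aug = vec (r 0) (\<lambda>j. hmono (cdeg X 0 j) (augc X j))\<rparr>"
  have F: "homogeneous_complex F"
    by (auto simp: homogeneous_complex_def F_def homogeneous_hmono)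
  have "graded {..<r i} (cdeg X i) {..<r (Suc i)} (cdeg X (Suc i)) (bd X i)" for i
    using X(1,3) by (simp add: strand_resolution_def)
  then have bd: "bd X i j k = 0 \<or> j < r i \<and> k < r (Suc i) \<and> 0 \<le> cdeg X (Suc i) k - cdeg X i j" for i j k
    unfolding graded_def by (auto simp: le_fun_def)
  have augc: "augc X j = 0 \<or> j < r 0 \<and> 0 \<le> cdeg X 0 j" for j
    using X(1,3) by (auto simp: strand_resolution_def in_degree_def)
  \<comment> \<open>The coefficients of \<open>X\<close> vanish outside the ranks and wherever the
    monomial would have a negative exponent, so nothing is lost in the polynomial complex.\<close>
  have "strands_of F = X"
  proof (rule strands.equality)
    show "bd (strands_of F) = bd X"
    proof (intro ext)
      show "bd (strands_of F) i j k = bd X i j k" for i j k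
        using bd[of i j k] by (auto simp: strands_of_def F_def hcoeff_hmono)
    qed
    show "augc (strands_of F) = augc X"
    proof
      show "augc (strands_of F) j = augc X j" for j
        using augc[of j] by (auto simp: strands_of_def F_def hcoeff_hmono)
    qed
  qed (simp_all add: strands_of_def F_def X(3))
  then show ?thesis using minimal_free_resolution_iff_strands[OF F A B] X by auto
qed

text \<open>The resolution selected by \<open>betti\<close> and \<open>X\<close> are both minimal,
  so the graded ranks of each are at most those of the other.\<close>

theorem betti_eq_card:
  fixes A B :: "('n::finite, 'k::field) mpoly set"
  assumes A: "monomial_ideal A" and B: "monomial_ideal B"
    and X: "strand_resolution (in_degree (expo A)) (in_degree (expo B)) (X :: ('n \<Rightarrow> int, 'k) strands)"
      "minimal_strands X"
  shows "betti A B i \<alpha> = card {j \<in> cells X i. cdeg X i j = \<alpha>}"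
proof -
  define F where "F = (SOME F. minimal_free_resolution A B F)"
  have m: "minimal_free_resolution A B F"
    unfolding F_def by (rule someI_ex[OF minimal_free_resolution_exists[OF A B]])
  then have F: "homogeneous_complex F"
    unfolding minimal_free_resolution_def free_resolution_def homogeneous_complex_def by blast
  have Y: "strand_resolution (in_degree (expo A)) (in_degree (expo B)) (strands_of F)"
    "minimal_strands (strands_of F)"
    using m minimal_free_resolution_iff_strands[OF F A B] by auto
  have "betti A B i \<alpha> = card {j \<in> cells (strands_of F) i. cdeg (strands_of F) i j = \<alpha>}"
    by (simp add: betti_def F_def[symmetric] strands_of_def)
  also have "\<dots> = card {j \<in> cells X i. cdeg X i j = \<alpha>}"
    using minimal_strands_card_le[OF X(1) Y(1) in_degree_mono[OF B] X(2)]
      minimal_strands_card_le[OF Y(1) X(1) in_degree_mono[OF B] Y(2)] by (intro order_antisym) auto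
  finally show ?thesis .
qed

section \<open>Truncation at the exponent bound\<close>

definition bounded_degree :: "('n \<Rightarrow> int extended) \<Rightarrow> ('n \<Rightarrow> int) \<Rightarrow> bool" where
  "bounded_degree a \<alpha> \<longleftrightarrow> (\<forall>v. Fin (\<alpha> v) \<le> a v)"

definition cut_degree :: "('n \<Rightarrow> int extended) \<Rightarrow> ('n \<Rightarrow> int) \<Rightarrow> 'n \<Rightarrow> int" where
  "cut_degree a \<alpha> = (\<lambda>v. case a v of Fin b \<Rightarrow> min (\<alpha> v) b | _ \<Rightarrow> \<alpha> v)"

text \<open>The property of \<open>\<tau>\<close> that truncation of strands requires. With a bound
  \<open>Minf\<close> no degree would be bounded, so a largest bounded degree below \<alpha> could
  not exist.\<close>

lemma le_cut_degree_iff: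
  assumes "\<And>v. a v \<noteq> Minf"
  shows "\<beta> \<le> cut_degree a \<alpha> \<longleftrightarrow> \<beta> \<le> \<alpha> \<and> bounded_degree a \<beta>"
proof -
  have "\<beta> v \<le> cut_degree a \<alpha> v \<longleftrightarrow> \<beta> v \<le> \<alpha> v \<and> Fin (\<beta> v) \<le> a v" for v
    using assms[of v] by (cases "a v") (auto simp: cut_degree_def)
  then show ?thesis by (auto simp: le_fun_def bounded_degree_def)
qed

lemma a_monomial_mdeg: "a_monomial a t \<longleftrightarrow> bounded_degree a (mdeg t)"
  by (simp add: a_monomial_def bounded_degree_def mdeg_def)

lemma a_monomial_antimono: "a_monomial a t \<Longrightarrow> s \<le> t \<Longrightarrow> a_monomial a s"
  unfolding a_monomial_def le_fun_def by (meson less_eq_extended.simps(1) of_nat_mono order_trans)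

text \<open>Boundedness is tested in each coordinate, where \<open>sup\<close> is a maximum. The
  behaviour of both intersections and faces under truncation rests on this.\<close>

lemma a_monomial_sup: "a_monomial a (sup s t) \<longleftrightarrow> a_monomial a s \<and> a_monomial a t"
proof -
  have "Fin (int (sup s t v)) \<le> a v \<longleftrightarrow> Fin (int (s v)) \<le> a v \<and> Fin (int (t v)) \<le> a v" for v
    by (cases "a v") (auto simp: sup_max)
  then show ?thesis unfolding a_monomial_def by blast
qed

section \<open>The ideal of the bounded minimal generators and its Betti numbers\<close>

definition truncated_ideal :: "('n \<Rightarrow> int extended) \<Rightarrow> ('n::finite, 'k::field) mpoly set \<Rightarrow> ('n, 'k) mpoly set" where
  "truncated_ideal a I = gen_ideal (monomial ` {t \<in> min_gens I. a_monomial a t})"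

lemma monomial_truncated_ideal: "monomial_ideal (truncated_ideal a I)"
  unfolding truncated_ideal_def by (rule monomial_ideal_gen)

lemma expo_truncated_ideal: "expo (truncated_ideal a I) = {t. \<exists>g\<in>min_gens I. a_monomial a g \<and> g \<le> t}"
  by (auto simp: truncated_ideal_def expo_gen_ideal)

lemma min_gens_truncated_ideal: "min_gens (truncated_ideal a I) = {t \<in> min_gens I. a_monomial a t}"
proof (intro equalityI subsetI)
  fix t assume t: "t \<in> min_gens (truncated_ideal a I)"
  then obtain g where g: "g \<in> min_gens I" "a_monomial a g" "g \<le> t"
    by (auto simp: min_gens_expo[of "truncated_ideal a I"] expo_truncated_ideal)
  then have "g \<in> expo (truncated_ideal a I)" by (auto simp: expo_truncated_ideal)
  then have "g = t" using t g(3) by (auto simp: min_gens_expo[of "truncated_ideal a I"])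
  then show "t \<in> {t \<in> min_gens I. a_monomial a t}" using g by simp
next
  fix t assume t: "t \<in> {t \<in> min_gens I. a_monomial a t}"
  have "s = t" if s: "s \<in> expo (truncated_ideal a I)" "s \<le> t" for s
  proof -
    obtain g where g: "g \<in> min_gens I" "g \<le> s" using s(1) by (auto simp: expo_truncated_ideal)
    then have "g = t" using t s(2) by (auto simp: min_gens_expo)
    then show ?thesis using g(2) s(2) by simp
  qed
  then show "t \<in> min_gens (truncated_ideal a I)"
    using t by (auto simp: min_gens_expo[of "truncated_ideal a I"] expo_truncated_ideal)
qed

lemma in_degree_up_set: "in_degree {t. \<exists>g\<in>G. g \<le> t} \<alpha> \<longleftrightarrow> (\<exists>g\<in>G. mdeg g \<le> \<alpha>)"
proof
  assume "in_degree {t. \<exists>g\<in>G. g \<le> t} \<alpha>"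
  then obtain g where g: "0 \<le> \<alpha>" "g \<in> G" "g \<le> (\<lambda>v. nat (\<alpha> v))" by (auto simp: in_degree_def)
  have "mdeg g \<le> \<alpha>"
  proof (rule le_funI)
    show "mdeg g v \<le> \<alpha> v" for v
      using le_funD[OF g(1), of v] le_funD[OF g(3), of v] by (simp add: mdeg_def)
  qed
  then show "\<exists>g\<in>G. mdeg g \<le> \<alpha>" using g(2) by blast
next
  assume "\<exists>g\<in>G. mdeg g \<le> \<alpha>"
  then obtain g where g: "g \<in> G" "mdeg g \<le> \<alpha>" by blast
  have "0 \<le> \<alpha>" using g(2) mdeg_nonneg order_trans by blast
  moreover have "g \<le> (\<lambda>v. nat (\<alpha> v))"
  proof (rule le_funI)
    show "g v \<le> nat (\<alpha> v)" for v using le_funD[OF g(2), of v] by (simp add: mdeg_def)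
  qed
  ultimately show "in_degree {t. \<exists>g\<in>G. g \<le> t} \<alpha>" using g(1) by (auto simp: in_degree_def)
qed

text \<open>A generator has degree at most \<open>cut_degree a \<alpha>\<close> precisely if it is
  an \<open>a\<close>-monomial of degree at most \<alpha>. This identifies what a truncated complex
  resolves.\<close>

lemma in_degree_truncated_ideal:
  assumes a: "\<And>v. a v \<noteq> Minf" and I: "monomial_ideal I"
  shows "in_degree (expo (truncated_ideal a I)) \<alpha> \<longleftrightarrow> in_degree (expo I) (cut_degree a \<alpha>)"
proof -
  have *: "expo (truncated_ideal a I) = {t. \<exists>g\<in>{g \<in> min_gens I. a_monomial a g}. g \<le> t}"
    by (auto simp: expo_truncated_ideal)
  show ?thesis
    unfolding * expo_min_gens[OF I] in_degree_up_set le_cut_degree_iff[of a, OF a] a_monomial_mdeg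
    by blast
qed

text \<open>Both ideals are left general so that Betti numbers of an ideal, with second ideal 0, and
  of a quotient, with first ideal R, are instances.\<close>

lemma betti_truncation:
  fixes A A' B B' :: "('n::finite, 'k::field) mpoly set"
  assumes a: "\<And>v. a v \<noteq> Minf"
    and "monomial_ideal A" "monomial_ideal B" "monomial_ideal A'" "monomial_ideal B'"
    and A': "\<And>\<alpha>. in_degree (expo A') \<alpha> \<longleftrightarrow> in_degree (expo A) (cut_degree a \<alpha>)"
    and B': "\<And>\<alpha>. in_degree (expo B') \<alpha> \<longleftrightarrow> in_degree (expo B) (cut_degree a \<alpha>)"
  shows "betti A' B' i \<alpha> = (if bounded_degree a \<alpha> then betti A B i \<alpha> else 0)"
proof -
  obtain X :: "('n \<Rightarrow> int, 'k) strands" and r where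
    X: "strand_resolution (in_degree (expo A)) (in_degree (expo B)) X" "minimal_strands X"
      "cells X = (\<lambda>i. {..<r i})"
    by (rule minimal_strand_resolution_exists[OF in_degree_mono[OF assms(2)] in_degree_mono[OF assms(3)], of 0])
       (auto simp: in_degree_def)
  have eq: "in_degree (expo A') = (\<lambda>\<alpha>. in_degree (expo A) (cut_degree a \<alpha>))"
    "in_degree (expo B') = (\<lambda>\<alpha>. in_degree (expo B) (cut_degree a \<alpha>))"
    using A' B' by blast+
  have "strand_resolution (in_degree (expo A')) (in_degree (expo B')) (truncate_strands (bounded_degree a) X)"
    unfolding eq by (rule truncate_strands_resolution[OF X(1) le_cut_degree_iff[of a, OF a]])
  from betti_eq_card[OF assms(4,5) this truncate_strands_minimal[OF X(2)]] show ?thesis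
    unfolding betti_eq_card[OF assms(2,3) X(1,2)] truncate_strands_card .
qed

lemma betti_ideal_truncated:
  assumes a: "\<And>v. a v \<noteq> Minf" and I: "monomial_ideal I"
  shows "betti_ideal (truncated_ideal a I) i \<alpha> = (if bounded_degree a \<alpha> then betti_ideal I i \<alpha> else 0)"
  by (rule betti_truncation[of a, OF a I monomial_ideal_zero(1) monomial_truncated_ideal monomial_ideal_zero(1)
        in_degree_truncated_ideal[of a, OF a I]]) (simp add: monomial_ideal_zero(2) in_degree_def)

lemma betti_quotient_truncated:
  assumes a: "\<And>v. 0 \<le> a v" and I: "monomial_ideal I"
  shows "betti_quotient (truncated_ideal a I) i \<alpha> = (if bounded_degree a \<alpha> then betti_quotient I i \<alpha> else 0)"
proof -
  have M: "a v \<noteq> Minf" for v using a[of v] by (cases "a v") (auto simp: zero_extended_def)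
  show ?thesis
  proof (rule betti_truncation[of a, OF M monomial_ideal_UNIV(1) I monomial_ideal_UNIV(1) monomial_truncated_ideal
        _ in_degree_truncated_ideal[of a, OF M I]])
    \<comment> \<open>Nonnegativity of \<open>a\<close> enters here: cutting preserves nonnegativity
      of degrees, so R is its own truncation.\<close>
    have "bounded_degree a 0" using a by (simp add: bounded_degree_def zero_extended_def)
    then show "in_degree (expo UNIV) \<alpha> \<longleftrightarrow> in_degree (expo UNIV) (cut_degree a \<alpha>)" for \<alpha>
      by (simp add: monomial_ideal_UNIV(2) in_degree_def le_cut_degree_iff[of a, OF M])
  qed
qed

lemma truncated_ideal_plus:
  assumes "monomial_ideal J" "monomial_ideal K" "min_gens (J + K) = min_gens J \<union> min_gens K"
  shows "truncated_ideal a (J + K) = truncated_ideal a J + truncated_ideal a K"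
proof (rule monomial_ideal_eqI)
  show "expo (truncated_ideal a (J + K)) = expo (truncated_ideal a J + truncated_ideal a K)"
    unfolding monomial_ideal_plus(2)[OF monomial_truncated_ideal monomial_truncated_ideal]
    by (auto simp: expo_truncated_ideal assms(3))
qed (simp_all add: monomial_truncated_ideal monomial_ideal_plus)

text \<open>Bounded generators of \<open>J\<close> and \<open>K\<close> have a bounded lcm, and a
  minimal generator of the intersection dividing that lcm is bounded. Conversely, a bounded monomial
  in the intersection is divisible by generators of \<open>J\<close> and of \<open>K\<close>, which
  are bounded as divisors of it.\<close>

lemma truncated_ideal_Int:
  fixes J K :: "('n::finite, 'k::field) mpoly set"
  assumes J: "monomial_ideal J" and K: "monomial_ideal K"
  shows "truncated_ideal a (J \<inter> K) = truncated_ideal a J \<inter> truncated_ideal a K"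
proof (rule monomial_ideal_eqI)
  show "expo (truncated_ideal a (J \<inter> K)) = expo (truncated_ideal a J \<inter> truncated_ideal a K)"
    unfolding monomial_ideal_Int(2)[OF monomial_truncated_ideal monomial_truncated_ideal]
  proof (intro equalityI subsetI)
    fix t assume "t \<in> expo (truncated_ideal a (J \<inter> K))"
    then obtain g where g: "g \<in> min_gens (J \<inter> K)" "a_monomial a g" "g \<le> t"
      by (auto simp: expo_truncated_ideal)
    have "t \<in> expo (truncated_ideal a L)" if gL: "g \<in> expo L" for L :: "('n, 'k) mpoly set"
    proof -
      obtain h where h: "h \<in> min_gens L" "h \<le> g" using gL by (rule min_gens_below)
      then have "a_monomial a h" "h \<le> t" using a_monomial_antimono[OF g(2) h(2)] g(3) by auto
      then show ?thesis using h(1) by (auto simp: expo_truncated_ideal)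
    qed
    moreover have "g \<in> expo J" "g \<in> expo K"
      using g(1) by (auto simp: min_gens_expo monomial_ideal_Int(2)[OF J K])
    ultimately show "t \<in> expo (truncated_ideal a J) \<inter> expo (truncated_ideal a K)" by blast
  next
    fix t assume "t \<in> expo (truncated_ideal a J) \<inter> expo (truncated_ideal a K)"
    then obtain g h where g: "g \<in> min_gens J" "a_monomial a g" "g \<le> t"
      and h: "h \<in> min_gens K" "a_monomial a h" "h \<le> t" by (auto simp: expo_truncated_ideal)
    have "sup g h \<in> expo (J \<inter> K)"
      using g(1) h(1) expo_upclosed[OF J, of g "sup g h"] expo_upclosed[OF K, of h "sup g h"]
      by (simp add: monomial_ideal_Int(2)[OF J K] min_gens_expo)
    then obtain f where f: "f \<in> min_gens (J \<inter> K)" "f \<le> sup g h" by (rule min_gens_below)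
    moreover have "a_monomial a f"
      using a_monomial_antimono[OF _ f(2)] g(2) h(2) by (simp add: a_monomial_sup)
    moreover have "f \<le> t" using f(2) g(3) h(3) by (meson le_sup_iff order_trans)
    ultimately show "t \<in> expo (truncated_ideal a (J \<inter> K))" by (auto simp: expo_truncated_ideal)
  qed
qed (simp_all add: monomial_truncated_ideal monomial_ideal_Int)

text \<open>All Betti numbers in the splitting formula are restricted to the same degrees, so the
  formula survives termwise.\<close>

lemma betti_splitting_truncated:
  assumes a: "\<And>v. a v \<noteq> Minf" and S: "betti_splitting I J K"
  shows "betti_splitting (truncated_ideal a I) (truncated_ideal a J) (truncated_ideal a K)"
proof -
  have J: "monomial_ideal J" and K: "monomial_ideal K" and I: "I = J + K"
    and G: "min_gens I = min_gens J \<union> min_gens K" "min_gens J \<inter> min_gens K = {}"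
    and b: "\<And>i \<alpha>. betti_ideal I i \<alpha> = betti_ideal J i \<alpha> + betti_ideal K i \<alpha> +
        (if i = 0 then 0 else betti_ideal (J \<inter> K) (i - 1) \<alpha>)"
    using S by (auto simp: betti_splitting_def)
  have MI: "monomial_ideal I" unfolding I by (rule monomial_ideal_plus(1)[OF J K])
  note betti = betti_ideal_truncated[of a, OF a]
  show ?thesis
    unfolding betti_splitting_def
  proof (intro conjI allI)
    show "truncated_ideal a I = truncated_ideal a J + truncated_ideal a K"
      using truncated_ideal_plus[OF J K] G(1) unfolding I by blast
    fix i \<alpha>
    show "betti_ideal (truncated_ideal a I) i \<alpha> =
        betti_ideal (truncated_ideal a J) i \<alpha> + betti_ideal (truncated_ideal a K) i \<alpha> +
        (if i = 0 then 0 else betti_ideal (truncated_ideal a J \<inter> truncated_ideal a K) (i - 1) \<alpha>)"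
      unfolding truncated_ideal_Int[OF J K, symmetric] betti[OF MI] betti[OF J] betti[OF K]
        betti[OF monomial_ideal_Int(1)[OF J K]] by (simp add: b)
  qed (use G in \<open>auto simp: monomial_truncated_ideal min_gens_truncated_ideal\<close>)
qed

section \<open>Pruning and truncation\<close>

lemma lcm_face_insert:
  assumes "finite \<sigma>"
  shows "lcm_face ms (insert i \<sigma>) = sup (ms ! i) (lcm_face ms \<sigma>)"
proof -
  have "insert 0 ((!) ms ` insert i \<sigma>) = insert (ms ! i) (insert 0 ((!) ms ` \<sigma>))" by auto
  then show ?thesis unfolding lcm_face_def using assms by (simp add: Sup_fin.insert)
qed

lemma a_monomial_lcm_face:
  assumes a: "\<And>v. 0 \<le> a v" and "finite \<sigma>"
  shows "a_monomial a (lcm_face ms \<sigma>) \<longleftrightarrow> (\<forall>i\<in>\<sigma>. a_monomial a (ms ! i))"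
  using assms(2)
proof (induction \<sigma> rule: finite_induct)
  case empty
  then show ?case using a by (simp add: lcm_face_def a_monomial_def zero_extended_def)
next
  case (insert i \<sigma>)
  then show ?case unfolding lcm_face_insert[OF insert.hyps(1)] a_monomial_sup by simp
qed

text \<open>The only edge of step \<open>j\<close> that can contain \<tau> joins
  \<open>\<tau> - {j}\<close> to \<open>insert j \<tau>\<close>. Without the quantifier over edges,
  the condition can be transported along an injection of indices.\<close>

lemma mem_pruned_edges_Suc:
  "\<tau> \<in> \<Union>(pruned_edges ms (Suc j)) \<longleftrightarrow> \<tau> \<in> \<Union>(pruned_edges ms j) \<or>
     \<tau> - {j} \<subseteq> {..<length ms} \<and> lcm_face ms (\<tau> - {j}) = lcm_face ms (insert j \<tau>) \<and>
     \<tau> - {j} \<notin> \<Union>(pruned_edges ms j) \<and> insert j \<tau> \<notin> \<Union>(pruned_edges ms j)"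
proof -
  let ?N = "\<lambda>\<sigma>. \<sigma> \<subseteq> {..<length ms} \<and> j \<notin> \<sigma> \<and> lcm_face ms \<sigma> = lcm_face ms (insert j \<sigma>) \<and>
    \<sigma> \<notin> \<Union>(pruned_edges ms j) \<and> insert j \<sigma> \<notin> \<Union>(pruned_edges ms j)"
  have "\<tau> \<in> \<Union>(pruned_edges ms (Suc j)) \<longleftrightarrow> \<tau> \<in> \<Union>(pruned_edges ms j) \<or>
      (\<exists>\<sigma>. ?N \<sigma> \<and> (\<tau> = \<sigma> \<or> \<tau> = insert j \<sigma>))"
    by auto
  also have "(\<exists>\<sigma>. ?N \<sigma> \<and> (\<tau> = \<sigma> \<or> \<tau> = insert j \<sigma>)) \<longleftrightarrow> ?N (\<tau> - {j})"
  proof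
    assume "\<exists>\<sigma>. ?N \<sigma> \<and> (\<tau> = \<sigma> \<or> \<tau> = insert j \<sigma>)"
    then obtain \<sigma> where \<sigma>: "?N \<sigma>" "\<tau> = \<sigma> \<or> \<tau> = insert j \<sigma>" by (elim exE conjE) blast
    then have "\<tau> - {j} = \<sigma>" by blast
    then show "?N (\<tau> - {j})" using \<sigma>(1) by simp
  next
    assume N: "?N (\<tau> - {j})"
    have "\<tau> = \<tau> - {j} \<or> \<tau> = insert j (\<tau> - {j})" by blast
    with N have "?N (\<tau> - {j}) \<and> (\<tau> = \<tau> - {j} \<or> \<tau> = insert j (\<tau> - {j}))" by (rule conjI)
    then show "\<exists>\<sigma>. ?N \<sigma> \<and> (\<tau> = \<sigma> \<or> \<tau> = insert j \<sigma>)" by (rule exI)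
  qed
  also have "?N (\<tau> - {j}) \<longleftrightarrow> \<tau> - {j} \<subseteq> {..<length ms} \<and> lcm_face ms (\<tau> - {j}) = lcm_face ms (insert j \<tau>) \<and>
     \<tau> - {j} \<notin> \<Union>(pruned_edges ms j) \<and> insert j \<tau> \<notin> \<Union>(pruned_edges ms j)"
    by simp
  finally show ?thesis .
qed

context
  fixes a :: "'n::finite \<Rightarrow> int extended" and ms :: "('n \<Rightarrow> nat) list"
  assumes a: "\<And>v. 0 \<le> a v"
begin

text \<open>Positions are kept in increasing order, so \<open>(!) bounded_indices\<close> embeds the
  small simplex in the large one and respects the order of pruning steps.\<close>

definition bounded_indices :: "nat list" where
  "bounded_indices = filter (\<lambda>i. a_monomial a (ms ! i)) [0..<length ms]"

definition bounded_gens :: "('n \<Rightarrow> nat) list" where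
  "bounded_gens = map ((!) ms) bounded_indices"

lemma length_bounded_gens: "length bounded_gens = length bounded_indices"
  by (simp add: bounded_gens_def)

lemma bounded_indices_image: "(!) bounded_indices ` {..<length bounded_gens} = {i. i < length ms \<and> a_monomial a (ms ! i)}"
proof -
  have "(!) bounded_indices ` {..<length bounded_gens} = set bounded_indices"
    by (auto simp: length_bounded_gens set_conv_nth)
  then show ?thesis by (auto simp: bounded_indices_def)
qed

lemma bounded_indices_inj: "inj_on ((!) bounded_indices) {..<length bounded_gens}"
  by (rule inj_on_nth) (auto simp: bounded_indices_def length_bounded_gens)

lemma set_bounded_gens: "set bounded_gens = {t \<in> set ms. a_monomial a t}"
  by (auto simp: bounded_gens_def bounded_indices_def in_set_conv_nth)

lemma distinct_bounded_gens:
  assumes "distinct ms"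
  shows "distinct bounded_gens"
  using assms by (auto simp: bounded_gens_def bounded_indices_def distinct_map inj_on_def nth_eq_iff_index_eq)

lemma lcm_face_bounded_gens:
  assumes "\<sigma> \<subseteq> {..<length bounded_gens}"
  shows "lcm_face bounded_gens \<sigma> = lcm_face ms ((!) bounded_indices ` \<sigma>)"
proof -
  have "(!) bounded_gens ` \<sigma> = (!) ms ` (!) bounded_indices ` \<sigma>"
    unfolding image_image
    by (rule image_cong) (use assms in \<open>auto simp: bounded_gens_def\<close>)
  then show ?thesis by (simp add: lcm_face_def)
qed

text \<open>The two prunings run at different speeds: \<open>j\<close> steps for \<open>ms\<close>
  correspond to as many steps for \<open>bounded_gens\<close> as there are bounded generators among
  the first \<open>j\<close>.\<close>

lemma pruned_bounded_gens:
  assumes "\<sigma> \<subseteq> {..<length bounded_gens}" "j \<le> length ms"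
  shows "\<sigma> \<in> \<Union>(pruned_edges bounded_gens (length (filter (\<lambda>i. a_monomial a (ms ! i)) [0..<j]))) \<longleftrightarrow>
    (!) bounded_indices ` \<sigma> \<in> \<Union>(pruned_edges ms j)"
  using assms
proof (induction j arbitrary: \<sigma>)
  case 0
  then show ?case by simp
next
  case (Suc j)
  let ?e = "(!) bounded_indices" and ?n = "length (filter (\<lambda>i. a_monomial a (ms ! i)) [0..<j])"
  have IH: "\<sigma> \<in> \<Union>(pruned_edges bounded_gens ?n) \<longleftrightarrow> ?e ` \<sigma> \<in> \<Union>(pruned_edges ms j)"
    if "\<sigma> \<subseteq> {..<length bounded_gens}" for \<sigma>
    using Suc.IH[OF that] Suc.prems(2) by simp
  have fin: "finite \<sigma>" using Suc.prems(1) finite_subset by blast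
  have sub: "?e ` \<sigma> \<subseteq> {i. i < length ms \<and> a_monomial a (ms ! i)}"
    using Suc.prems(1) bounded_indices_image by blast
  show ?case
  proof (cases "a_monomial a (ms ! j)")
    case True
    \<comment> \<open>The prefix before \<open>j\<close> has length \<open>?n\<close>, so step
      \<open>?n\<close> of the short pruning and step \<open>j\<close> of the long one treat the
      same generator.\<close>
    have split: "bounded_indices = filter (\<lambda>i. a_monomial a (ms ! i)) [0..<j] @ j #
        filter (\<lambda>i. a_monomial a (ms ! i)) [Suc j..<length ms]"
    proof -
      have "[0..<length ms] = [0..<j] @ j # [Suc j..<length ms]"
        using Suc.prems(2) upt_add_eq_append[of 0 j "length ms - j"] upt_conv_Cons[of j "length ms"] by simp
      then show ?thesis using True by (simp add: bounded_indices_def)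
    qed
    have n: "?n < length bounded_gens" "?e ?n = j"
      unfolding length_bounded_gens by (simp_all add: split)
    have len: "length (filter (\<lambda>i. a_monomial a (ms ! i)) [0..<Suc j]) = Suc ?n" using True by simp
    have \<sigma>n: "\<sigma> - {?n} \<subseteq> {..<length bounded_gens}" "insert ?n \<sigma> \<subseteq> {..<length bounded_gens}"
      using Suc.prems(1) n(1) by auto
    have e: "?e ` (\<sigma> - {?n}) = ?e ` \<sigma> - {j}" "?e ` insert ?n \<sigma> = insert j (?e ` \<sigma>)"
      using inj_on_image_set_diff[OF bounded_indices_inj, of \<sigma> "{?n}"] Suc.prems(1) n by auto
    have "?e ` \<sigma> - {j} \<subseteq> {..<length ms}" using sub by auto
    then show ?thesis
      unfolding len mem_pruned_edges_Suc[of _ _ ?n] mem_pruned_edges_Suc[of _ _ j]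
        IH[OF Suc.prems(1)] IH[OF \<sigma>n(1)] IH[OF \<sigma>n(2)] lcm_face_bounded_gens[OF \<sigma>n(1)]
        lcm_face_bounded_gens[OF \<sigma>n(2)] e
      using \<sigma>n(1) by blast
  next
    case False
    \<comment> \<open>The lcm of a bounded face is bounded, and adjoining the unbounded generator
      \<open>j\<close> destroys this. So no edge of this step meets a bounded face.\<close>
    have "lcm_face ms (?e ` \<sigma> - {j}) \<noteq> lcm_face ms (insert j (?e ` \<sigma>))"
    proof
      assume "lcm_face ms (?e ` \<sigma> - {j}) = lcm_face ms (insert j (?e ` \<sigma>))"
      moreover have "a_monomial a (lcm_face ms (?e ` \<sigma> - {j}))"
        using sub fin by (subst a_monomial_lcm_face[of a, OF a]) auto
      ultimately show False using False fin by (simp add: a_monomial_lcm_face[of a, OF a])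
    qed
    then show ?thesis
      unfolding mem_pruned_edges_Suc[of _ _ j] using False IH[OF Suc.prems(1)] by simp
  qed
qed

lemma critical_bounded_gens:
  assumes "\<sigma> \<subseteq> {..<length bounded_gens}"
  shows "\<sigma> \<in> critical_faces bounded_gens \<longleftrightarrow> (!) bounded_indices ` \<sigma> \<in> critical_faces ms"
proof -
  have "(!) bounded_indices ` \<sigma> \<subseteq> {..<length ms}"
    using assms bounded_indices_image by blast
  moreover have "length (filter (\<lambda>i. a_monomial a (ms ! i)) [0..<length ms]) = length bounded_gens"
    by (simp add: length_bounded_gens bounded_indices_def)
  ultimately show ?thesis
    using pruned_bounded_gens[OF assms order_refl] assms by (simp add: critical_faces_def)
qed

text \<open>A face of \<open>ms\<close> with bounded lcm has only bounded vertices, hence comes from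
  the short list. In the remaining degrees the short list has no faces.\<close>

lemma card_critical_bounded_gens:
  "card {\<sigma> \<in> critical_faces bounded_gens. card \<sigma> = i \<and> mdeg (lcm_face bounded_gens \<sigma>) = \<alpha>} =
    (if bounded_degree a \<alpha> then card {\<sigma> \<in> critical_faces ms. card \<sigma> = i \<and> mdeg (lcm_face ms \<sigma>) = \<alpha>} else 0)"
proof -
  let ?e = "(!) bounded_indices" and ?N = "{..<length bounded_gens}"
  let ?S = "{\<sigma> \<in> critical_faces bounded_gens. card \<sigma> = i \<and> mdeg (lcm_face bounded_gens \<sigma>) = \<alpha>}"
  let ?T = "{\<sigma> \<in> critical_faces ms. card \<sigma> = i \<and> mdeg (lcm_face ms \<sigma>) = \<alpha>}"
  have crit: "\<sigma> \<subseteq> ?N" if "\<sigma> \<in> critical_faces bounded_gens" for \<sigma>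
    using that by (auto simp: critical_faces_def)
  show ?thesis
  proof (cases "bounded_degree a \<alpha>")
    case True
    have "bij_betw ((`) ?e) ?S ?T"
    proof (rule bij_betwI')
      fix \<sigma> \<tau> assume "\<sigma> \<in> ?S" "\<tau> \<in> ?S"
      then show "?e ` \<sigma> = ?e ` \<tau> \<longleftrightarrow> \<sigma> = \<tau>"
        using inj_on_image_eq_iff[OF bounded_indices_inj] crit by blast
    next
      fix \<sigma> assume \<sigma>: "\<sigma> \<in> ?S"
      then have s: "\<sigma> \<subseteq> ?N" using crit by blast
      have "card (?e ` \<sigma>) = card \<sigma>" by (rule card_image[OF inj_on_subset[OF bounded_indices_inj s]])
      then show "?e ` \<sigma> \<in> ?T" using \<sigma> critical_bounded_gens[OF s] lcm_face_bounded_gens[OF s] by simp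
    next
      fix \<tau> assume \<tau>: "\<tau> \<in> ?T"
      then have "\<tau> \<subseteq> {..<length ms}" by (auto simp: critical_faces_def)
      moreover from this have "finite \<tau>" using finite_subset by blast
      then have "\<forall>i\<in>\<tau>. a_monomial a (ms ! i)"
        using a_monomial_lcm_face[of a, OF a] \<tau> True by (auto simp: a_monomial_mdeg)
      ultimately have "\<tau> \<subseteq> ?e ` ?N" unfolding bounded_indices_image by auto
      then obtain \<sigma> where \<sigma>: "\<sigma> \<subseteq> ?N" "\<tau> = ?e ` \<sigma>" by (auto simp: subset_image_iff)
      have "card (?e ` \<sigma>) = card \<sigma>" by (rule card_image[OF inj_on_subset[OF bounded_indices_inj \<sigma>(1)]])
      then have "\<sigma> \<in> ?S"
        using \<tau> critical_bounded_gens[OF \<sigma>(1)] lcm_face_bounded_gens[OF \<sigma>(1)] unfolding \<sigma>(2) by simp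
      then show "\<exists>\<sigma>\<in>?S. \<tau> = ?e ` \<sigma>" using \<sigma>(2) by blast
    qed
    then show ?thesis using True bij_betw_same_card by auto
  next
    case False
    have "mdeg (lcm_face bounded_gens \<sigma>) \<noteq> \<alpha>" if "\<sigma> \<in> critical_faces bounded_gens" for \<sigma>
    proof -
      have "finite \<sigma>" "\<forall>i\<in>\<sigma>. a_monomial a (bounded_gens ! i)"
        using crit[OF that] set_bounded_gens nth_mem finite_subset by blast+
      then have "a_monomial a (lcm_face bounded_gens \<sigma>)" by (simp add: a_monomial_lcm_face[of a, OF a])
      then show ?thesis using False by (auto simp: a_monomial_mdeg)
    qed
    then have "?S = {}" by blast
    then show ?thesis using False by (simp only: card.empty if_False)
  qed
qed

end

lemma minimal_pruned_order_truncated: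
  assumes a: "\<And>v. 0 \<le> a v" and I: "monomial_ideal I" and ms: "minimal_pruned_order I ms"
  shows "minimal_pruned_order (truncated_ideal a I) (bounded_gens a ms)"
proof -
  have "card {\<sigma> \<in> critical_faces (bounded_gens a ms). card \<sigma> = i \<and> mdeg (lcm_face (bounded_gens a ms) \<sigma>) = \<alpha>} =
      betti_quotient (truncated_ideal a I) i \<alpha>" for i \<alpha>
    unfolding card_critical_bounded_gens[of a, OF a] betti_quotient_truncated[of a, OF a I]
    using ms by (simp add: minimal_pruned_order_def)
  then show ?thesis
    using ms unfolding minimal_pruned_order_def min_gens_truncated_ideal
    by (simp add: distinct_bounded_gens[of a, OF a] set_bounded_gens[of a, OF a])
qed

text \<open>Induction over the derivation handles arbitrarily nested splittings. The premise about
  the intersection fits because truncation commutes with it.\<close>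

lemma admits_truncated:
  assumes a: "\<And>v. 0 \<le> a v" and "admits_minimal_pruned_resolution J"
  shows "admits_minimal_pruned_resolution (truncated_ideal a J)"
  using assms(2)
proof (induction rule: admits_minimal_pruned_resolution.induct)
  case (order I ms)
  then show ?case
    using minimal_pruned_order_truncated[of a, OF a] monomial_truncated_ideal
    by (blast intro: admits_minimal_pruned_resolution.order)
next
  case (splitting I J K)
  have M: "a v \<noteq> Minf" for v using a[of v] by (cases "a v") (auto simp: zero_extended_def)
  have "truncated_ideal a (J \<inter> K) = truncated_ideal a J \<inter> truncated_ideal a K"
    using splitting.hyps(1) by (intro truncated_ideal_Int) (auto simp: betti_splitting_def)
  then show ?case
    using betti_splitting_truncated[of a, OF M splitting.hyps(1)] splitting.IH
    by (metis admits_minimal_pruned_resolution.splitting)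
qed

section \<open>The zero ideal, and the identification of \<open>I\<close> with a truncation of
  \<open>J\<close>\<close>

lemma betti_quotient_zero:
  "betti_quotient ({0} :: ('n::finite, 'k::field) mpoly set) i \<alpha> = (if i = 0 \<and> \<alpha> = 0 then 1 else 0)"
proof -
  \<comment> \<open>R resolves itself, with one generator of degree 0. It matches the empty face,
    the only face for an empty list of generators.\<close>
  define X :: "('n \<Rightarrow> int, 'k) strands" where
    "X = \<lparr>cells = (\<lambda>i. if i = 0 then {0} else {}), cdeg = (\<lambda>_ _. 0), bd = (\<lambda>_ _ _. 0),
      augc = (\<lambda>j. if j = 0 then 1 else 0)\<rparr>"
  have "strand_resolution (in_degree (expo (UNIV :: ('n, 'k) mpoly set)))
      (in_degree (expo ({0} :: ('n, 'k) mpoly set))) X"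
    unfolding strand_resolution_def monomial_ideal_UNIV(2) monomial_ideal_zero(2)
  proof (intro conjI allI impI)
    fix i :: nat and \<alpha> :: "'n \<Rightarrow> int"
    have z: "(\<lambda>_. 0) \<in> chains X i \<alpha>" for i by (simp add: fsupp_def)
    have b: "bdmap X i u = (\<lambda>_. 0)" for u by (simp add: bdmap_def mapply_def X_def)
    have "cycles (in_degree {}) X i \<alpha> = {\<lambda>_. 0}"
    proof (cases i)
      case 0
      then show ?thesis
        by (auto simp: X_def fsupp_def augm_def in_degree_def fun_eq_iff)
    next
      case (Suc n)
      then show ?thesis using z[of i] by (auto simp: X_def fsupp_def bdmap_def mapply_def)
    qed
    moreover have "bdmap X i ` chains X (Suc i) \<alpha> = {\<lambda>_. 0}" using z[of "Suc i"] by (auto simp: b)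
    ultimately show "cycles (in_degree {}) X i \<alpha> = bdmap X i ` chains X (Suc i) \<alpha>" by simp
  next
    fix \<alpha> :: "'n \<Rightarrow> int" assume "in_degree UNIV \<alpha> \<and> \<not> in_degree {} \<alpha>"
    then show "\<exists>u\<in>chains X 0 \<alpha>. augm X u \<noteq> 0"
      by (intro bexI[of _ "\<lambda>j. if j = 0 then 1 else 0"])
         (auto simp: X_def fsupp_def augm_def in_degree_def)
  qed (auto simp: X_def graded_def in_degree_def split: if_splits)
  moreover have "minimal_strands X" by (simp add: minimal_strands_def X_def)
  ultimately have "betti_quotient ({0} :: ('n, 'k) mpoly set) i \<alpha> = card {j \<in> cells X i. cdeg X i j = \<alpha>}"
    using betti_eq_card[OF monomial_ideal_UNIV(1) monomial_ideal_zero(1)] by blast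
  also have "{j \<in> cells X i. cdeg X i j = \<alpha>} = (if i = 0 \<and> \<alpha> = 0 then {0} else {})"
    by (auto simp: X_def)
  finally show ?thesis by simp
qed

lemma admits_zero: "admits_minimal_pruned_resolution ({0} :: ('n::finite, 'k::field) mpoly set)"
proof (rule admits_minimal_pruned_resolution.order[OF monomial_ideal_zero(1)])
  let ?ms = "[] :: ('n \<Rightarrow> nat) list"
  have c: "critical_faces ?ms = {{}}" by (auto simp: critical_faces_def)
  have "mdeg (0 :: 'n \<Rightarrow> nat) = 0" by (simp add: mdeg_def fun_eq_iff)
  then have "{\<sigma> \<in> critical_faces ?ms. card \<sigma> = i \<and> mdeg (lcm_face ?ms \<sigma>) = \<alpha>} =
      (if i = 0 \<and> \<alpha> = 0 then {{}} else {})" for i \<alpha>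
    by (auto simp: c lcm_face_def)
  then show "minimal_pruned_order ({0} :: ('n, 'k) mpoly set) ?ms"
    unfolding minimal_pruned_order_def betti_quotient_zero
    by (auto simp: min_gens_expo monomial_ideal_zero(2))
qed

theorem proposition6p15:
  fixes a :: "'n::finite \<Rightarrow> int extended"
    and I J :: "('n, 'k::field) mpoly set"
    and m :: "nat \<Rightarrow> 'n \<Rightarrow> nat"
    and q :: nat
  assumes "\<And>v. a v \<noteq> Minf"
    and "a_ideal a I"
    and "J = I + gen_ideal {monomial (m i) | i. i \<in> {1..q}}"
    and "\<And>i. i \<in> {1..q} \<Longrightarrow> m i \<in> min_gens J \<and> \<not> a_monomial a (m i)"
    and "admits_minimal_pruned_resolution J"
  shows "admits_minimal_pruned_resolution I"
proof -
  have I: "monomial_ideal I" and bounded: "\<And>t. t \<in> min_gens I \<Longrightarrow> a_monomial a t"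
    using assms(2) by (auto simp: a_ideal_def)
  show ?thesis
  proof (cases "\<forall>v. 0 \<le> a v")
    case True
    have "{monomial (m i) | i. i \<in> {1..q}} = (monomial ` m ` {1..q} :: ('n, 'k) mpoly set)" by auto
    then have expoJ: "expo J = expo I \<union> {t. \<exists>i\<in>{1..q}. m i \<le> t}"
      unfolding assms(3) by (simp add: monomial_ideal_plus(2)[OF I monomial_ideal_gen] expo_gen_ideal)
    have above: "\<not> a_monomial a t" if "i \<in> {1..q}" "m i \<le> t" for i t
      using assms(4)[OF that(1)] a_monomial_antimono[OF _ that(2)] by blast
    have "I = truncated_ideal a J"
    proof (rule monomial_ideal_eqI[OF I monomial_truncated_ideal], intro equalityI subsetI)
      fix t assume "t \<in> expo I"
      then obtain g where g: "g \<in> min_gens I" "g \<le> t" by (rule min_gens_below)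
      \<comment> \<open>If \<open>s\<close> lay in \<open>J\<close> because of some
        \<open>m i\<close>, then \<open>m i\<close> would divide the \<open>a\<close>-monomial
        \<open>g\<close>. So minimal generators of \<open>I\<close> stay minimal in
        \<open>J\<close>.\<close>
      have "s = g" if "s \<in> expo J" "s \<le> g" for s
      proof -
        have "s \<in> expo I" using that above[of _ g] bounded[OF g(1)] unfolding expoJ by (blast intro: order_trans)
        then show ?thesis using that(2) g(1) by (simp add: min_gens_expo)
      qed
      then have "g \<in> min_gens J" using g(1) by (auto simp: expoJ min_gens_expo)
      then show "t \<in> expo (truncated_ideal a J)" using g(2) bounded[OF g(1)] by (auto simp: expo_truncated_ideal)
    next
      fix t assume "t \<in> expo (truncated_ideal a J)"
      then obtain g where g: "g \<in> min_gens J" "a_monomial a g" "g \<le> t" by (auto simp: expo_truncated_ideal)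
      \<comment> \<open>A bounded monomial is divisible by no \<open>m i\<close>, so it belongs to
        \<open>J\<close> only through \<open>I\<close>.\<close>
      then have "g \<in> expo I" using above by (auto simp: min_gens_expo expoJ)
      then show "t \<in> expo I" using expo_upclosed[OF I] g(3) by blast
    qed
    then show ?thesis using admits_truncated[of a, OF _ assms(5)] True by simp
  next
    case False
    then have "\<not> a_monomial a t" for t
    proof -
      obtain v where v: "\<not> 0 \<le> a v" using False by blast
      then have "\<not> Fin (int (t v)) \<le> a v" by (cases "a v") (auto simp: zero_extended_def)
      then show ?thesis by (auto simp: a_monomial_def)
    qed
    then have "expo I = {}" using bounded min_gens_below by blast
    then have "I = {0}" by (intro monomial_ideal_eqI[OF I monomial_ideal_zero(1)]) (simp add: monomial_ideal_zero(2))
    then show ?thesis using admits_zero by simp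
  qed
qed

end
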